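(* Let $p$ be a prime and let $F$ be a field containing a primitive $p$-th root of unity. Let $a,b\in F^\times$ be linearly independent modulo $(F^\times)^p$. Let $k<p$ be a positive integer. Assume that $\chi_a\cup\chi_b=0$ in $H^2(G_F,\mathbb{F}_p)$. Then: (1) the $(k+1)$-fold Massey products $\langle\chi_b,\chi_a,\ldots,\chi_a\rangle$ and $\langle\chi_a,\ldots,\chi_a,\chi_b\rangle$ ($k$ copies of $\chi_a$) are defined and contain $0$; (2) the $(k+2)$-fold Massey products $\langle\chi_a,\chi_b,\chi_a,\ldots,\chi_a\rangle$ and $\langle\chi_a,\ldots,\chi_a,\chi_b,\chi_a\rangle$ ($k+1$ copies of $\chi_a$) are defined and contain $0$.
   Context: $G_F=\mathrm{Gal}(F_s/F)$ is the absolute Galois group. Fix a primitive $p$-th root of unity $\xi\in F$, identifying $\mu_p$ with $\mathbb{F}_p$. For $a\in F^\times$, $\chi_a\in H^1(G_F,\mathbb{F}_p)=\mathrm{Hom}(G_F,\mathbb{F}_p)$ is the Kummer character: $\sigma(\sqrt[p]{a})=\xi^{\chi_a(\sigma)}\sqrt[p]{a}$. "Linearly independent modulo $(F^\times)^p$" means linearly independent in the $\mathbb{F}_p$-vector space $F^\times/(F^\times)^p$. For a profinite group $G$, $C^\bullet(G,\mathbb{F}_p)$ is the differential graded algebra of inhomogeneous continuous cochains with trivial coefficients; in degree 1, $(\partial f)(\sigma,\tau)=f(\sigma)+f(\tau)-f(\sigma\tau)$ and $(f\cup g)(\sigma,\tau)=f(\sigma)g(\tau)$. Massey products: let $n\ge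 3$ and $a_1,\ldots,a_n\in H^1(G,\mathbb{F}_p)=\mathrm{Hom}(G,\mathbb{F}_p)$. A defining system for the $n$-fold Massey product $\langle a_1,\ldots,a_n\rangle$ is a collection $\mathcal{M}=\{a_{ij}\in C^1(G,\mathbb{F}_p)\mid 1\le i<j\le n+1,\ (i,j)\ne(1,n+1)\}$ such that $a_{i,i+1}=a_i$ for all $i$ and $\partial a_{ij}=\sum_{l=i+1}^{j-1}a_{il}\cup a_{lj}$ whenever $i+1<j$. Then $\sum_{l=2}^{n}a_{1l}\cup a_{l,n+1}$ is a 2-cocycle, and its class in $H^2(G,\mathbb{F}_p)$ is the value $\langle a_1,\ldots,a_n\rangle_{\mathcal{M}}$. The Massey product $\langle a_1,\ldots,a_n\rangle\subseteq H^2(G,\mathbb{F}_p)$ is the set of all values over all defining systems; it is defined if a defining system exists. For $n=2$ (which occurs in (1) when $k=1$), $\langle a_1,a_2\rangle$ is always defined and equals $\{a_1\cup a_2\}$. *)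

theory Defs
  imports
    "HOL-Analysis.Function_Topology"
    "HOL-Analysis.Product_Topology"
    "HOL-Algebra.Bij"
    "HOL-Algebra.Algebraic_Closure_Type"
    "Berlekamp_Zassenhaus.Finite_Field"
begin

section \<open>Continuous cochains in degrees 1 and 2\<close>

text \<open>
  The prime field with p elements is \<open>'p mod_ring\<close> with \<open>'p :: prime_card\<close>, p being
  \<open>CARD('p)\<close>; it carries the discrete topology.
  Elements of a group are elements of its carrier, so only the values of a cochain on the
  carrier are meaningful. Equality of cochains is therefore always stated pointwise on the
  carrier.
\<close>

record 'g topgroup = "'g monoid" +
  group_topology :: "'g topology"

definition cochains1 :: "('g, 'm) topgroup_scheme \<Rightarrow> ('g \<Rightarrow> 'p::prime_card mod_ring) set"
  where "cochains1 G = {f. continuous_map (group_topology G) (discrete_topology UNIV) f}"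

definition cochains2 :: "('g, 'm) topgroup_scheme \<Rightarrow> ('g \<Rightarrow> 'g \<Rightarrow> 'p::prime_card mod_ring) set"
  where "cochains2 G =
    {c. continuous_map (prod_topology (group_topology G) (group_topology G))
          (discrete_topology UNIV) (\<lambda>(\<sigma>, \<tau>). c \<sigma> \<tau>)}"

definition coboundary1 ::
  "('g, 'm) topgroup_scheme \<Rightarrow> ('g \<Rightarrow> 'p::prime_card mod_ring) \<Rightarrow> 'g \<Rightarrow> 'g \<Rightarrow> 'p mod_ring"
  where "coboundary1 G f \<sigma> \<tau> = f \<sigma> + f \<tau> - f (\<sigma> \<otimes>\<^bsub>G\<^esub> \<tau>)"

definition coboundary2 ::
  "('g, 'm) topgroup_scheme \<Rightarrow> ('g \<Rightarrow> 'g \<Rightarrow> 'p::prime_card mod_ring)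
    \<Rightarrow> 'g \<Rightarrow> 'g \<Rightarrow> 'g \<Rightarrow> 'p mod_ring"
  where "coboundary2 G c \<rho> \<sigma> \<tau> =
    c \<sigma> \<tau> - c (\<rho> \<otimes>\<^bsub>G\<^esub> \<sigma>) \<tau> + c \<rho> (\<sigma> \<otimes>\<^bsub>G\<^esub> \<tau>) - c \<rho> \<sigma>"

definition cup :: "('g \<Rightarrow> 'p::prime_card mod_ring) \<Rightarrow> ('g \<Rightarrow> 'p mod_ring) \<Rightarrow> 'g \<Rightarrow> 'g \<Rightarrow> 'p mod_ring"
  where "cup f g \<sigma> \<tau> = f \<sigma> * g \<tau>"

definition cocycles2 :: "('g, 'm) topgroup_scheme \<Rightarrow> ('g \<Rightarrow> 'g \<Rightarrow> 'p::prime_card mod_ring) set"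
  where "cocycles2 G =
    {c \<in> cochains2 G. \<forall>\<rho>\<in>carrier G. \<forall>\<sigma>\<in>carrier G. \<forall>\<tau>\<in>carrier G. coboundary2 G c \<rho> \<sigma> \<tau> = 0}"

definition cohomologous2 ::
  "('g, 'm) topgroup_scheme
    \<Rightarrow> (('g \<Rightarrow> 'g \<Rightarrow> 'p::prime_card mod_ring) \<times> ('g \<Rightarrow> 'g \<Rightarrow> 'p mod_ring)) set"
  where "cohomologous2 G =
    {(c, d). c \<in> cocycles2 G \<and> d \<in> cocycles2 G \<and>
       (\<exists>f\<in>cochains1 G. \<forall>\<sigma>\<in>carrier G. \<forall>\<tau>\<in>carrier G. c \<sigma> \<tau> - d \<sigma> \<tau> = coboundary1 G f \<sigma> \<tau>)}"

text \<open>
  The second cohomology group is \<open>cocycles2 G // cohomologous2 G\<close>; classes of cocycles are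
  its elements.
\<close>

definition H2_class ::
  "('g, 'm) topgroup_scheme \<Rightarrow> ('g \<Rightarrow> 'g \<Rightarrow> 'p::prime_card mod_ring)
    \<Rightarrow> ('g \<Rightarrow> 'g \<Rightarrow> 'p mod_ring) set"
  where "H2_class G c = cohomologous2 G `` {c}"

definition H2_zero :: "('g, 'm) topgroup_scheme \<Rightarrow> ('g \<Rightarrow> 'g \<Rightarrow> 'p::prime_card mod_ring) set"
  where "H2_zero G = H2_class G (\<lambda>\<sigma> \<tau>. 0)"


section \<open>Massey products\<close>

text \<open>
  The list \<open>as\<close> holds the n entries of the product, the i-th one (counted from 1) being
  \<open>as ! (i - 1)\<close>. Only the values \<open>M i j\<close> with \<open>1 \<le> i < j \<le> n + 1\<close> and
  \<open>(i, j) \<noteq> (1, n + 1)\<close> matter. For n = 2 the only conditions are that \<open>M 1 2\<close> and \<open>M 2 3\<close>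
  are the two entries, so the product is the singleton of the class of their cup product.
\<close>

definition defining_system ::
  "('g, 'm) topgroup_scheme \<Rightarrow> ('g \<Rightarrow> 'p::prime_card mod_ring) list
    \<Rightarrow> (nat \<Rightarrow> nat \<Rightarrow> 'g \<Rightarrow> 'p mod_ring) \<Rightarrow> bool"
  where "defining_system G as M \<longleftrightarrow>
    (let n = length as in
      (\<forall>i j. 1 \<le> i \<and> i < j \<and> j \<le> n + 1 \<and> (i, j) \<noteq> (1, n + 1) \<longrightarrow> M i j \<in> cochains1 G) \<and>
      (\<forall>i\<in>{1..n}. \<forall>\<sigma>\<in>carrier G. M i (i + 1) \<sigma> = (as ! (i - 1)) \<sigma>) \<and>
      (\<forall>i j. 1 \<le> i \<and> i + 1 < j \<and> j \<le> n + 1 \<and> (i, j) \<noteq> (1, n + 1) \<longrightarrow>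
        (\<forall>\<sigma>\<in>carrier G. \<forall>\<tau>\<in>carrier G.
          coboundary1 G (M i j) \<sigma> \<tau> = (\<Sum>l = i + 1..j - 1. cup (M i l) (M l j) \<sigma> \<tau>))))"

definition massey_value ::
  "('g, 'm) topgroup_scheme \<Rightarrow> nat \<Rightarrow> (nat \<Rightarrow> nat \<Rightarrow> 'g \<Rightarrow> 'p::prime_card mod_ring)
    \<Rightarrow> ('g \<Rightarrow> 'g \<Rightarrow> 'p mod_ring) set"
  where "massey_value G n M =
    H2_class G (\<lambda>\<sigma> \<tau>. \<Sum>l = 2..n. cup (M 1 l) (M l (n + 1)) \<sigma> \<tau>)"

definition massey_product ::
  "('g, 'm) topgroup_scheme \<Rightarrow> ('g \<Rightarrow> 'p::prime_card mod_ring) list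
    \<Rightarrow> ('g \<Rightarrow> 'g \<Rightarrow> 'p mod_ring) set set"
  where "massey_product G as = {massey_value G (length as) M | M. defining_system G as M}"

definition massey_defined ::
  "('g, 'm) topgroup_scheme \<Rightarrow> ('g \<Rightarrow> 'p::prime_card mod_ring) list \<Rightarrow> bool"
  where "massey_defined G as \<longleftrightarrow> (\<exists>M. defining_system G as M)"


section \<open>The absolute Galois group and Kummer characters\<close>

text \<open>
  The separable closure of the field \<open>'a\<close>, formed inside its algebraic closure: the elements
  whose minimal polynomial has only simple roots.
\<close>

definition sep_closure :: "'a::field alg_closure set"
  where "sep_closure =
    {x. \<exists>f :: 'a poly. Factorial_Ring.irreducible f \<and> rsquarefree (map_poly to_ac f) \<and>
          poly (map_poly to_ac f) x = 0}"

definition galois_automorphisms :: "('a::field alg_closure \<Rightarrow> 'a alg_closure) set"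
  where "galois_automorphisms =
    {\<sigma> \<in> Bij sep_closure.
       (\<forall>x\<in>sep_closure. \<forall>y\<in>sep_closure. \<sigma> (x + y) = \<sigma> x + \<sigma> y \<and> \<sigma> (x * y) = \<sigma> x * \<sigma> y) \<and>
       (\<forall>c. \<sigma> (to_ac c) = to_ac c)}"

text \<open>
  The Krull topology is the topology of pointwise convergence on the discrete set
  \<open>sep_closure\<close>: the automorphisms agreeing with a given \<open>\<sigma>\<close> on a finite set S form
  the coset of \<open>\<sigma>\<close> modulo the Galois group over the finite extension generated by S.
\<close>

definition krull_topology :: "('a::field alg_closure \<Rightarrow> 'a alg_closure) topology"
  where "krull_topology =
    subtopology (product_topology (\<lambda>_. discrete_topology sep_closure) sep_closure)
      galois_automorphisms"

definition absolute_galois_group :: "('a::field alg_closure \<Rightarrow> 'a alg_closure) topgroup"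
  where "absolute_galois_group =
    \<lparr>carrier = galois_automorphisms,
     monoid.mult = monoid.mult (BijGroup sep_closure),
     monoid.one = monoid.one (BijGroup sep_closure),
     group_topology = krull_topology\<rparr>"

definition primitive_root_of_unity :: "nat \<Rightarrow> 'a::field \<Rightarrow> bool"
  where "primitive_root_of_unity n \<xi> \<longleftrightarrow> \<xi> ^ n = 1 \<and> (\<forall>m. 0 < m \<and> m < n \<longrightarrow> \<xi> ^ m \<noteq> 1)"

text \<open>
  The defining equation is required for every p-th root \<open>\<alpha>\<close> of \<open>a\<close>; as these roots differ by
  powers of \<open>\<xi>\<close>, which are fixed by \<open>\<sigma>\<close>, they all yield the same exponent.
\<close>

definition kummer_char ::
  "'a::field \<Rightarrow> 'a \<Rightarrow> ('a alg_closure \<Rightarrow> 'a alg_closure) \<Rightarrow> 'p::prime_card mod_ring"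
  where "kummer_char \<xi> a \<sigma> =
    (THE c :: 'p mod_ring. \<forall>\<alpha>\<in>sep_closure. \<alpha> ^ CARD('p) = to_ac a \<longrightarrow>
       \<sigma> \<alpha> = to_ac \<xi> ^ nat (to_int_mod_ring c) * \<alpha>)"

text \<open>
  Linear independence of the classes of two nonzero elements in the vector space, over the
  field with p elements, of nonzero elements modulo p-th powers (written multiplicatively,
  integer exponents representing the scalars).
\<close>

definition independent_mod_powers :: "nat \<Rightarrow> 'a::field \<Rightarrow> 'a \<Rightarrow> bool"
  where "independent_mod_powers p a b \<longleftrightarrow>
    (\<forall>i j :: int. (\<exists>c. c \<noteq> 0 \<and> a powi i * b powi j = c ^ p) \<longrightarrow> int p dvd i \<and> int p dvd j)"

end

theory Submission
  imports Defs
begin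

text \<open>
  Write \<open>\<chi>\<close> for \<open>\<chi>a\<close> and \<open>p\<close> for the characteristic of the coefficients. If a defining system
  can be completed by a cochain in its corner \<open>(1, n + 1)\<close>, satisfying the same equation as the other
  entries, then the corner exhibits the value of the Massey product as a coboundary
  (\<open>complete_system_imp_massey\<close>). All four assertions therefore ask for complete systems.

  The group-theoretic half. Let \<open>\<chi>\<close> be a character of a group, and let cochains \<open>f i\<close>, indexed by
  the prime field, satisfy \<open>f i (\<sigma>\<tau>) = f i \<tau> + f (i + \<chi> \<tau>) \<sigma>\<close>. In other words, \<open>f\<close> is a crossed
  homomorphism into the functions on the prime field, on which the group acts by translation
  through \<open>\<chi>\<close>; if \<open>\<chi>\<close> is nonzero, this is the module induced from the kernel of \<open>\<chi>\<close>. Put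
  \<open>\<psi> = \<Sum>i. f i\<close>. Translating a divided power \<open>i ^ m / m!\<close> by \<open>t\<close> yields a combination of
  those with exponent at most \<open>m\<close> whose coefficients are divided powers of \<open>t\<close>, so the moments
  \<open>\<Sum>i. i ^ m / m! * f i\<close> with \<open>m \<le> k\<close> and the divided powers of \<open>\<chi>\<close> form a complete
  system for \<open>\<psi>, \<chi>, ..., \<chi>\<close>. The inequality \<open>k < p\<close> makes the factorials invertible. One more row
  with first entry \<open>\<chi>\<close> can be added: the cup product of \<open>\<chi>\<close> with the class of \<open>f\<close> corresponds
  to a cup product on the kernel of \<open>\<chi>\<close>, where \<open>\<chi>\<close> vanishes, and it is bounded by the explicit
  family \<open>- (i + \<chi>) * f i\<close>. This is \<open>complete_system_of_twisted_family\<close>. The products in the reverse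
  order come from the opposite group (\<open>massey_of_twisted_family\<close>).

  The arithmetic half. A family with \<open>\<psi> = \<chi>b\<close> can be read off from \<open>p\<close>-th roots of elements \<open>d i\<close> of
  product \<open>b\<close> that every \<open>\<sigma>\<close> permutes by \<open>d i \<mapsto> d (i + \<chi> \<sigma>)\<close> (\<open>ex_twisted_family\<close>); such elements are
  the conjugates of an element of norm \<open>b\<close> in the extension generated by a \<open>p\<close>-th root of \<open>a\<close>. To find
  them, write the cup product of \<open>\<chi>a\<close> and \<open>\<chi>b\<close> as the coboundary of \<open>\<phi>\<close>. On the kernel \<open>H\<close> of
  \<open>\<chi>a\<close> the cochain \<open>\<phi>\<close> is a homomorphism, and Hilbert's Theorem 90 gives \<open>\<gamma> \<noteq> 0\<close> with
  \<open>h \<gamma> = \<xi> ^ \<phi> h * \<gamma>\<close> for \<open>h\<close> in \<open>H\<close>. Since \<open>a\<close> and \<open>b\<close> are independent there is an automorphism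
  \<open>s\<close> with \<open>\<chi>a s = 1\<close> and \<open>\<chi>b s = 0\<close>. If \<open>\<beta>\<close> is a \<open>p\<close>-th root of \<open>b\<close>, then
  \<open>\<gamma> * \<beta> / s \<gamma>\<close> is fixed by \<open>H\<close>, and the product of its translates under \<open>s\<close> telescopes to
  \<open>\<beta> ^ p = b\<close>, because \<open>\<phi> (s ^ p) = p * \<phi> s = 0\<close> (\<open>ex_norm_family\<close>).

  These arguments need some Galois theory of the separable closure inside the algebraic closure:
  it is a field (\<open>sep_closure_add\<close>, \<open>sep_closure_mult\<close>), and its elements fixed by all automorphisms
  lie in the base field (\<open>galois_fixed_field\<close>).
\<close>

section \<open>Cochains with values in a discrete set\<close>

lemma continuous_map_discrete_UNIV_iff:
  "continuous_map Y (discrete_topology UNIV) f \<longleftrightarrow> (\<forall>c. openin Y {x \<in> topspace Y. f x = c})"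
proof
  assume "continuous_map Y (discrete_topology UNIV) f"
  then show "\<forall>c. openin Y {x \<in> topspace Y. f x = c}"
    using openin_continuous_map_preimage[of Y "discrete_topology UNIV" f "{_}"] by fastforce
next
  assume *: "\<forall>c. openin Y {x \<in> topspace Y. f x = c}"
  have "openin Y {x \<in> topspace Y. f x \<in> U}" for U
  proof -
    have "{x \<in> topspace Y. f x \<in> U} = (\<Union>c\<in>U. {x \<in> topspace Y. f x = c})" by auto
    then show ?thesis using * by auto
  qed
  then show "continuous_map Y (discrete_topology UNIV) f"
    by (auto simp: continuous_map_def)
qed

text \<open>
  Into a discrete space, continuity means that the fibres are open, and a fibre of the combined map
  is a union of intersections of fibres of \<open>f\<close> and \<open>g\<close>.
\<close>

lemma continuous_map_discrete_combine:
  assumes f: "continuous_map Y (discrete_topology UNIV) f"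
    and g: "continuous_map Y (discrete_topology UNIV) g"
  shows "continuous_map Y (discrete_topology UNIV) (\<lambda>x. h (f x) (g x))"
  unfolding continuous_map_discrete_UNIV_iff
proof
  fix c
  have "{x \<in> topspace Y. h (f x) (g x) = c} =
    (\<Union>(u, v)\<in>{(u, v). h u v = c}. {x \<in> topspace Y. f x = u} \<inter> {x \<in> topspace Y. g x = v})"
    by auto
  moreover have "openin Y ({x \<in> topspace Y. f x = u} \<inter> {x \<in> topspace Y. g x = v})" for u v
    using f g by (auto simp: continuous_map_discrete_UNIV_iff)
  ultimately show "openin Y {x \<in> topspace Y. h (f x) (g x) = c}" by auto
qed

lemma continuous_map_discrete_sum:
  assumes "finite A" and "\<And>i. i \<in> A \<Longrightarrow> continuous_map Y (discrete_topology UNIV) (f i)"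
  shows "continuous_map Y (discrete_topology UNIV) (\<lambda>x. \<Sum>i\<in>A. f i x :: 'b::comm_monoid_add)"
  using assms
  by (induction A rule: finite_induct) (auto intro: continuous_map_discrete_combine)

lemma cup_in_cochains2:
  assumes "f \<in> cochains1 G" and "g \<in> cochains1 G"
  shows "cup f g \<in> cochains2 G"
proof -
  let ?T = "group_topology G"
  have "continuous_map (prod_topology ?T ?T) (discrete_topology UNIV) (\<lambda>z. f (fst z))"
    using assms continuous_map_compose[OF continuous_map_fst, of ?T "discrete_topology UNIV" f ?T]
    by (simp add: cochains1_def o_def)
  moreover have "continuous_map (prod_topology ?T ?T) (discrete_topology UNIV) (\<lambda>z. g (snd z))"
    using assms continuous_map_compose[OF continuous_map_snd, of ?T "discrete_topology UNIV" g ?T]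
    by (simp add: cochains1_def o_def)
  ultimately show ?thesis
    using continuous_map_discrete_combine[of _ "\<lambda>z. f (fst z)" "\<lambda>z. g (snd z)" "(*)"]
    by (simp add: cochains2_def cup_def case_prod_unfold)
qed

text \<open>
  The coboundary relation itself shows that \<open>c\<close> is a cocycle, because the group is associative.
\<close>

lemma H2_class_coboundary:
  assumes "group G" and c: "c \<in> cochains2 G" and f: "f \<in> cochains1 G"
    and eq: "\<And>\<sigma> \<tau>. \<sigma> \<in> carrier G \<Longrightarrow> \<tau> \<in> carrier G \<Longrightarrow> c \<sigma> \<tau> = coboundary1 G f \<sigma> \<tau>"
  shows "H2_class G c = H2_zero G"
proof -
  interpret group G by fact
  have c_cocycle: "c \<in> cocycles2 G"
    using c by (auto simp: cocycles2_def coboundary2_def eq coboundary1_def m_assoc)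
  have zero_cocycle: "(\<lambda>\<sigma> \<tau>. 0) \<in> cocycles2 G"
    by (simp add: cocycles2_def cochains2_def coboundary2_def case_prod_unfold)
  have "(c, d) \<in> cohomologous2 G \<longleftrightarrow> ((\<lambda>\<sigma> \<tau>. 0), d) \<in> cohomologous2 G" for d
  proof
    assume "(c, d) \<in> cohomologous2 G"
    then obtain g where d: "d \<in> cocycles2 G" and g: "g \<in> cochains1 G"
      and dg: "\<And>\<sigma> \<tau>. \<sigma> \<in> carrier G \<Longrightarrow> \<tau> \<in> carrier G \<Longrightarrow> c \<sigma> \<tau> - d \<sigma> \<tau> = coboundary1 G g \<sigma> \<tau>"
      by (auto simp: cohomologous2_def)
    have "0 - d \<sigma> \<tau> = coboundary1 G (\<lambda>\<sigma>. g \<sigma> - f \<sigma>) \<sigma> \<tau>"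
      if "\<sigma> \<in> carrier G" "\<tau> \<in> carrier G" for \<sigma> \<tau>
    proof -
      have "0 - d \<sigma> \<tau> = (c \<sigma> \<tau> - d \<sigma> \<tau>) - c \<sigma> \<tau>" by simp
      also have "\<dots> = coboundary1 G g \<sigma> \<tau> - coboundary1 G f \<sigma> \<tau>"
        by (subst dg[OF that]) (subst eq[OF that], rule refl)
      finally show ?thesis by (simp add: coboundary1_def)
    qed
    moreover have "(\<lambda>\<sigma>. g \<sigma> - f \<sigma>) \<in> cochains1 G"
      using f g by (auto simp: cochains1_def intro: continuous_map_discrete_combine)
    ultimately show "((\<lambda>\<sigma> \<tau>. 0), d) \<in> cohomologous2 G"
      using zero_cocycle d by (auto simp: cohomologous2_def)
  next
    assume "((\<lambda>\<sigma> \<tau>. 0), d) \<in> cohomologous2 G"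
    then obtain g where d: "d \<in> cocycles2 G" and g: "g \<in> cochains1 G"
      and dg: "\<And>\<sigma> \<tau>. \<sigma> \<in> carrier G \<Longrightarrow> \<tau> \<in> carrier G \<Longrightarrow> 0 - d \<sigma> \<tau> = coboundary1 G g \<sigma> \<tau>"
      unfolding cohomologous2_def by blast
    have "c \<sigma> \<tau> - d \<sigma> \<tau> = coboundary1 G (\<lambda>\<sigma>. g \<sigma> + f \<sigma>) \<sigma> \<tau>"
      if "\<sigma> \<in> carrier G" "\<tau> \<in> carrier G" for \<sigma> \<tau>
    proof -
      have "c \<sigma> \<tau> - d \<sigma> \<tau> = c \<sigma> \<tau> + (0 - d \<sigma> \<tau>)" by simp
      also have "\<dots> = coboundary1 G f \<sigma> \<tau> + coboundary1 G g \<sigma> \<tau>"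
        by (simp only: dg[OF that] eq[OF that])
      finally show ?thesis by (simp add: coboundary1_def)
    qed
    moreover have "(\<lambda>\<sigma>. g \<sigma> + f \<sigma>) \<in> cochains1 G"
      using f g by (auto simp: cochains1_def intro: continuous_map_discrete_combine)
    ultimately show "(c, d) \<in> cohomologous2 G"
      using c_cocycle d by (auto simp: cohomologous2_def)
  qed
  then show ?thesis
    by (auto simp: H2_zero_def H2_class_def)
qed

lemma H2_zero_imp_coboundary:
  assumes "H2_class G c = H2_zero G"
  obtains f where "f \<in> cochains1 G"
    "\<forall>\<sigma>\<in>carrier G. \<forall>\<tau>\<in>carrier G. c \<sigma> \<tau> = coboundary1 G f \<sigma> \<tau>"
proof -
  have "(\<lambda>\<sigma> \<tau>. 0) \<in> cocycles2 G"
    by (simp add: cocycles2_def cochains2_def coboundary2_def case_prod_unfold)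
  moreover have "(\<lambda>\<sigma>. 0) \<in> cochains1 G" by (simp add: cochains1_def)
  ultimately have "(\<lambda>\<sigma> \<tau>. 0, \<lambda>\<sigma> \<tau>. 0) \<in> cohomologous2 G"
    unfolding cohomologous2_def
    by (intro CollectI case_prodI conjI bexI[of _ "\<lambda>\<sigma>. 0"]) (simp_all add: coboundary1_def)
  then have "(\<lambda>\<sigma> \<tau>. 0) \<in> H2_zero G"
    by (simp add: H2_zero_def H2_class_def)
  then have "(\<lambda>\<sigma> \<tau>. 0) \<in> H2_class G c" by (simp only: assms)
  then have "(c, \<lambda>\<sigma> \<tau>. 0) \<in> cohomologous2 G" by (simp add: H2_class_def)
  then obtain f where "f \<in> cochains1 G"
    "\<forall>\<sigma>\<in>carrier G. \<forall>\<tau>\<in>carrier G. c \<sigma> \<tau> - 0 = coboundary1 G f \<sigma> \<tau>"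
    unfolding cohomologous2_def by blast
  then show thesis using that by simp
qed

section \<open>Complete systems\<close>

text \<open>
  A defining system with its corner filled in. Up to signs, these are the continuous homomorphisms to
  unipotent upper triangular matrices whose superdiagonal is \<open>as\<close>.
\<close>

definition complete_system ::
  "('g, 'm) topgroup_scheme \<Rightarrow> ('g \<Rightarrow> 'p::prime_card mod_ring) list
    \<Rightarrow> (nat \<Rightarrow> nat \<Rightarrow> 'g \<Rightarrow> 'p mod_ring) \<Rightarrow> bool"
  where "complete_system G as M \<longleftrightarrow>
    (\<forall>i j. 1 \<le> i \<and> i < j \<and> j \<le> length as + 1 \<longrightarrow> M i j \<in> cochains1 G) \<and>
    (\<forall>i\<in>{1..length as}. \<forall>\<sigma>\<in>carrier G. M i (i + 1) \<sigma> = (as ! (i - 1)) \<sigma>) \<and>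
    (\<forall>i j. 1 \<le> i \<and> i + 1 < j \<and> j \<le> length as + 1 \<longrightarrow>
      (\<forall>\<sigma>\<in>carrier G. \<forall>\<tau>\<in>carrier G.
        coboundary1 G (M i j) \<sigma> \<tau> = (\<Sum>l = i + 1..j - 1. cup (M i l) (M l j) \<sigma> \<tau>)))"

lemma complete_systemD:
  assumes "complete_system G as M"
  shows "1 \<le> i \<Longrightarrow> i < j \<Longrightarrow> j \<le> length as + 1 \<Longrightarrow> M i j \<in> cochains1 G"
    and "1 \<le> i \<Longrightarrow> i \<le> length as \<Longrightarrow> \<sigma> \<in> carrier G \<Longrightarrow> M i (i + 1) \<sigma> = (as ! (i - 1)) \<sigma>"
    and "1 \<le> i \<Longrightarrow> i + 1 < j \<Longrightarrow> j \<le> length as + 1 \<Longrightarrow> \<sigma> \<in> carrier G \<Longrightarrow> \<tau> \<in> carrier G \<Longrightarrow>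
      coboundary1 G (M i j) \<sigma> \<tau> = (\<Sum>l = i + 1..j - 1. cup (M i l) (M l j) \<sigma> \<tau>)"
  using assms unfolding complete_system_def by auto

lemma complete_system_imp_massey:
  assumes G: "group G" and M: "complete_system G as M" and len: "length as \<ge> 2"
  shows "massey_defined G as \<and> H2_zero G \<in> massey_product G as"
proof -
  have ds: "defining_system G as M"
    using M by (simp add: defining_system_def complete_system_def Let_def)
  let ?n = "length as"
  have "massey_value G ?n M = H2_zero G"
    unfolding massey_value_def
  proof (rule H2_class_coboundary[OF G])
    show "M 1 (?n + 1) \<in> cochains1 G"
      using complete_systemD(1)[OF M, of 1 "?n + 1"] len by (cases as) auto
    have "cup (M 1 l) (M l (?n + 1)) \<in> cochains2 G" if "l \<in> {2..?n}" for l
      using complete_systemD(1)[OF M] that by (intro cup_in_cochains2) auto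
    then show "(\<lambda>\<sigma> \<tau>. \<Sum>l = 2..?n. cup (M 1 l) (M l (?n + 1)) \<sigma> \<tau>) \<in> cochains2 G"
      by (auto simp: cochains2_def case_prod_unfold intro!: continuous_map_discrete_sum)
    show "(\<Sum>l = 2..?n. cup (M 1 l) (M l (?n + 1)) \<sigma> \<tau>) = coboundary1 G (M 1 (?n + 1)) \<sigma> \<tau>"
      if "\<sigma> \<in> carrier G" "\<tau> \<in> carrier G" for \<sigma> \<tau>
      using complete_systemD(3)[OF M, of 1 "?n + 1" \<sigma> \<tau>] that len by (simp add: numeral_2_eq_2)
  qed
  with ds show ?thesis
    by (auto simp: massey_defined_def massey_product_def)
qed

text \<open>
  Deleting the first row and column of an upper triangular matrix is multiplicative.
\<close>

lemma complete_system_tl: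
  assumes "complete_system G (x # as) M"
  shows "complete_system G as (\<lambda>i j. M (i + 1) (j + 1))"
  unfolding complete_system_def
proof (intro conjI allI impI ballI)
  fix i j assume "1 \<le> i \<and> i < j \<and> j \<le> length as + 1"
  then show "M (i + 1) (j + 1) \<in> cochains1 G"
    using complete_systemD(1)[OF assms] by simp
next
  fix i \<sigma> assume "i \<in> {1..length as}" "\<sigma> \<in> carrier G"
  then show "M (i + 1) (i + 1 + 1) \<sigma> = (as ! (i - 1)) \<sigma>"
    using complete_systemD(2)[OF assms, of "i + 1" \<sigma>] by (auto simp: nth_Cons')
next
  fix i j \<sigma> \<tau>
  assume ij: "1 \<le> i \<and> i + 1 < j \<and> j \<le> length as + 1" and "\<sigma> \<in> carrier G" "\<tau> \<in> carrier G"
  then have "coboundary1 G (M (i + 1) (j + 1)) \<sigma> \<tau> =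
      (\<Sum>l = Suc (i + 1)..Suc (j - 1). cup (M (i + 1) l) (M l (j + 1)) \<sigma> \<tau>)"
    using complete_systemD(3)[OF assms, of "i + 1" "j + 1" \<sigma> \<tau>] by simp
  also have "\<dots> = (\<Sum>l = i + 1..j - 1. cup (M (i + 1) (l + 1)) (M (l + 1) (j + 1)) \<sigma> \<tau>)"
    by (subst sum.shift_bounds_cl_Suc_ivl) simp
  finally show "coboundary1 G (M (i + 1) (j + 1)) \<sigma> \<tau> =
      (\<Sum>l = i + 1..j - 1. cup (M (i + 1) (l + 1)) (M (l + 1) (j + 1)) \<sigma> \<tau>)" .
qed

definition opposite :: "('g, 'm) topgroup_scheme \<Rightarrow> ('g, 'm) topgroup_scheme"
  where "opposite G = G\<lparr>monoid.mult := \<lambda>\<sigma> \<tau>. \<tau> \<otimes>\<^bsub>G\<^esub> \<sigma>\<rparr>"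

lemma opposite_simps [simp]:
  "carrier (opposite G) = carrier G"
  "\<sigma> \<otimes>\<^bsub>opposite G\<^esub> \<tau> = \<tau> \<otimes>\<^bsub>G\<^esub> \<sigma>"
  "group_topology (opposite G) = group_topology G"
  "cochains1 (opposite G) = cochains1 G"
  by (simp_all add: opposite_def cochains1_def)

text \<open>
  Reflection in the antidiagonal reverses matrix products, and so does passing to the opposite
  group; together they turn complete systems into complete systems without any signs.
\<close>

lemma complete_system_rev:
  assumes M: "complete_system (opposite G) as M"
  shows "complete_system G (rev as) (\<lambda>i j. M (length as + 2 - j) (length as + 2 - i))"
  unfolding complete_system_def length_rev
proof (intro conjI allI impI ballI)
  let ?n = "length as"
  fix i j assume "1 \<le> i \<and> i < j \<and> j \<le> ?n + 1"
  then show "M (?n + 2 - j) (?n + 2 - i) \<in> cochains1 G"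
    using complete_systemD(1)[OF M, of "?n + 2 - j" "?n + 2 - i"] by fastforce
next
  let ?n = "length as"
  fix i \<sigma> assume i: "i \<in> {1..?n}" and \<sigma>: "\<sigma> \<in> carrier G"
  have "M (?n + 1 - i) (?n + 1 - i + 1) \<sigma> = (as ! (?n + 1 - i - 1)) \<sigma>"
    using complete_systemD(2)[OF M, of "?n + 1 - i"] i \<sigma> by fastforce
  moreover have "rev as ! (i - 1) = as ! (?n + 1 - i - 1)"
    using i by (cases i) (auto simp: rev_nth)
  moreover have "?n + 2 - (i + 1) = ?n + 1 - i" "?n + 2 - i = ?n + 1 - i + 1"
    using i by auto
  ultimately show "M (?n + 2 - (i + 1)) (?n + 2 - i) \<sigma> = (rev as ! (i - 1)) \<sigma>"
    by simp
next
  let ?n = "length as"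
  fix i j \<sigma> \<tau>
  assume ij: "1 \<le> i \<and> i + 1 < j \<and> j \<le> ?n + 1" and \<sigma>\<tau>: "\<sigma> \<in> carrier G" "\<tau> \<in> carrier G"
  let ?i = "?n + 2 - j" and ?j = "?n + 2 - i"
  have "1 \<le> ?i \<and> ?i + 1 < ?j \<and> ?j \<le> ?n + 1" using ij by auto
  then have "coboundary1 (opposite G) (M ?i ?j) \<tau> \<sigma> =
      (\<Sum>l = ?i + 1..?j - 1. cup (M ?i l) (M l ?j) \<tau> \<sigma>)"
    using complete_systemD(3)[OF M, of ?i ?j \<tau> \<sigma>] \<sigma>\<tau> by simp
  also have "coboundary1 (opposite G) (M ?i ?j) \<tau> \<sigma> = coboundary1 G (M ?i ?j) \<sigma> \<tau>"
    by (simp add: coboundary1_def algebra_simps)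
  also have "(\<Sum>l = ?i + 1..?j - 1. cup (M ?i l) (M l ?j) \<tau> \<sigma>) =
      (\<Sum>l = i + 1..j - 1. cup (M (?n + 2 - l) ?j) (M ?i (?n + 2 - l)) \<sigma> \<tau>)"
    by (rule sum.reindex_bij_witness[of _ "\<lambda>l. ?n + 2 - l" "\<lambda>l. ?n + 2 - l"])
      (use ij in \<open>auto simp: cup_def mult.commute\<close>)
  finally show "coboundary1 G (M ?i ?j) \<sigma> \<tau> =
      (\<Sum>l = i + 1..j - 1. cup (M (?n + 2 - l) ?j) (M ?i (?n + 2 - l)) \<sigma> \<tau>)" .
qed


section \<open>Divided powers and moments\<close>

text \<open>
  The formula is useful only for \<open>m < CARD('p)\<close>; for larger \<open>m\<close> the denominator vanishes.
\<close>

definition divided_power :: "nat \<Rightarrow> 'p::prime_card mod_ring \<Rightarrow> 'p mod_ring"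
  where "divided_power m t = t ^ m / of_nat (fact m)"

definition moment :: "nat \<Rightarrow> ('p::prime_card mod_ring \<Rightarrow> 'p mod_ring) \<Rightarrow> 'p mod_ring"
  where "moment m u = (\<Sum>i\<in>UNIV. divided_power m i * u i)"

lemma divided_power_0 [simp]: "divided_power 0 t = 1"
  by (simp add: divided_power_def)

lemma divided_power_1 [simp]: "divided_power (Suc 0) t = t"
  by (simp add: divided_power_def)

lemma divided_power_add:
  fixes s t :: "'p::prime_card mod_ring"
  assumes "m < CARD('p)"
  shows "divided_power m (s + t) = (\<Sum>l\<le>m. divided_power l s * divided_power (m - l) t)"
proof -
  have nz: "(of_nat (fact l) :: 'p mod_ring) \<noteq> 0" if "l \<le> m" for l
    using of_nat_0_mod_ring_dvd[of "fact l", where ?'a = 'p]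
      prime_dvd_fact_iff[OF prime_card[where ?'a = 'p], of l] assms that by linarith
  have "of_nat (m choose l) * s ^ l * t ^ (m - l) / of_nat (fact m) =
      divided_power l s * divided_power (m - l) t" if "l \<le> m" for l
  proof -
    have "(of_nat (fact m) :: 'p mod_ring) = of_nat (fact l) * of_nat (fact (m - l)) * of_nat (m choose l)"
      using binomial_fact_lemma[OF that] by (metis of_nat_mult)
    then show ?thesis
      using nz[of l] nz[of "m - l"] nz[of m] that by (simp add: divided_power_def field_simps)
  qed
  then have "(\<Sum>l\<le>m. divided_power l s * divided_power (m - l) t) =
      (\<Sum>l\<le>m. of_nat (m choose l) * s ^ l * t ^ (m - l)) / of_nat (fact m)"
    by (simp add: sum_divide_distrib)
  then show ?thesis
    by (simp add: divided_power_def binomial_ring)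
qed

lemma moment_add: "moment m (\<lambda>i. u i + v i) = moment m u + moment m v"
  by (simp add: moment_def algebra_simps sum.distrib)

lemma moment_scale: "moment m (\<lambda>i. c * u i) = c * moment m u"
  by (simp add: moment_def sum_distrib_left algebra_simps)

text \<open>
  The shift acts on the moments by a unipotent triangular matrix with divided powers as entries, so
  moments of a twisted family satisfy equations of Massey type.
\<close>

lemma moment_shift:
  fixes u :: "'p::prime_card mod_ring \<Rightarrow> 'p mod_ring"
  assumes "m < CARD('p)"
  shows "moment m (\<lambda>i. u (i + t)) =
    moment m u + (\<Sum>l<m. moment l u * divided_power (m - l) (- t))"
proof -
  have "moment m (\<lambda>i. u (i + t)) = (\<Sum>i\<in>UNIV. divided_power m (i + - t) * u i)"
    unfolding moment_def
    by (rule sum.reindex_bij_witness[of _ "\<lambda>i. i - t" "\<lambda>i. i + t"]) auto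
  also have "\<dots> = (\<Sum>i\<in>UNIV. \<Sum>l\<le>m. divided_power l i * u i * divided_power (m - l) (- t))"
    unfolding divided_power_add[OF assms] sum_distrib_right
    by (intro sum.cong refl) (simp add: mult_ac)
  also have "\<dots> = (\<Sum>l\<le>m. moment l u * divided_power (m - l) (- t))"
    unfolding moment_def sum_distrib_right by (rule sum.swap)
  finally show ?thesis
    by (simp add: lessThan_Suc_atMost[symmetric])
qed

text \<open>
  The rows below the second consist of the negated divided powers of \<open>- \<chi>\<close>, the second row of the
  moments of \<open>f\<close>, the first of the moments of \<open>- (i + \<chi>) * f i\<close>. The factor \<open>- (i + \<chi>)\<close> is chosen
  such that this family fails to be twisted exactly by the cup product of \<open>\<chi>\<close> and \<open>f\<close>.
  The lemma will be applied both to a group and to its opposite.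
\<close>

lemma complete_system_of_twisted_family:
  fixes \<chi> \<psi> :: "'g \<Rightarrow> 'p::prime_card mod_ring" and f :: "'p mod_ring \<Rightarrow> 'g \<Rightarrow> 'p mod_ring"
  assumes k: "k < CARD('p)"
    and \<chi>: "\<chi> \<in> cochains1 G" and f: "\<And>i. f i \<in> cochains1 G"
    and \<chi>_mult: "\<And>\<sigma> \<tau>. \<sigma> \<in> carrier G \<Longrightarrow> \<tau> \<in> carrier G \<Longrightarrow> \<chi> (\<sigma> \<otimes>\<^bsub>G\<^esub> \<tau>) = \<chi> \<sigma> + \<chi> \<tau>"
    and f_mult: "\<And>i \<sigma> \<tau>. \<sigma> \<in> carrier G \<Longrightarrow> \<tau> \<in> carrier G \<Longrightarrow>
      f i (\<sigma> \<otimes>\<^bsub>G\<^esub> \<tau>) = f i \<tau> + f (i + \<chi> \<tau>) \<sigma>"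
    and \<psi>: "\<And>\<sigma>. \<sigma> \<in> carrier G \<Longrightarrow> \<psi> \<sigma> = (\<Sum>i\<in>UNIV. f i \<sigma>)"
  shows "\<exists>M. complete_system G (\<chi> # \<psi> # replicate k \<chi>) M"
proof -
  define A where "A m \<sigma> = - divided_power m (- \<chi> \<sigma>)" for m \<sigma>
  define E where "E m \<sigma> = moment m (\<lambda>i. f i \<sigma>)" for m \<sigma>
  define D where "D m \<sigma> = moment m (\<lambda>i. - (i + \<chi> \<sigma>) * f i \<sigma>)" for m \<sigma>
  have cont: "A m \<in> cochains1 G" "E m \<in> cochains1 G" "D m \<in> cochains1 G" for m
  proof -
    show "A m \<in> cochains1 G"
      using continuous_map_discrete_combine[of _ \<chi> \<chi> "\<lambda>x _. - divided_power m (- x)"] \<chi>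
      by (simp add: A_def[abs_def] cochains1_def)
    have "continuous_map (group_topology G) (discrete_topology UNIV) (\<lambda>\<sigma>. divided_power m i * f i \<sigma>)" for i
      using continuous_map_discrete_combine[of _ "f i" "f i" "\<lambda>x _. divided_power m i * x"] f
      by (simp add: cochains1_def)
    then show "E m \<in> cochains1 G"
      unfolding E_def[abs_def] moment_def cochains1_def by (auto intro: continuous_map_discrete_sum)
    have "continuous_map (group_topology G) (discrete_topology UNIV)
        (\<lambda>\<sigma>. divided_power m i * (- (i + \<chi> \<sigma>) * f i \<sigma>))" for i
      using continuous_map_discrete_combine[of _ "f i" \<chi> "\<lambda>x y. divided_power m i * (- (i + y) * x)"] f \<chi>
      by (simp add: cochains1_def)
    then show "D m \<in> cochains1 G"
      unfolding D_def[abs_def] moment_def cochains1_def by (auto intro: continuous_map_discrete_sum)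
  qed
  have cobA: "coboundary1 G (A m) \<sigma> \<tau> = (\<Sum>l = 1..m - 1. A l \<sigma> * A (m - l) \<tau>)"
    if "\<sigma> \<in> carrier G" "\<tau> \<in> carrier G" "m < CARD('p)" "0 < m" for m \<sigma> \<tau>
  proof -
    from \<open>0 < m\<close> obtain n where m: "m = Suc n" by (cases m) auto
    have "A m (\<sigma> \<otimes>\<^bsub>G\<^esub> \<tau>) = - (\<Sum>l\<le>m. divided_power l (- \<chi> \<sigma>) * divided_power (m - l) (- \<chi> \<tau>))"
      using that by (simp add: A_def \<chi>_mult divided_power_add[symmetric] add.commute)
    also have "(\<Sum>l\<le>m. divided_power l (- \<chi> \<sigma>) * divided_power (m - l) (- \<chi> \<tau>)) =
       divided_power m (- \<chi> \<tau>) +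
       (\<Sum>l = 1..n. divided_power l (- \<chi> \<sigma>) * divided_power (m - l) (- \<chi> \<tau>)) + divided_power m (- \<chi> \<sigma>)"
      by (simp add: m atMost_atLeast0 sum.atLeast_Suc_atMost)
    finally show ?thesis
      by (simp add: coboundary1_def A_def m)
  qed
  have cobE: "coboundary1 G (E m) \<sigma> \<tau> = (\<Sum>l<m. E l \<sigma> * A (m - l) \<tau>)"
    if "\<sigma> \<in> carrier G" "\<tau> \<in> carrier G" "m < CARD('p)" for m \<sigma> \<tau>
  proof -
    have "E m (\<sigma> \<otimes>\<^bsub>G\<^esub> \<tau>) = E m \<tau> + moment m (\<lambda>i. f (i + \<chi> \<tau>) \<sigma>)"
      using that by (simp add: E_def f_mult moment_add)
    also have "moment m (\<lambda>i. f (i + \<chi> \<tau>) \<sigma>) =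
        E m \<sigma> + (\<Sum>l<m. E l \<sigma> * divided_power (m - l) (- \<chi> \<tau>))"
      using moment_shift[OF that(3), of "\<lambda>i. f i \<sigma>"] by (simp add: E_def)
    finally show ?thesis
      by (simp add: coboundary1_def A_def sum_negf)
  qed
  have cobD: "coboundary1 G (D m) \<sigma> \<tau> = \<chi> \<sigma> * E m \<tau> + (\<Sum>l<m. D l \<sigma> * A (m - l) \<tau>)"
    if "\<sigma> \<in> carrier G" "\<tau> \<in> carrier G" "m < CARD('p)" for m \<sigma> \<tau>
  proof -
    have "(\<lambda>i. - (i + \<chi> (\<sigma> \<otimes>\<^bsub>G\<^esub> \<tau>)) * f i (\<sigma> \<otimes>\<^bsub>G\<^esub> \<tau>)) =
       (\<lambda>i. (- (i + \<chi> \<tau>) * f i \<tau> + (- \<chi> \<sigma>) * f i \<tau>)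
         + - ((i + \<chi> \<tau>) + \<chi> \<sigma>) * f (i + \<chi> \<tau>) \<sigma>)"
      using that by (simp add: f_mult \<chi>_mult algebra_simps)
    then have "D m (\<sigma> \<otimes>\<^bsub>G\<^esub> \<tau>) = D m \<tau> + (- \<chi> \<sigma>) * E m \<tau>
        + moment m (\<lambda>i. - ((i + \<chi> \<tau>) + \<chi> \<sigma>) * f (i + \<chi> \<tau>) \<sigma>)"
      unfolding D_def E_def by (simp only: moment_add moment_scale)
    also have "moment m (\<lambda>i. - ((i + \<chi> \<tau>) + \<chi> \<sigma>) * f (i + \<chi> \<tau>) \<sigma>) =
        D m \<sigma> + (\<Sum>l<m. D l \<sigma> * divided_power (m - l) (- \<chi> \<tau>))"
      using moment_shift[OF that(3), of "\<lambda>i. - (i + \<chi> \<sigma>) * f i \<sigma>"] by (simp only: D_def)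
    finally show ?thesis
      by (simp add: coboundary1_def A_def sum_negf)
  qed
  define M where "M i j = (if i = 1 then if j = 2 then \<chi> else D (j - 3)
    else if i = 2 then E (j - 3) else A (j - i))" for i j :: nat
  have "complete_system G (\<chi> # \<psi> # replicate k \<chi>) M"
    unfolding complete_system_def
  proof (intro conjI allI impI ballI)
    show "M i j \<in> cochains1 G" for i j
      using \<chi> cont by (simp add: M_def)
  next
    fix i \<sigma> assume i: "i \<in> {1..length (\<chi> # \<psi> # replicate k \<chi>)}" and \<sigma>: "\<sigma> \<in> carrier G"
    consider "i = 1" | "i = 2" | "i \<ge> 3" using i by fastforce
    then show "M i (i + 1) \<sigma> = ((\<chi> # \<psi> # replicate k \<chi>) ! (i - 1)) \<sigma>"
    proof cases
      case 2
      then show ?thesis using \<psi>[OF \<sigma>] by (simp add: M_def E_def moment_def)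
    next
      case 3
      then show ?thesis using i by (auto simp: M_def A_def nth_Cons')
    qed (simp add: M_def)
  next
    fix i j \<sigma> \<tau>
    assume ij: "1 \<le> i \<and> i + 1 < j \<and> j \<le> length (\<chi> # \<psi> # replicate k \<chi>) + 1"
      and \<sigma>\<tau>: "\<sigma> \<in> carrier G" "\<tau> \<in> carrier G"
    have tail: "(\<Sum>l = 3..j - 1. B (l - 3) \<sigma> * A (j - l) \<tau>) = (\<Sum>l<j - 3. B l \<sigma> * A (j - 3 - l) \<tau>)" for B
      by (rule sum.reindex_bij_witness[of _ "\<lambda>l. l + 3" "\<lambda>l. l - 3"]) auto
    have small: "j - 3 < CARD('p)" "i \<ge> 3 \<Longrightarrow> j - i < CARD('p)" using ij k by auto
    consider "i = 1" | "i = 2" | "i \<ge> 3" using ij by linarith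
    then show "coboundary1 G (M i j) \<sigma> \<tau> = (\<Sum>l = i + 1..j - 1. cup (M i l) (M l j) \<sigma> \<tau>)"
    proof cases
      case 1
      have "(\<Sum>l = 2..j - 1. cup (M i l) (M l j) \<sigma> \<tau>) =
          \<chi> \<sigma> * E (j - 3) \<tau> + (\<Sum>l<j - 3. D l \<sigma> * A (j - 3 - l) \<tau>)"
        unfolding tail[symmetric]
        using 1 ij by (subst sum.atLeast_Suc_atMost) (auto simp: M_def cup_def intro!: sum.cong)
      then show ?thesis
        using 1 ij cobD[OF \<sigma>\<tau> small(1)] by (simp add: M_def numeral_2_eq_2)
    next
      case 2
      have "(\<Sum>l = 3..j - 1. cup (M i l) (M l j) \<sigma> \<tau>) = (\<Sum>l<j - 3. E l \<sigma> * A (j - 3 - l) \<tau>)"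
        unfolding tail[symmetric]
        using 2 by (intro sum.cong) (auto simp: M_def cup_def)
      then show ?thesis
        using 2 ij cobE[OF \<sigma>\<tau> small(1)] by (simp add: M_def numeral_3_eq_3)
    next
      case 3
      have "(\<Sum>l = i + 1..j - 1. cup (M i l) (M l j) \<sigma> \<tau>) = (\<Sum>l = 1..j - i - 1. A l \<sigma> * A (j - i - l) \<tau>)"
        by (rule sum.reindex_bij_witness[of _ "\<lambda>l. l + i" "\<lambda>l. l - i"])
          (use 3 in \<open>auto simp: M_def cup_def\<close>)
      then show ?thesis
        using 3 ij cobA[OF \<sigma>\<tau> small(2)] by (simp add: M_def)
    qed
  qed
  then show ?thesis by blast
qed

text \<open>
  A twisted family \<open>f\<close> for a group gives one for the opposite group, namely
  \<open>i \<mapsto> f (- i - \<chi> \<sigma>) \<sigma>\<close>, with the same sum. It supplies the products in which \<open>\<psi>\<close> comes last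
  or second to last; the shorter products arise from the longer ones by dropping an outer entry \<open>\<chi>\<close>.
\<close>

theorem massey_of_twisted_family:
  fixes \<chi> \<psi> :: "'g \<Rightarrow> 'p::prime_card mod_ring" and f :: "'p mod_ring \<Rightarrow> 'g \<Rightarrow> 'p mod_ring"
  assumes G: "group G" and k: "0 < k" "k < CARD('p)"
    and \<chi>: "\<chi> \<in> cochains1 G" and f: "\<And>i. f i \<in> cochains1 G"
    and \<chi>_mult: "\<And>\<sigma> \<tau>. \<sigma> \<in> carrier G \<Longrightarrow> \<tau> \<in> carrier G \<Longrightarrow> \<chi> (\<sigma> \<otimes>\<^bsub>G\<^esub> \<tau>) = \<chi> \<sigma> + \<chi> \<tau>"
    and f_mult: "\<And>i \<sigma> \<tau>. \<sigma> \<in> carrier G \<Longrightarrow> \<tau> \<in> carrier G \<Longrightarrow>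
      f i (\<sigma> \<otimes>\<^bsub>G\<^esub> \<tau>) = f i \<tau> + f (i + \<chi> \<tau>) \<sigma>"
    and \<psi>: "\<And>\<sigma>. \<sigma> \<in> carrier G \<Longrightarrow> \<psi> \<sigma> = (\<Sum>i\<in>UNIV. f i \<sigma>)"
    and as: "as \<in> {\<psi> # replicate k \<chi>, replicate k \<chi> @ [\<psi>],
      \<chi> # \<psi> # replicate k \<chi>, replicate k \<chi> @ [\<psi>, \<chi>]}"
  shows "massey_defined G as \<and> H2_zero G \<in> massey_product G as"
proof -
  obtain M where M: "complete_system G (\<chi> # \<psi> # replicate k \<chi>) M"
    using complete_system_of_twisted_family[OF k(2) \<chi> f \<chi>_mult f_mult \<psi>] by auto
  define f' where "f' i \<sigma> = f (- i - \<chi> \<sigma>) \<sigma>" for i \<sigma>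
  have f': "f' i \<in> cochains1 G" for i
  proof -
    have "continuous_map (group_topology G) (discrete_topology UNIV)
        (\<lambda>\<sigma>. if \<chi> \<sigma> = t then f (- i - t) \<sigma> else 0)" for t
      using continuous_map_discrete_combine[of _ \<chi> "f (- i - t)" "\<lambda>u x. if u = t then x else 0"] \<chi> f
      by (simp add: cochains1_def)
    then have "continuous_map (group_topology G) (discrete_topology UNIV)
        (\<lambda>\<sigma>. \<Sum>t\<in>UNIV. if \<chi> \<sigma> = t then f (- i - t) \<sigma> else 0)"
      by (intro continuous_map_discrete_sum) auto
    then show ?thesis by (simp add: f'_def[abs_def] cochains1_def)
  qed
  have f'_mult: "f' i (\<tau> \<otimes>\<^bsub>G\<^esub> \<sigma>) = f' i \<tau> + f' (i + \<chi> \<tau>) \<sigma>"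
    if "\<sigma> \<in> carrier G" "\<tau> \<in> carrier G" for i \<sigma> \<tau>
    using that by (simp add: f'_def f_mult \<chi>_mult algebra_simps)
  have f'_sum: "\<psi> \<sigma> = (\<Sum>i\<in>UNIV. f' i \<sigma>)" if "\<sigma> \<in> carrier G" for \<sigma>
    unfolding \<psi>[OF that] f'_def
    by (rule sum.reindex_bij_witness[of _ "\<lambda>i. - i - \<chi> \<sigma>" "\<lambda>i. - i - \<chi> \<sigma>"]) auto
  have "\<exists>M. complete_system (opposite G) (\<chi> # \<psi> # replicate k \<chi>) M"
    by (rule complete_system_of_twisted_family[of k \<chi> _ f'])
      (simp_all add: k \<chi> f' \<chi>_mult f'_mult f'_sum add.commute)
  then obtain N where N: "complete_system (opposite G) (\<chi> # \<psi> # replicate k \<chi>) N" ..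
  have "\<exists>M. complete_system G as M"
    using as M complete_system_tl[OF M] complete_system_rev[OF N]
      complete_system_rev[OF complete_system_tl[OF N]] by auto
  moreover have "length as \<ge> 2" using as k(1) by auto
  ultimately show ?thesis using complete_system_imp_massey[OF G] by blast
qed

section \<open>Minimal polynomials over intermediate rings\<close>

interpretation to_ac_hom: field_hom "to_ac :: 'a::field \<Rightarrow> 'a alg_closure"
  by standard simp_all

abbreviation poly_ac :: "'a::field poly \<Rightarrow> 'a alg_closure \<Rightarrow> 'a alg_closure"
  where "poly_ac f \<equiv> poly (map_poly to_ac f)"

interpretation map_poly_to_ac_hom: map_poly_inj_idom_hom "to_ac :: 'a::field \<Rightarrow> 'a alg_closure" ..

lemma poly_ac_simps [simp]:
  "poly_ac (f + g) x = poly_ac f x + poly_ac g x"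
  "poly_ac (f * g) x = poly_ac f x * poly_ac g x"
  "poly_ac (smult c f) x = to_ac c * poly_ac f x"
  "poly_ac (pCons c f) x = to_ac c + x * poly_ac f x"
  "poly_ac (pderiv f) x = poly (pderiv (map_poly to_ac f)) x"
  by (simp_all add: hom_distribs)

text \<open>
  A nonzero polynomial of least degree with root \<open>x\<close> divides all others by division with
  remainder, and it is irreducible because it is prime.
\<close>

lemma ex_min_poly:
  fixes x :: "'a::field alg_closure"
  obtains m :: "'a poly" where "Factorial_Ring.irreducible m" "poly_ac m x = 0"
    "\<And>f. poly_ac f x = 0 \<Longrightarrow> m dvd f"
proof -
  define P where "P f \<longleftrightarrow> f \<noteq> 0 \<and> poly_ac f x = 0" for f :: "'a poly"
  define m where "m = (ARG_MIN degree f. P f)"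
  have "\<exists>f. P f" using alg_closure_algebraic[of x] unfolding P_def by metis
  then have Pm: "P m" and min: "\<And>f. P f \<Longrightarrow> degree m \<le> degree f"
    unfolding m_def by (auto intro: arg_min_natI arg_min_nat_le)
  have m: "m \<noteq> 0" "poly_ac m x = 0" using Pm by (auto simp: P_def)
  have dvd: "m dvd f" if "poly_ac f x = 0" for f
  proof -
    have "poly_ac (f mod m) x = 0"
    proof -
      have "poly_ac (m * (f div m) + f mod m) x = 0" using that by simp
      then show ?thesis using m by (simp only: poly_ac_simps) simp
    qed
    then show ?thesis
      using min[of "f mod m"] degree_mod_less'[of m f] m
      unfolding P_def by (metis dvd_eq_mod_eq_0 not_le)
  qed
  have "Factorial_Ring.irreducible m"
  proof (rule Factorial_Ring.irreducibleI)
    show "\<not> m dvd 1"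
    proof
      assume "m dvd 1"
      then obtain s where "1 = m * s" by (elim dvdE)
      then have "poly_ac 1 x = poly_ac (m * s) x" by simp
      then show False using m by (simp only: poly_ac_simps) simp
    qed
  next
    fix u v assume uv: "m = u * v"
    have "poly_ac u x * poly_ac v x = 0" using m(2) by (simp add: uv hom_distribs)
    then have "m dvd u \<or> m dvd v" using dvd by auto
    then have "u * v dvd u * 1 \<or> v * u dvd v * 1" by (simp add: uv mult.commute)
    then show "u dvd 1 \<or> v dvd 1"
      using m(1) unfolding uv dvd_mult_cancel_left by auto
  qed (use m in auto)
  then show thesis using that m(2) dvd by blast
qed

lemma irreducible_root_dvd:
  assumes g: "Factorial_Ring.irreducible g" "poly_ac g x = 0" and "poly_ac h x = 0"
  shows "g dvd h"
proof -
  obtain m where m: "Factorial_Ring.irreducible m" "\<And>f. poly_ac f x = 0 \<Longrightarrow> m dvd f"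
    using ex_min_poly[of x] by metis
  obtain s where s: "g = m * s" using m(2)[OF g(2)] by (elim dvdE)
  then have "s dvd 1" using g(1) m(1) Factorial_Ring.irreducibleD by (metis irreducible_not_unit)
  then have "g dvd m" unfolding s by (metis dvd_refl mult.right_neutral mult_dvd_mono)
  then show ?thesis using m(2)[OF assms(3)] dvd_trans by blast
qed

text \<open>
  Every element is algebraic over the base field. After cancelling powers of \<open>x\<close> from an equation for \<open>x\<close>
  the constant term is nonzero, and the equation can be solved for \<open>inverse x\<close>.
\<close>

lemma inverse_poly_in_element:
  fixes x :: "'a::field alg_closure"
  assumes "x \<noteq> 0" shows "\<exists>f. inverse x = poly_ac f x"
proof -
  obtain p :: "'a poly" where "p \<noteq> 0" "poly_ac p x = 0" by (rule alg_closure_algebraic)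
  then show ?thesis
  proof (induction p)
    case (pCons c q)
    show ?case
    proof (cases "c = 0")
      case True
      then show ?thesis using pCons assms by (auto simp: map_poly_pCons)
    next
      case False
      have "to_ac c + x * poly_ac q x = 0"
        using pCons.prems by (simp add: map_poly_pCons)
      then have "x * poly_ac q x = - to_ac c" by (simp add: eq_neg_iff_add_eq_0 add.commute)
      then have "x * (- poly_ac q x / to_ac c) = 1" using False by simp
      then have "inverse x = - poly_ac q x / to_ac c" by (rule inverse_unique)
      also have "\<dots> = poly_ac (smult (- 1 / c) q) x"
        by (simp only: poly_ac_simps) simp
      finally show ?thesis by blast
    qed
  qed simp
qed

text \<open>
  These sets are in fact fields (\<open>intermediate_ring_inverse\<close>). Asking for closure under sums and
  products only makes the property easy to check for the domains of the graphs considered below.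
\<close>

definition intermediate_ring :: "'a::field alg_closure set \<Rightarrow> bool"
  where "intermediate_ring K \<longleftrightarrow> range to_ac \<subseteq> K \<and>
    (\<forall>x\<in>K. \<forall>y\<in>K. x + y \<in> K \<and> x * y \<in> K)"

context
  fixes K :: "'a::field alg_closure set"
  assumes K: "intermediate_ring K"
begin

lemma intermediate_ring_base: "to_ac c \<in> K"
  and intermediate_ring_add: "x \<in> K \<Longrightarrow> y \<in> K \<Longrightarrow> x + y \<in> K"
  and intermediate_ring_mult: "x \<in> K \<Longrightarrow> y \<in> K \<Longrightarrow> x * y \<in> K"
  using K by (auto simp: intermediate_ring_def)

lemma intermediate_ring_0: "0 \<in> K" and intermediate_ring_1: "1 \<in> K"
  using intermediate_ring_base[of 0] intermediate_ring_base[of 1] by simp_all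

lemma intermediate_ring_uminus: "x \<in> K \<Longrightarrow> - x \<in> K"
  using intermediate_ring_mult[of "to_ac (-1)" x] intermediate_ring_base[of "-1"] by simp

lemma intermediate_ring_diff: "x \<in> K \<Longrightarrow> y \<in> K \<Longrightarrow> x - y \<in> K"
  using intermediate_ring_add[of x "- y"] intermediate_ring_uminus by simp

lemma intermediate_ring_sum: "(\<And>i. i \<in> A \<Longrightarrow> f i \<in> K) \<Longrightarrow> sum f A \<in> K"
  by (induction A rule: infinite_finite_induct) (auto intro: intermediate_ring_0 intermediate_ring_add)

lemma intermediate_ring_poly: "x \<in> K \<Longrightarrow> poly_ac f x \<in> K"
  by (induction f)
    (auto simp: map_poly_pCons intro!: intermediate_ring_0 intermediate_ring_add intermediate_ring_mult
      intermediate_ring_base)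

lemma intermediate_ring_inverse: "x \<in> K \<Longrightarrow> inverse x \<in> K"
  using inverse_poly_in_element[of x] intermediate_ring_poly[of x] intermediate_ring_0
  by (cases "x = 0") auto

text \<open>
  The intermediate ring is not a type of its own, so division with remainder is carried out on
  polynomials over the algebraic closure, checking that all coefficients stay in \<open>K\<close>.
\<close>

lemma ex_min_poly_over:
  obtains m where "\<forall>n. coeff m n \<in> K" "lead_coeff m = 1" "poly m x = 0"
    "\<forall>f. (\<forall>n. coeff f n \<in> K) \<and> poly f x = 0 \<longrightarrow> (\<exists>s. (\<forall>n. coeff s n \<in> K) \<and> f = m * s)"
proof -
  define P where "P f \<longleftrightarrow> f \<noteq> 0 \<and> (\<forall>n. coeff f n \<in> K) \<and> poly f x = 0" for f
  define g where "g = (ARG_MIN degree f. P f)"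
  have "\<exists>f. P f"
  proof -
    obtain p :: "'a poly" where "p \<noteq> 0" "poly_ac p x = 0" by (rule alg_closure_algebraic)
    then have "P (map_poly to_ac p)" by (auto simp: P_def intermediate_ring_base)
    then show ?thesis by blast
  qed
  then have Pg: "P g" and min: "\<And>f. P f \<Longrightarrow> degree g \<le> degree f"
    unfolding g_def by (auto intro: arg_min_natI arg_min_nat_le)
  define m where "m = smult (inverse (lead_coeff g)) g"
  have m: "\<forall>n. coeff m n \<in> K" "lead_coeff m = 1" "poly m x = 0" "degree m = degree g"
    using Pg by (auto simp: m_def P_def intermediate_ring_inverse intermediate_ring_mult)
  have "\<exists>s. (\<forall>n. coeff s n \<in> K) \<and> f = m * s"
    if "\<forall>n. coeff f n \<in> K" "poly f x = 0" for f
    using that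
  proof (induction "length (coeffs f)" arbitrary: f rule: less_induct)
    case less
    show ?case
    proof (cases "f = 0")
      case True
      then show ?thesis by (intro exI[of _ 0]) (simp add: intermediate_ring_0)
    next
      case False
      then have deg: "degree m \<le> degree f" using min[of f] less.prems m(4) by (simp add: P_def)
      define q where "q = monom (lead_coeff f) (degree f - degree m)"
      have q: "\<forall>n. coeff q n \<in> K" using less.prems by (simp add: q_def intermediate_ring_0)
      have coeff_mq: "\<forall>n. coeff (m * q) n \<in> K"
        using m(1) q by (auto simp: coeff_mult intro!: intermediate_ring_sum intermediate_ring_mult)
      have deg_mq: "degree (m * q) = degree f"
        using m(2) False deg by (subst degree_mult_eq) (auto simp: q_def degree_monom_eq)
      then have "degree (f - m * q) \<le> degree f" by (simp add: degree_diff_le)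
      moreover have "coeff (f - m * q) (degree f) = 0"
        using deg_mq lead_coeff_mult[of m q] m(2) False by (simp add: q_def degree_monom_eq)
      ultimately have "f - m * q = 0 \<or> degree (f - m * q) < degree f"
        by (metis leading_coeff_0_iff le_neq_implies_less)
      then have "length (coeffs (f - m * q)) < length (coeffs f)"
        using False by (cases "f - m * q = 0") (simp_all add: length_coeffs_degree)
      moreover have "\<forall>n. coeff (f - m * q) n \<in> K"
        using less.prems(1) coeff_mq by (simp add: intermediate_ring_diff)
      moreover have "poly (f - m * q) x = 0" using less.prems m(3) by simp
      ultimately obtain s where s: "\<forall>n. coeff s n \<in> K" "f - m * q = m * s"
        using less.hyps by blast
      then have "f = m * (s + q)" by (simp add: algebra_simps)
      moreover have "\<forall>n. coeff (s + q) n \<in> K" using s(1) q by (simp add: intermediate_ring_add)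
      ultimately show ?thesis by blast
    qed
  qed
  then show thesis using that m by blast
qed

end

section \<open>Separable elements form a field\<close>

text \<open>
  Separability becomes a condition that is easy to verify: being a simple root of some polynomial
  over the base field. If \<open>x\<close> is a simple root of \<open>f\<close>, it is one of the minimal polynomial \<open>m\<close> of \<open>x\<close>
  too. A multiple root of \<open>m\<close> would be shared with the derivative of \<open>m\<close>, so the irreducible \<open>m\<close> would
  divide its derivative, which is nonzero and of smaller degree.
\<close>

lemma sep_closure_iff:
  "x \<in> sep_closure \<longleftrightarrow> (\<exists>f. poly_ac f x = 0 \<and> poly_ac (pderiv f) x \<noteq> 0)"
proof
  assume "x \<in> sep_closure"
  then obtain f where f: "rsquarefree (map_poly to_ac f)" "poly_ac f x = 0"
    by (auto simp: sep_closure_def)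
  have "poly_ac (pderiv f) x \<noteq> 0"
  proof
    assume 0: "poly_ac (pderiv f) x = 0"
    obtain q where q: "map_poly to_ac f = [:- x, 1:] * q"
      using f(2) poly_eq_0_iff_dvd by (metis dvdE)
    have "map_poly to_ac (pderiv f) = pderiv (map_poly to_ac f)"
      by (simp add: to_ac_hom.map_poly_pderiv)
    also have "\<dots> = q + [:- x, 1:] * pderiv q"
      unfolding q pderiv_mult by (simp add: pderiv_pCons)
    finally have "poly q x = 0" using 0 by simp
    then have "[:- x, 1:] ^ 2 dvd map_poly to_ac f"
      unfolding q power2_eq_square by (intro mult_dvd_mono) (simp_all add: poly_eq_0_iff_dvd)
    moreover have "order x (map_poly to_ac f) = 1"
      using f by (intro rsquarefree_root_order) (auto simp: rsquarefree_def)
    ultimately show False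
      using f by (simp add: order_divides rsquarefree_def)
  qed
  with f show "\<exists>f. poly_ac f x = 0 \<and> poly_ac (pderiv f) x \<noteq> 0" by blast
next
  assume "\<exists>f. poly_ac f x = 0 \<and> poly_ac (pderiv f) x \<noteq> 0"
  then obtain f where f: "poly_ac f x = 0" "poly_ac (pderiv f) x \<noteq> 0" by blast
  obtain m where m: "Factorial_Ring.irreducible m" "poly_ac m x = 0" "m dvd f"
    using ex_min_poly[of x] f(1) by metis
  then obtain s where s: "f = m * s" by (elim dvdE)
  have "poly_ac (pderiv f) x = poly_ac m x * poly_ac (pderiv s) x + poly_ac s x * poly_ac (pderiv m) x"
    by (simp add: s pderiv_mult hom_distribs del: poly_ac_simps(5))
  then have dm: "poly_ac (pderiv m) x \<noteq> 0" using f(2) m(2) by auto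
  then have m0: "pderiv m \<noteq> 0" "m \<noteq> 0" by (auto simp del: poly_ac_simps(5))
  have "order y (map_poly to_ac m) \<le> 1" for y
  proof (rule ccontr)
    assume "\<not> order y (map_poly to_ac m) \<le> 1"
    then have "[:- y, 1:] ^ 2 dvd map_poly to_ac m" using m0 by (simp add: order_divides)
    then obtain q where q: "map_poly to_ac m = [:- y, 1:] ^ 2 * q" by (elim dvdE)
    have "poly_ac m y = 0" by (simp add: q)
    moreover have "poly_ac (pderiv m) y = 0"
    proof -
      have "map_poly to_ac (pderiv m) = pderiv (map_poly to_ac m)"
        by (simp add: to_ac_hom.map_poly_pderiv)
      also have "poly \<dots> y = 0" unfolding q power2_eq_square pderiv_mult by simp
      finally show ?thesis by simp
    qed
    ultimately have "m dvd pderiv m" using irreducible_root_dvd[OF m(1)] by blast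
    then have "degree m \<le> degree (pderiv m)" using m0 by (intro dvd_imp_degree_le)
    moreover have "degree m \<noteq> 0"
    proof
      assume "degree m = 0"
      then obtain c where "m = [:c:]" by (rule degree_eq_zeroE)
      then show False using m0 by (simp add: pderiv_pCons)
    qed
    ultimately show False using degree_pderiv_le[of m] by linarith
  qed
  then have "rsquarefree (map_poly to_ac m)"
    using m0 by (auto simp: rsquarefree_def le_Suc_eq)
  then show "x \<in> sep_closure" using m by (auto simp: sep_closure_def)
qed

lemma to_ac_in_sep_closure [simp]: "to_ac c \<in> sep_closure"
  unfolding sep_closure_iff
  by (intro exI[of _ "[:- c, 1:]"]) (simp add: map_poly_pCons pderiv_pCons)

text \<open>
  The graph of a derivation over the base field, from an intermediate ring to the algebraic closure.
  Such derivations detect separability: they vanish on separable elements, whereas an inseparable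
  element admits one with value 1. Representing them by graphs makes extending their domain a matter
  of inclusion.
\<close>

definition derivation_graph :: "('a::field alg_closure \<times> 'a alg_closure) set \<Rightarrow> bool"
  where "derivation_graph r \<longleftrightarrow> (\<forall>c. (to_ac c, 0) \<in> r) \<and>
    (\<forall>(x, a)\<in>r. \<forall>(y, b)\<in>r. (x + y, a + b) \<in> r \<and> (x * y, x * b + y * a) \<in> r) \<and>
    (\<forall>a. (0, a) \<in> r \<longrightarrow> a = 0)"

lemma derivation_graphI:
  assumes "\<And>c. (to_ac c, 0) \<in> r"
    and "\<And>x a y b. (x, a) \<in> r \<Longrightarrow> (y, b) \<in> r \<Longrightarrow> (x + y, a + b) \<in> r \<and> (x * y, x * b + y * a) \<in> r"
    and "\<And>a. (0, a) \<in> r \<Longrightarrow> a = 0"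
  shows "derivation_graph r"
  using assms by (auto simp: derivation_graph_def)

lemma derivation_graphD:
  assumes "derivation_graph r"
  shows "(to_ac c, 0) \<in> r"
    and "(x, a) \<in> r \<Longrightarrow> (y, b) \<in> r \<Longrightarrow> (x + y, a + b) \<in> r"
    and "(x, a) \<in> r \<Longrightarrow> (y, b) \<in> r \<Longrightarrow> (x * y, x * b + y * a) \<in> r"
    and "(0, a) \<in> r \<Longrightarrow> a = 0"
  using assms by (fastforce simp: derivation_graph_def)+

lemma derivation_graph_unique:
  assumes r: "derivation_graph r" and "(x, a) \<in> r" "(x, b) \<in> r"
  shows "a = b"
proof -
  have "(- x, - b) \<in> r"
    using derivation_graphD(3)[OF r derivation_graphD(1)[OF r, of "-1"] assms(3)] by simp
  from derivation_graphD(2)[OF r assms(2) this] have "(0, a - b) \<in> r" by simp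
  then show ?thesis using derivation_graphD(4)[OF r] by fastforce
qed

lemma derivation_graph_poly:
  assumes r: "derivation_graph r" and x: "(x, a) \<in> r"
  shows "(poly_ac f x, poly_ac (pderiv f) x * a) \<in> r"
proof (induction f)
  case 0
  show ?case using derivation_graphD(1)[OF r, of 0] by simp
next
  case (pCons c f)
  have "(to_ac c + x * poly_ac f x, 0 + (x * (poly_ac (pderiv f) x * a) + poly_ac f x * a)) \<in> r"
    by (intro derivation_graphD(2,3)[OF r] derivation_graphD(1)[OF r] x pCons.IH)
  then show ?case by (simp add: map_poly_pCons pderiv_pCons algebra_simps)
qed

text \<open>
  Applying the derivation to \<open>f x = 0\<close> gives \<open>f' x * a = 0\<close>, and \<open>x\<close> is a simple root of some \<open>f\<close>.
\<close>

lemma derivation_graph_separable: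
  assumes r: "derivation_graph r" and "(x, a) \<in> r" and "x \<in> sep_closure"
  shows "a = 0"
proof -
  obtain f where f: "poly_ac f x = 0" "poly_ac (pderiv f) x \<noteq> 0"
    using assms(3) by (auto simp: sep_closure_iff)
  then have "(0, poly_ac (pderiv f) x * a) \<in> r"
    using derivation_graph_poly[OF assms(1,2), of f] by simp
  then have "poly_ac (pderiv f) x * a = 0" by (rule derivation_graphD(4)[OF r])
  then show ?thesis using f(2) by simp
qed

text \<open>
  On polynomials in \<open>x\<close> take the formal derivative, evaluated at \<open>x\<close>. This is well defined since, \<open>x\<close>
  being inseparable, the derivative of every polynomial vanishing at \<open>x\<close> also vanishes there.
\<close>

lemma ex_derivation_graph_inseparable:
  assumes "x \<notin> sep_closure"
  obtains r where "derivation_graph r" "(x, 1) \<in> r"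
proof
  let ?r = "range (\<lambda>f. (poly_ac f x, poly_ac (pderiv f) x))"
  have "(to_ac c, 0) \<in> ?r" for c
    by (rule range_eqI[of _ _ "[:c:]"]) (simp add: map_poly_pCons pderiv_pCons)
  moreover have "(poly_ac f x + poly_ac g x, poly_ac (pderiv f) x + poly_ac (pderiv g) x) \<in> ?r" for f g
    by (rule range_eqI[of _ _ "f + g"]) (simp add: pderiv_add)
  moreover have "(poly_ac f x * poly_ac g x,
      poly_ac f x * poly_ac (pderiv g) x + poly_ac g x * poly_ac (pderiv f) x) \<in> ?r" for f g
    by (rule range_eqI[of _ _ "f * g"]) (simp add: pderiv_mult)
  moreover have "a = 0" if "(0, a) \<in> ?r" for a
    using that assms by (auto simp: sep_closure_iff)
  ultimately show "derivation_graph ?r"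
    unfolding derivation_graph_def by (auto simp del: to_ac_hom.hom_zero)
  show "(x, 1) \<in> ?r"
    by (rule range_eqI[of _ _ "[:0, 1:]"]) (simp add: map_poly_pCons pderiv_pCons)
qed


text \<open>
  The coefficientwise image of a polynomial under a map that is given by its graph.
\<close>

definition poly_rel :: "('a::zero \<times> 'b::zero) set \<Rightarrow> 'a poly \<Rightarrow> 'b poly \<Rightarrow> bool"
  where "poly_rel r f g \<longleftrightarrow> (\<forall>n. (coeff f n, coeff g n) \<in> r)"

lemma ex_poly_rel:
  assumes "\<And>b. (0, b) \<in> r \<longleftrightarrow> b = 0" and "\<forall>n. coeff f n \<in> Domain r"
  obtains g where "poly_rel r f g"
proof
  define h where "h c = (SOME d. (c, d) \<in> r)" for c
  have "h 0 = 0" by (simp add: h_def assms(1))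
  moreover have "(c, h c) \<in> r" if "c \<in> Domain r" for c
    using that unfolding h_def by (metis DomainE someI)
  ultimately show "poly_rel r f (map_poly h f)"
    using assms(2) by (simp add: poly_rel_def coeff_map_poly)
qed

lemma sum_pairs_in:
  assumes "(0, 0) \<in> r" and "\<And>x a y b. (x, a) \<in> r \<Longrightarrow> (y, b) \<in> r \<Longrightarrow> (x + y, a + b) \<in> r"
    and "\<And>i. i \<in> A \<Longrightarrow> (f i, g i) \<in> r"
  shows "(\<Sum>i\<in>A. f i, \<Sum>i\<in>A. g i) \<in> r"
  using assms(3) by (induction A rule: infinite_finite_induct) (auto intro: assms(1,2))

context
  fixes r :: "('a::field alg_closure \<times> 'a alg_closure) set"
  assumes r: "derivation_graph r"
begin

lemma derivation_graph_0_iff: "(0, a) \<in> r \<longleftrightarrow> a = 0"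
  using derivation_graphD(4)[OF r] derivation_graphD(1)[OF r, of 0] by auto

lemma derivation_graph_Domain: "intermediate_ring (Domain r)"
  unfolding intermediate_ring_def
proof (intro conjI ballI subsetI)
  show "x \<in> Domain r" if "x \<in> range to_ac" for x
    using that derivation_graphD(1)[OF r] by auto
  fix x y assume "x \<in> Domain r" "y \<in> Domain r"
  then obtain a b where "(x, a) \<in> r" "(y, b) \<in> r" by auto
  then show "x + y \<in> Domain r" "x * y \<in> Domain r"
    using derivation_graphD(2,3)[OF r] by (blast intro: DomainI)+
qed

lemma poly_rel_derivation_unique: "poly_rel r f g \<Longrightarrow> poly_rel r f h \<Longrightarrow> g = h"
  by (rule poly_eqI) (auto simp: poly_rel_def intro: derivation_graph_unique[OF r])

lemma poly_rel_derivation_add: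
  "poly_rel r f g \<Longrightarrow> poly_rel r f' g' \<Longrightarrow> poly_rel r (f + f') (g + g')"
  by (simp add: poly_rel_def derivation_graphD(2)[OF r])

lemma poly_rel_derivation_mult:
  assumes "poly_rel r f g" "poly_rel r f' g'"
  shows "poly_rel r (f * f') (f * g' + f' * g)"
  unfolding poly_rel_def
proof
  fix n
  have "(\<Sum>i\<le>n. coeff f i * coeff f' (n - i),
      \<Sum>i\<le>n. coeff f i * coeff g' (n - i) + coeff f' (n - i) * coeff g i) \<in> r"
    using assms by (intro sum_pairs_in derivation_graphD(2,3)[OF r])
      (auto simp: poly_rel_def derivation_graph_0_iff)
  moreover have "coeff (f * g' + f' * g) n =
      (\<Sum>i\<le>n. coeff f i * coeff g' (n - i) + coeff f' (n - i) * coeff g i)"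
    unfolding coeff_add mult.commute[of f' g] coeff_mult by (simp add: sum.distrib mult.commute)
  ultimately show "(coeff (f * f') n, coeff (f * g' + f' * g) n) \<in> r"
    by (simp add: coeff_mult)
qed

lemma poly_rel_derivation_const: "(c, d) \<in> r \<Longrightarrow> poly_rel r [:c:] [:d:]"
  by (auto simp: poly_rel_def coeff_pCons derivation_graph_0_iff split: nat.split)

text \<open>
  If \<open>m\<close> is the minimal polynomial of \<open>x\<close> over the domain and \<open>m1\<close> arises from it by applying the
  derivation to the coefficients, then a value \<open>t\<close> at \<open>x\<close> is admissible if and only if
  \<open>m1 x + m' x * t = 0\<close>. Separability of \<open>x\<close> makes \<open>m' x\<close> nonzero, so this can be solved.
\<close>

lemma derivation_graph_extend:
  assumes x: "x \<in> sep_closure"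
  obtains r' a where "derivation_graph r'" "r \<subseteq> r'" "(x, a) \<in> r'"
proof -
  note K = derivation_graph_Domain
  obtain m where m: "\<forall>n. coeff m n \<in> Domain r" "lead_coeff m = 1" "poly m x = 0"
    and m_dvd: "\<forall>f. (\<forall>n. coeff f n \<in> Domain r) \<and> poly f x = 0 \<longrightarrow>
      (\<exists>s. (\<forall>n. coeff s n \<in> Domain r) \<and> f = m * s)"
    by (rule ex_min_poly_over[OF K, of x])
  obtain m1 where m1: "poly_rel r m m1"
    using ex_poly_rel[OF derivation_graph_0_iff m(1)] .
  have dm: "poly (pderiv m) x \<noteq> 0"
  proof
    assume 0: "poly (pderiv m) x = 0"
    obtain f where f: "poly_ac f x = 0" "poly_ac (pderiv f) x \<noteq> 0"
      using x by (auto simp: sep_closure_iff)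
    obtain s where s: "map_poly to_ac f = m * s"
      using m_dvd[rule_format, of "map_poly to_ac f"] f(1) intermediate_ring_base[OF K] by auto
    have "poly_ac (pderiv f) x = 0"
      using m(3) 0 by (simp add: s pderiv_mult)
    with f(2) show False by simp
  qed
  define t where "t = - poly m1 x / poly (pderiv m) x"
  define r' where "r' = {(poly f x, poly g x + poly (pderiv f) x * t) | f g. poly_rel r f g}"
  have r'I: "(poly f x, poly g x + poly (pderiv f) x * t) \<in> r'" if "poly_rel r f g" for f g
    using that unfolding r'_def by blast
  have const: "(c, d) \<in> r'" if "(c, d) \<in> r" for c d
    using r'I[OF poly_rel_derivation_const[OF that]] by (simp add: pderiv_pCons)
  have arith: "(u + v, a + b) \<in> r' \<and> (u * v, u * b + v * a) \<in> r'" if "(u, a) \<in> r'" "(v, b) \<in> r'" for u v a b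
  proof -
    obtain f g where fg: "poly_rel r f g"
      and eqs: "u = poly f x" "a = poly g x + poly (pderiv f) x * t"
      using \<open>(u, a) \<in> r'\<close> unfolding r'_def by blast
    obtain f' g' where fg': "poly_rel r f' g'"
      and eqs': "v = poly f' x" "b = poly g' x + poly (pderiv f') x * t"
      using \<open>(v, b) \<in> r'\<close> unfolding r'_def by blast
    show ?thesis
    proof
      show "(u + v, a + b) \<in> r'"
        using r'I[OF poly_rel_derivation_add[OF fg fg']] by (simp add: eqs eqs' pderiv_add algebra_simps)
      show "(u * v, u * b + v * a) \<in> r'"
        using r'I[OF poly_rel_derivation_mult[OF fg fg']] by (simp add: eqs eqs' pderiv_mult algebra_simps)
    qed
  qed
  have single: "a = 0" if "(0, a) \<in> r'" for a
  proof -
    obtain f g where fg: "poly_rel r f g" "poly f x = 0" "a = poly g x + poly (pderiv f) x * t"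
      using \<open>(0, a) \<in> r'\<close> unfolding r'_def by fastforce
    have "\<forall>n. coeff f n \<in> Domain r"
      using fg(1) unfolding poly_rel_def by (blast intro: DomainI)
    then obtain s where s: "\<forall>n. coeff s n \<in> Domain r" "f = m * s"
      using m_dvd fg(2) by blast
    obtain s1 where s1: "poly_rel r s s1"
      using ex_poly_rel[OF derivation_graph_0_iff s(1)] .
    have "g = m * s1 + s * m1"
      using poly_rel_derivation_unique[OF fg(1)] poly_rel_derivation_mult[OF m1 s1] s(2) by simp
    then have "a = poly s x * (poly m1 x + poly (pderiv m) x * t)"
      using m(3) by (simp add: fg(3) s(2) pderiv_mult algebra_simps)
    then show ?thesis using dm by (simp add: t_def)
  qed
  have "derivation_graph r'"
    using const[OF derivation_graphD(1)[OF r]] arith single by (rule derivation_graphI)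
  moreover have "(x, t) \<in> r'"
  proof -
    have "poly_rel r [:0, 1:] 0"
      using derivation_graphD(1)[OF r, of 1] derivation_graph_0_iff
      by (auto simp: poly_rel_def coeff_pCons split: nat.split)
    from r'I[OF this] show ?thesis by (simp add: pderiv_pCons)
  qed
  moreover have "r \<subseteq> r'" using const by auto
  ultimately show thesis using that by blast
qed

end

text \<open>
  If \<open>z\<close> were inseparable, a derivation with value 1 at \<open>z\<close> would extend to \<open>x\<close> and \<open>y\<close> and vanish
  there. This reduces closure of the separable elements under sums and products to the rules of
  differentiation.
\<close>

lemma separable_if_derivations_vanish:
  assumes x: "x \<in> sep_closure" and y: "y \<in> sep_closure"
    and z: "\<And>r c. derivation_graph r \<Longrightarrow> (x, 0) \<in> r \<Longrightarrow> (y, 0) \<in> r \<Longrightarrow> (z, c) \<in> r \<Longrightarrow> c = 0"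
  shows "z \<in> sep_closure"
proof (rule ccontr)
  assume "z \<notin> sep_closure"
  then obtain r where r: "derivation_graph r" "(z, 1) \<in> r" by (rule ex_derivation_graph_inseparable)
  obtain r1 a where r1: "derivation_graph r1" "r \<subseteq> r1" "(x, a) \<in> r1"
    using derivation_graph_extend[OF r(1) x] .
  obtain r2 b where r2: "derivation_graph r2" "r1 \<subseteq> r2" "(y, b) \<in> r2"
    using derivation_graph_extend[OF r1(1) y] .
  have "a = 0" using derivation_graph_separable[OF r1(1,3) x] .
  moreover have "b = 0" using derivation_graph_separable[OF r2(1,3) y] .
  ultimately have "(x, 0) \<in> r2" "(y, 0) \<in> r2" "(z, 1) \<in> r2"
    using r(2) r1(2,3) r2(2,3) by auto
  then show False using z[OF r2(1)] by fastforce
qed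

lemma sep_closure_add:
  assumes "x \<in> sep_closure" "y \<in> sep_closure" shows "x + y \<in> sep_closure"
proof (rule separable_if_derivations_vanish[OF assms])
  fix r c assume r: "derivation_graph r" "(x, 0) \<in> r" "(y, 0) \<in> r" "(x + y, c) \<in> r"
  show "c = 0"
    using derivation_graph_unique[OF r(1,4) derivation_graphD(2)[OF r(1-3)]] by simp
qed

lemma sep_closure_mult:
  assumes "x \<in> sep_closure" "y \<in> sep_closure" shows "x * y \<in> sep_closure"
proof (rule separable_if_derivations_vanish[OF assms])
  fix r c assume r: "derivation_graph r" "(x, 0) \<in> r" "(y, 0) \<in> r" "(x * y, c) \<in> r"
  show "c = 0"
    using derivation_graph_unique[OF r(1,4) derivation_graphD(3)[OF r(1-3)]] by simp
qed

lemma sep_closure_intermediate_ring: "intermediate_ring sep_closure"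
  by (auto simp: intermediate_ring_def sep_closure_add sep_closure_mult)

lemmas sep_closure_inverse = intermediate_ring_inverse[OF sep_closure_intermediate_ring]

lemma sep_closure_prod: "(\<And>i. i \<in> A \<Longrightarrow> f i \<in> sep_closure) \<Longrightarrow> prod f A \<in> sep_closure"
  by (induction A rule: infinite_finite_induct)
    (auto intro: sep_closure_mult intermediate_ring_1[OF sep_closure_intermediate_ring])

text \<open>
  If \<open>y ^ n\<close> is a simple root of \<open>f\<close>, then \<open>y\<close> is a simple root of \<open>f (t ^ n)\<close>, because
  \<open>n * y ^ (n - 1)\<close> is nonzero.
\<close>

lemma sep_closure_root:
  fixes y :: "'a::field alg_closure"
  assumes y: "y ^ n \<in> sep_closure" and n: "(of_nat n :: 'a) \<noteq> 0"
  shows "y \<in> sep_closure"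
proof (cases "y = 0")
  case False
  obtain f where f: "poly_ac f (y ^ n) = 0" "poly_ac (pderiv f) (y ^ n) \<noteq> 0"
    using y by (auto simp: sep_closure_iff)
  let ?g = "pcompose f (monom 1 n)"
  have "poly_ac ?g y = 0"
    using f(1) by (simp add: to_ac_hom.map_poly_pcompose poly_pcompose poly_monom)
  moreover have "poly_ac (pderiv ?g) y = poly_ac (pderiv f) (y ^ n) * (of_nat n * y ^ (n - 1))"
    by (simp add: to_ac_hom.map_poly_pcompose pderiv_pcompose poly_pcompose poly_monom pderiv_monom)
  moreover have "(of_nat n :: 'a alg_closure) \<noteq> 0"
    using n by (metis to_ac_eq_0_iff to_ac_of_nat)
  ultimately show ?thesis
    using f(2) False unfolding sep_closure_iff by (intro exI[of _ ?g]) simp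
qed (use to_ac_in_sep_closure[of 0] in simp)

section \<open>Extension of embeddings\<close>

text \<open>
  The graph of a homomorphism over the base field from an intermediate ring to the algebraic closure.
  Unions of chains of such graphs are again such graphs, which suits Zorn's lemma.
\<close>

definition embedding_graph :: "('a::field alg_closure \<times> 'a alg_closure) set \<Rightarrow> bool"
  where "embedding_graph r \<longleftrightarrow> (\<forall>c. (to_ac c, to_ac c) \<in> r) \<and>
    (\<forall>(x, a)\<in>r. \<forall>(y, b)\<in>r. (x + y, a + b) \<in> r \<and> (x * y, a * b) \<in> r) \<and>
    (\<forall>a. (0, a) \<in> r \<longrightarrow> a = 0)"

lemma embedding_graphI:
  assumes "\<And>c. (to_ac c, to_ac c) \<in> r"
    and "\<And>x a y b. (x, a) \<in> r \<Longrightarrow> (y, b) \<in> r \<Longrightarrow> (x + y, a + b) \<in> r \<and> (x * y, a * b) \<in> r"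
    and "\<And>a. (0, a) \<in> r \<Longrightarrow> a = 0"
  shows "embedding_graph r"
  using assms by (auto simp: embedding_graph_def)

lemma embedding_graphD:
  assumes "embedding_graph r"
  shows "(to_ac c, to_ac c) \<in> r"
    and "(x, a) \<in> r \<Longrightarrow> (y, b) \<in> r \<Longrightarrow> (x + y, a + b) \<in> r"
    and "(x, a) \<in> r \<Longrightarrow> (y, b) \<in> r \<Longrightarrow> (x * y, a * b) \<in> r"
    and "(0, a) \<in> r \<Longrightarrow> a = 0"
  using assms by (fastforce simp: embedding_graph_def)+

context
  fixes r :: "('a::field alg_closure \<times> 'a alg_closure) set"
  assumes r: "embedding_graph r"
begin

lemma embedding_graph_unique:
  assumes "(x, a) \<in> r" "(x, b) \<in> r"
  shows "a = b"
proof -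
  have "(- x, - b) \<in> r"
    using embedding_graphD(3)[OF r embedding_graphD(1)[OF r, of "-1"] assms(2)] by simp
  from embedding_graphD(2)[OF r assms(1) this] have "(0, a - b) \<in> r" by simp
  then show ?thesis using embedding_graphD(4)[OF r, of "a - b"] by simp
qed

lemma embedding_graph_0_iff: "(0, a) \<in> r \<longleftrightarrow> a = 0"
  using embedding_graphD(4)[OF r] embedding_graphD(1)[OF r, of 0] by auto

lemma embedding_graph_Domain: "intermediate_ring (Domain r)"
  unfolding intermediate_ring_def
proof (intro conjI ballI subsetI)
  show "x \<in> Domain r" if "x \<in> range to_ac" for x
    using that embedding_graphD(1)[OF r] by auto
  fix x y assume "x \<in> Domain r" "y \<in> Domain r"
  then obtain a b where "(x, a) \<in> r" "(y, b) \<in> r" by auto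
  then show "x + y \<in> Domain r" "x * y \<in> Domain r"
    using embedding_graphD(2,3)[OF r] by (blast intro: DomainI)+
qed

lemma poly_rel_embedding_unique: "poly_rel r f g \<Longrightarrow> poly_rel r f h \<Longrightarrow> g = h"
  by (rule poly_eqI) (auto simp: poly_rel_def intro: embedding_graph_unique)

lemma poly_rel_embedding_add:
  "poly_rel r f g \<Longrightarrow> poly_rel r f' g' \<Longrightarrow> poly_rel r (f + f') (g + g')"
  by (simp add: poly_rel_def embedding_graphD(2)[OF r])

lemma poly_rel_embedding_mult:
  assumes "poly_rel r f g" "poly_rel r f' g'"
  shows "poly_rel r (f * f') (g * g')"
  unfolding poly_rel_def coeff_mult
  using assms by (intro allI sum_pairs_in embedding_graphD(2,3)[OF r])
    (auto simp: poly_rel_def embedding_graph_0_iff)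

lemma poly_rel_embedding_const: "(c, d) \<in> r \<Longrightarrow> poly_rel r [:c:] [:d:]"
  by (auto simp: poly_rel_def coeff_pCons embedding_graph_0_iff split: nat.split)

text \<open>
  The image of \<open>x\<close> may be any root \<open>w\<close> of the image \<open>m1\<close> of the minimal polynomial of \<open>x\<close> over the
  domain.
\<close>

lemma embedding_graph_extend:
  obtains r' a where "embedding_graph r'" "r \<subseteq> r'" "(x, a) \<in> r'"
proof -
  note K = embedding_graph_Domain
  obtain m where m: "\<forall>n. coeff m n \<in> Domain r" "lead_coeff m = 1" "poly m x = 0"
    and m_dvd: "\<forall>f. (\<forall>n. coeff f n \<in> Domain r) \<and> poly f x = 0 \<longrightarrow>
      (\<exists>s. (\<forall>n. coeff s n \<in> Domain r) \<and> f = m * s)"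
    by (rule ex_min_poly_over[OF K, of x])
  obtain m1 where m1: "poly_rel r m m1"
    using ex_poly_rel[OF embedding_graph_0_iff m(1)] .
  have "degree m > 0"
  proof (rule ccontr)
    assume "\<not> degree m > 0"
    then obtain c where "m = [:c:]" by (auto elim: degree_eq_zeroE)
    then show False using m by simp
  qed
  moreover have "coeff m1 (degree m) = 1"
    using m1 m(2) embedding_graphD(1)[OF r, of 1] embedding_graph_unique
    unfolding poly_rel_def by (metis to_ac_1)
  then have "degree m \<le> degree m1" by (intro le_degree) simp
  ultimately obtain w where w: "poly m1 w = 0"
    using alg_closed_imp_poly_has_root[of m1] by auto
  define r' where "r' = {(poly f x, poly g w) | f g. poly_rel r f g}"
  have r'I: "(poly f x, poly g w) \<in> r'" if "poly_rel r f g" for f g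
    using that unfolding r'_def by blast
  have const: "(c, d) \<in> r'" if "(c, d) \<in> r" for c d
    using r'I[OF poly_rel_embedding_const[OF that]] by simp
  have arith: "(u + v, a + b) \<in> r' \<and> (u * v, a * b) \<in> r'" if "(u, a) \<in> r'" "(v, b) \<in> r'" for u v a b
  proof -
    obtain f g where fg: "poly_rel r f g" and eqs: "u = poly f x" "a = poly g w"
      using \<open>(u, a) \<in> r'\<close> unfolding r'_def by blast
    obtain f' g' where fg': "poly_rel r f' g'" and eqs': "v = poly f' x" "b = poly g' w"
      using \<open>(v, b) \<in> r'\<close> unfolding r'_def by blast
    show ?thesis
      using r'I[OF poly_rel_embedding_add[OF fg fg']] r'I[OF poly_rel_embedding_mult[OF fg fg']]
      by (simp add: eqs eqs')
  qed
  have single: "a = 0" if "(0, a) \<in> r'" for a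
  proof -
    obtain f g where fg: "poly_rel r f g" "poly f x = 0" "a = poly g w"
      using \<open>(0, a) \<in> r'\<close> unfolding r'_def by fastforce
    have "\<forall>n. coeff f n \<in> Domain r"
      using fg(1) unfolding poly_rel_def by (blast intro: DomainI)
    then obtain s where s: "\<forall>n. coeff s n \<in> Domain r" "f = m * s"
      using m_dvd fg(2) by blast
    obtain s1 where s1: "poly_rel r s s1"
      using ex_poly_rel[OF embedding_graph_0_iff s(1)] .
    have "g = m1 * s1"
      using poly_rel_embedding_unique[OF fg(1)] poly_rel_embedding_mult[OF m1 s1] s(2) by simp
    then show ?thesis using w by (simp add: fg(3))
  qed
  have "embedding_graph r'"
    using const[OF embedding_graphD(1)[OF r]] arith single by (rule embedding_graphI)
  moreover have "(x, w) \<in> r'"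
  proof -
    have "poly_rel r [:0, 1:] [:0, 1:]"
      using embedding_graphD(1)[OF r, of 1] embedding_graph_0_iff
      by (auto simp: poly_rel_def coeff_pCons split: nat.split)
    from r'I[OF this] show ?thesis by simp
  qed
  moreover have "r \<subseteq> r'" using const by auto
  ultimately show thesis using that by blast
qed

end

lemma embedding_graph_Union:
  assumes "C \<noteq> {}" and chain: "\<And>r s. r \<in> C \<Longrightarrow> s \<in> C \<Longrightarrow> r \<subseteq> s \<or> s \<subseteq> r"
    and C: "\<And>r. r \<in> C \<Longrightarrow> embedding_graph r"
  shows "embedding_graph (\<Union>C)"
proof (rule embedding_graphI)
  show "(to_ac c, to_ac c) \<in> \<Union>C" for c
  proof -
    obtain r where "r \<in> C" using assms(1) by blast
    then show ?thesis using embedding_graphD(1)[OF C] by blast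
  qed
  show "a = 0" if "(0, a) \<in> \<Union>C" for a
  proof -
    obtain r where "r \<in> C" "(0, a) \<in> r" using \<open>(0, a) \<in> \<Union>C\<close> by blast
    then show ?thesis using embedding_graphD(4)[OF C] by blast
  qed
  fix x a y b assume "(x, a) \<in> \<Union>C" "(y, b) \<in> \<Union>C"
  then obtain r s where rs: "r \<in> C" "(x, a) \<in> r" "s \<in> C" "(y, b) \<in> s" by blast
  then obtain t where "t \<in> C" "(x, a) \<in> t" "(y, b) \<in> t" using chain[of r s] by blast
  then show "(x + y, a + b) \<in> \<Union>C \<and> (x * y, a * b) \<in> \<Union>C"
    using embedding_graphD(2,3)[OF C[OF \<open>t \<in> C\<close>]] by blast
qed

lemma embedding_extends:
  fixes r :: "('a::field alg_closure \<times> 'a alg_closure) set"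
  assumes "embedding_graph r"
  obtains \<tau> where "\<And>c. \<tau> (to_ac c) = to_ac c" "\<And>x y. \<tau> (x + y) = \<tau> x + \<tau> y"
    "\<And>x y. \<tau> (x * y) = \<tau> x * \<tau> y" "\<And>x a. (x, a) \<in> r \<Longrightarrow> \<tau> x = a"
proof -
  let ?A = "{s. embedding_graph s \<and> r \<subseteq> s}"
  have "\<exists>M\<in>?A. \<forall>s\<in>?A. M \<subseteq> s \<longrightarrow> s = M"
  proof (rule subset_Zorn_nonempty)
    show "?A \<noteq> {}" using assms by blast
  next
    fix C assume C: "C \<noteq> {}" "subset.chain ?A C"
    then have "embedding_graph (\<Union>C)"
      by (intro embedding_graph_Union) (auto simp: subset_chain_def)
    moreover have "r \<subseteq> \<Union>C" using C unfolding subset_chain_def by blast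
    ultimately show "\<Union>C \<in> ?A" by blast
  qed
  then obtain M where "M \<in> ?A" and M_max: "\<forall>s\<in>?A. M \<subseteq> s \<longrightarrow> s = M" ..
  then have M: "embedding_graph M" "r \<subseteq> M" by simp_all
  have max: "s = M" if "embedding_graph s" "M \<subseteq> s" for s
    using M_max M(2) that by simp
  have total: "\<exists>a. (x, a) \<in> M" for x
  proof -
    obtain s a where "embedding_graph s" "M \<subseteq> s" "(x, a) \<in> s"
      using embedding_graph_extend[OF M(1)] .
    then show ?thesis using max[of s] by auto
  qed
  define \<tau> where "\<tau> x = (SOME a. (x, a) \<in> M)" for x
  have \<tau>: "(x, \<tau> x) \<in> M" for x
    unfolding \<tau>_def using total by (rule someI_ex)
  note unique = embedding_graph_unique[OF M(1) \<tau>]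
  show thesis
  proof
    show "\<tau> (to_ac c) = to_ac c" for c by (rule unique[OF embedding_graphD(1)[OF M(1)]])
    show "\<tau> (x + y) = \<tau> x + \<tau> y" for x y by (rule unique[OF embedding_graphD(2)[OF M(1) \<tau> \<tau>]])
    show "\<tau> (x * y) = \<tau> x * \<tau> y" for x y by (rule unique[OF embedding_graphD(3)[OF M(1) \<tau> \<tau>]])
    show "\<tau> x = a" if "(x, a) \<in> r" for x a
      using that M(2) by (intro unique) blast
  qed
qed

text \<open>
  Surjectivity on the separable closure holds because \<open>\<tau>\<close> maps the finite set of roots of a
  polynomial over the base field injectively to itself.
\<close>

lemma restrict_embedding_in_galois:
  fixes \<tau> :: "'a::field alg_closure \<Rightarrow> 'a alg_closure"
  assumes base: "\<And>c. \<tau> (to_ac c) = to_ac c" and add: "\<And>x y. \<tau> (x + y) = \<tau> x + \<tau> y"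
    and mult: "\<And>x y. \<tau> (x * y) = \<tau> x * \<tau> y"
  shows "restrict \<tau> sep_closure \<in> galois_automorphisms"
proof -
  have \<tau>_poly: "poly_ac f (\<tau> x) = \<tau> (poly_ac f x)" for f x
    using base[of 0] by (induction f) (simp_all add: base add mult)
  have nz: "\<tau> x \<noteq> 0" if "x \<noteq> 0" for x
    using mult[of x "inverse x"] base[of 1] that by auto
  have "\<tau> (x - y) = \<tau> x - \<tau> y" for x y
    using add[of "x - y" y] by simp
  then have inj: "inj \<tau>"
    using nz[of "_ - _"] by (auto intro!: injI)
  have "\<tau> x \<in> sep_closure" if "x \<in> sep_closure" for x
  proof -
    obtain f where "poly_ac f x = 0" "poly_ac (pderiv f) x \<noteq> 0"
      using \<open>x \<in> sep_closure\<close> by (auto simp: sep_closure_iff)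
    then have "poly_ac f (\<tau> x) = 0" "poly_ac (pderiv f) (\<tau> x) \<noteq> 0"
      unfolding \<tau>_poly using base[of 0] nz by auto
    then show ?thesis unfolding sep_closure_iff by blast
  qed
  moreover have "\<exists>x\<in>sep_closure. \<tau> x = y" if "y \<in> sep_closure" for y
  proof -
    obtain f where f: "poly_ac f y = 0" "poly_ac (pderiv f) y \<noteq> 0"
      using \<open>y \<in> sep_closure\<close> by (auto simp: sep_closure_iff)
    let ?R = "{z. poly_ac f z = 0}"
    have "finite ?R" using f(2) by (intro poly_roots_finite) auto
    moreover have "\<tau> ` ?R \<subseteq> ?R" using \<tau>_poly base[of 0] by auto
    ultimately have "\<tau> ` ?R = ?R" using inj by (intro endo_inj_surj) (auto intro: inj_on_subset)
    then have "y \<in> \<tau> ` ?R" using f(1) by simp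
    then obtain x where "y = \<tau> x" "x \<in> ?R" by (rule imageE)
    then have x: "poly_ac f x = 0" "\<tau> x = y" by simp_all
    then have "poly_ac (pderiv f) x \<noteq> 0" using f(2) \<tau>_poly[of "pderiv f" x] base[of 0] by auto
    with x(1) have "x \<in> sep_closure"
      unfolding sep_closure_iff by (intro exI[of _ f] conjI)
    with x(2) show ?thesis by (intro bexI[of _ x])
  qed
  ultimately have "bij_betw \<tau> sep_closure sep_closure"
    using inj unfolding bij_betw_def by (auto intro: inj_on_subset)
  then have "bij_betw (restrict \<tau> sep_closure) sep_closure sep_closure"
    by (simp add: bij_betw_cong[of sep_closure "restrict \<tau> sep_closure" \<tau>])
  then show ?thesis
    by (auto simp: galois_automorphisms_def Bij_def base add mult sep_closure_add sep_closure_mult)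
qed

text \<open>
  If \<open>x\<close> is not in the base field, its irreducible polynomial has a root \<open>y \<noteq> x\<close> by separability, and the
  homomorphism sending \<open>x\<close> to \<open>y\<close> extends to an automorphism that moves \<open>x\<close>.
\<close>

theorem galois_fixed_field:
  fixes x :: "'a::field alg_closure"
  assumes x: "x \<in> sep_closure" and fixed: "\<And>\<sigma>. \<sigma> \<in> galois_automorphisms \<Longrightarrow> \<sigma> x = x"
  shows "x \<in> range to_ac"
proof -
  obtain f where f: "Factorial_Ring.irreducible f" "rsquarefree (map_poly to_ac f)" "poly_ac f x = 0"
    using x by (auto simp: sep_closure_def)
  obtain q where q: "map_poly to_ac f = [:- x, 1:] * q"
    using f(3) poly_eq_0_iff_dvd by (metis dvdE)
  have q0: "q \<noteq> 0" using f(2) q by (auto simp: rsquarefree_def)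
  show ?thesis
  proof (cases "degree q = 0")
    case True
    then have "degree f = 1"
      using q0 arg_cong[OF q, of degree] by (simp add: degree_mult_eq del: mult_pCons_left)
    then obtain c d where cd: "f = [:c, d:]" "d \<noteq> 0" using degree1_coeffs by blast
    then have "x * to_ac d = - to_ac c"
      using f(3) by (simp add: eq_neg_iff_add_eq_0 add.commute)
    then have "x = to_ac (- c / d)" using cd(2) by (simp add: field_simps)
    then show ?thesis by blast
  next
    case False
    then obtain y where y: "poly q y = 0" using alg_closed_imp_poly_has_root[of q] by auto
    have "y \<noteq> x"
    proof
      assume "y = x"
      then have "[:- x, 1:] ^ 2 dvd map_poly to_ac f"
        unfolding q power2_eq_square using y by (intro mult_dvd_mono) (simp_all add: poly_eq_0_iff_dvd)
      moreover have "order x (map_poly to_ac f) = 1"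
        using f by (intro rsquarefree_root_order) (auto simp: rsquarefree_def)
      ultimately show False using f by (simp add: order_divides rsquarefree_def)
    qed
    have fy: "poly_ac f y = 0" using y by (simp add: q)
    let ?r = "range (\<lambda>g. (poly_ac g x, poly_ac g y))"
    have "embedding_graph ?r"
    proof (rule embedding_graphI)
      show "(to_ac c, to_ac c) \<in> ?r" for c
        by (rule range_eqI[of _ _ "[:c:]"]) simp
      show "a = 0" if "(0, a) \<in> ?r" for a
      proof -
        obtain g where "poly_ac g x = 0" "a = poly_ac g y" using \<open>(0, a) \<in> ?r\<close> by force
        moreover from this have "f dvd g" by (intro irreducible_root_dvd[OF f(1,3)])
        then obtain s where "g = f * s" by (rule dvdE)
        ultimately show ?thesis using fy by simp
      qed
      fix u a v b assume "(u, a) \<in> ?r" "(v, b) \<in> ?r"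
      then obtain g h where "u = poly_ac g x" "a = poly_ac g y" "v = poly_ac h x" "b = poly_ac h y"
        by blast
      then have "(u + v, a + b) = (poly_ac (g + h) x, poly_ac (g + h) y)"
        "(u * v, a * b) = (poly_ac (g * h) x, poly_ac (g * h) y)" by simp_all
      then show "(u + v, a + b) \<in> ?r \<and> (u * v, a * b) \<in> ?r" by blast
    qed
    then obtain \<tau> where \<tau>: "\<And>c. \<tau> (to_ac c) = to_ac c" "\<And>x y. \<tau> (x + y) = \<tau> x + \<tau> y"
      "\<And>x y. \<tau> (x * y) = \<tau> x * \<tau> y" "\<And>x a. (x, a) \<in> ?r \<Longrightarrow> \<tau> x = a"
      using embedding_extends by blast
    have "(x, y) \<in> ?r" by (rule range_eqI[of _ _ "[:0, 1:]"]) simp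
    then have "\<tau> x = y" by (rule \<tau>(4))
    then show ?thesis
      using fixed[OF restrict_embedding_in_galois[OF \<tau>(1-3)]] x \<open>y \<noteq> x\<close> by simp
  qed
qed

section \<open>The absolute Galois group\<close>

lemma galois_closed: "\<sigma> \<in> galois_automorphisms \<Longrightarrow> x \<in> sep_closure \<Longrightarrow> \<sigma> x \<in> sep_closure"
  unfolding galois_automorphisms_def using Bij_imp_funcset by blast

lemma galois_add: "\<sigma> \<in> galois_automorphisms \<Longrightarrow> x \<in> sep_closure \<Longrightarrow> y \<in> sep_closure \<Longrightarrow>
    \<sigma> (x + y) = \<sigma> x + \<sigma> y"
  and galois_mult: "\<sigma> \<in> galois_automorphisms \<Longrightarrow> x \<in> sep_closure \<Longrightarrow> y \<in> sep_closure \<Longrightarrow>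
    \<sigma> (x * y) = \<sigma> x * \<sigma> y"
  and galois_base: "\<sigma> \<in> galois_automorphisms \<Longrightarrow> \<sigma> (to_ac c) = to_ac c"
  by (auto simp: galois_automorphisms_def)

lemma galois_0: "\<sigma> \<in> galois_automorphisms \<Longrightarrow> \<sigma> 0 = 0"
  and galois_1: "\<sigma> \<in> galois_automorphisms \<Longrightarrow> \<sigma> 1 = 1"
  using galois_base[of \<sigma> 0] galois_base[of \<sigma> 1] by simp_all

lemma galois_inj: "\<sigma> \<in> galois_automorphisms \<Longrightarrow> x \<in> sep_closure \<Longrightarrow> y \<in> sep_closure \<Longrightarrow>
    \<sigma> x = \<sigma> y \<longleftrightarrow> x = y"
  by (rule inj_on_eq_iff[of \<sigma> sep_closure])
    (simp_all add: galois_automorphisms_def Bij_def bij_betw_def)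

lemmas sep_closure_0 [simp] = intermediate_ring_0[OF sep_closure_intermediate_ring]
  and sep_closure_1 [simp] = intermediate_ring_1[OF sep_closure_intermediate_ring]

lemma galois_eq_0: "\<sigma> \<in> galois_automorphisms \<Longrightarrow> x \<in> sep_closure \<Longrightarrow> \<sigma> x = 0 \<longleftrightarrow> x = 0"
  using galois_inj[of \<sigma> x 0] by (simp add: galois_0)

lemma galois_inverse:
  assumes "\<sigma> \<in> galois_automorphisms" "x \<in> sep_closure"
  shows "\<sigma> (inverse x) = inverse (\<sigma> x)"
proof (cases "x = 0")
  case False
  then have "\<sigma> x * \<sigma> (inverse x) = 1"
    using galois_mult[OF assms sep_closure_inverse[OF assms(2)]] assms by (simp add: galois_1)
  then show ?thesis by (rule inverse_unique[symmetric])
qed (use assms in \<open>simp add: galois_0\<close>)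

lemma galois_prod:
  assumes "\<sigma> \<in> galois_automorphisms" and "\<And>i. i \<in> A \<Longrightarrow> f i \<in> sep_closure"
  shows "\<sigma> (\<Prod>i\<in>A. f i) = (\<Prod>i\<in>A. \<sigma> (f i))"
  using assms(2)
  by (induction A rule: infinite_finite_induct)
    (simp_all add: galois_1[OF assms(1)] galois_mult[OF assms(1)] sep_closure_prod)

lemma galois_sum:
  assumes "\<sigma> \<in> galois_automorphisms" and "\<And>i. i \<in> A \<Longrightarrow> f i \<in> sep_closure"
  shows "\<sigma> (\<Sum>i\<in>A. f i) = (\<Sum>i\<in>A. \<sigma> (f i))"
  using assms(2)
  by (induction A rule: infinite_finite_induct)
    (simp_all add: galois_0[OF assms(1)] galois_add[OF assms(1)] intermediate_ring_sum[OF sep_closure_intermediate_ring])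

lemma sep_closure_power: "x \<in> sep_closure \<Longrightarrow> x ^ n \<in> sep_closure"
  using sep_closure_prod[of "{..<n}" "\<lambda>_. x"] by simp

lemma galois_power: "\<sigma> \<in> galois_automorphisms \<Longrightarrow> x \<in> sep_closure \<Longrightarrow> \<sigma> (x ^ n) = \<sigma> x ^ n"
  using galois_prod[of \<sigma> "{..<n}" "\<lambda>_. x"] by simp

lemma galois_poly:
  assumes \<sigma>: "\<sigma> \<in> galois_automorphisms" and "x \<in> sep_closure"
  shows "\<sigma> (poly_ac f x) = poly_ac f (\<sigma> x)"
  using assms(2)
  by (induction f)
    (simp_all add: galois_0[OF \<sigma>] galois_base[OF \<sigma>] galois_add[OF \<sigma>] galois_mult[OF \<sigma>] sep_closure_mult
      intermediate_ring_poly[OF sep_closure_intermediate_ring])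

text \<open>
  The conjugates of \<open>x\<close> are roots of any polynomial over the base field that vanishes at \<open>x\<close>.
\<close>

lemma galois_orbit_finite:
  assumes "x \<in> sep_closure"
  shows "finite {\<sigma> x | \<sigma>. \<sigma> \<in> galois_automorphisms}"
proof -
  obtain f where f: "poly_ac f x = 0" "f \<noteq> 0"
    by (rule alg_closure_algebraic[of x])
  have "{\<sigma> x | \<sigma>. \<sigma> \<in> galois_automorphisms} \<subseteq> {y. poly_ac f y = 0}"
  proof
    fix y assume "y \<in> {\<sigma> x | \<sigma>. \<sigma> \<in> galois_automorphisms}"
    then obtain \<sigma> where "\<sigma> \<in> galois_automorphisms" "y = \<sigma> x" by blast
    then show "y \<in> {y. poly_ac f y = 0}"
      using galois_poly[of \<sigma> x f] assms f(1) by (simp add: galois_0)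
  qed
  moreover have "finite {y. poly_ac f y = 0}"
    using f(2) by (intro poly_roots_finite) simp
  ultimately show ?thesis by (rule finite_subset)
qed

lemma galois_ext:
  assumes "\<sigma> \<in> galois_automorphisms" "\<tau> \<in> galois_automorphisms"
    and "\<And>x. x \<in> sep_closure \<Longrightarrow> \<sigma> x = \<tau> x"
  shows "\<sigma> = \<tau>"
  using assms extensionalityI[of \<sigma> sep_closure \<tau>]
  by (auto simp: galois_automorphisms_def Bij_def)

abbreviation galois_mult_op (infixl "\<otimes>\<^sub>G" 70)
  where "\<sigma> \<otimes>\<^sub>G \<tau> \<equiv> \<sigma> \<otimes>\<^bsub>absolute_galois_group\<^esub> \<tau>"

lemma carrier_absolute_galois_group [simp]: "carrier absolute_galois_group = galois_automorphisms"
  by (simp add: absolute_galois_group_def)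

lemma galois_compose:
  assumes "\<sigma> \<in> galois_automorphisms" "\<tau> \<in> galois_automorphisms"
  shows "x \<in> sep_closure \<Longrightarrow> (\<sigma> \<otimes>\<^sub>G \<tau>) x = \<sigma> (\<tau> x)"
    and "\<sigma> \<otimes>\<^sub>G \<tau> \<in> galois_automorphisms"
proof -
  have eq: "\<sigma> \<otimes>\<^sub>G \<tau> = compose sep_closure \<sigma> \<tau>"
    using assms by (simp add: absolute_galois_group_def BijGroup_def galois_automorphisms_def)
  then show "x \<in> sep_closure \<Longrightarrow> (\<sigma> \<otimes>\<^sub>G \<tau>) x = \<sigma> (\<tau> x)"
    by (simp add: compose_def)
  have "compose sep_closure \<sigma> \<tau> \<in> Bij sep_closure"
    using assms by (intro compose_Bij) (simp_all add: galois_automorphisms_def)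
  then show "\<sigma> \<otimes>\<^sub>G \<tau> \<in> galois_automorphisms"
    unfolding eq using assms
    by (subst galois_automorphisms_def)
      (simp add: compose_def galois_base galois_add galois_mult galois_closed sep_closure_add
        sep_closure_mult)
qed

lemma galois_one:
  shows "x \<in> sep_closure \<Longrightarrow> \<one>\<^bsub>absolute_galois_group\<^esub> x = x"
    and "\<one>\<^bsub>absolute_galois_group\<^esub> \<in> galois_automorphisms"
  by (auto simp: absolute_galois_group_def BijGroup_def galois_automorphisms_def id_Bij
      sep_closure_add sep_closure_mult)

lemma group_absolute_galois_group: "group absolute_galois_group"
proof (rule groupI, unfold carrier_absolute_galois_group)
  fix \<sigma> \<tau> \<rho> :: "'a alg_closure \<Rightarrow> 'a alg_closure"
  assume \<sigma>: "\<sigma> \<in> galois_automorphisms"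
  show "\<one>\<^bsub>absolute_galois_group\<^esub> \<otimes>\<^sub>G \<sigma> = \<sigma>"
    by (rule galois_ext) (simp_all add: galois_compose galois_one galois_closed \<sigma>)
  show "\<exists>\<tau>\<in>galois_automorphisms. \<tau> \<otimes>\<^sub>G \<sigma> = \<one>\<^bsub>absolute_galois_group\<^esub>"
  proof
    let ?\<tau> = "restrict (inv_into sep_closure \<sigma>) sep_closure"
    have bij: "bij_betw \<sigma> sep_closure sep_closure"
      using \<sigma> by (simp add: galois_automorphisms_def Bij_def)
    have inv: "inv_into sep_closure \<sigma> (\<sigma> x) = x" if "x \<in> sep_closure" for x
      using bij that by (rule bij_betw_inv_into_left)
    have inv': "\<sigma> (inv_into sep_closure \<sigma> x) = x" if "x \<in> sep_closure" for x
      using bij that by (rule bij_betw_inv_into_right)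
    have inv_in: "inv_into sep_closure \<sigma> x \<in> sep_closure" if "x \<in> sep_closure" for x
      using bij that by (metis bij_betw_imp_surj_on inv_into_into)
    have "?\<tau> \<in> Bij sep_closure"
      using \<sigma> by (intro restrict_inv_into_Bij) (simp add: galois_automorphisms_def)
    moreover have "?\<tau> (x + y) = ?\<tau> x + ?\<tau> y" "?\<tau> (x * y) = ?\<tau> x * ?\<tau> y"
      if "x \<in> sep_closure" "y \<in> sep_closure" for x y
    proof -
      have "\<sigma> (?\<tau> x + ?\<tau> y) = x + y" "\<sigma> (?\<tau> x * ?\<tau> y) = x * y"
        using that by (simp_all add: galois_add[OF \<sigma>] galois_mult[OF \<sigma>] inv' inv_in)
      then show "?\<tau> (x + y) = ?\<tau> x + ?\<tau> y" "?\<tau> (x * y) = ?\<tau> x * ?\<tau> y"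
        using inv[of "?\<tau> x + ?\<tau> y"] inv[of "?\<tau> x * ?\<tau> y"] that
        by (simp_all add: sep_closure_add sep_closure_mult inv_in)
    qed
    moreover have "?\<tau> (to_ac c) = to_ac c" for c
      using inv[of "to_ac c"] by (simp add: galois_base[OF \<sigma>])
    ultimately show \<tau>: "?\<tau> \<in> galois_automorphisms"
      unfolding galois_automorphisms_def by blast
    show "?\<tau> \<otimes>\<^sub>G \<sigma> = \<one>\<^bsub>absolute_galois_group\<^esub>"
      by (rule galois_ext) (simp_all add: galois_compose galois_one galois_closed \<sigma> \<tau> inv)
  qed
  assume \<tau>: "\<tau> \<in> galois_automorphisms"
  show "\<sigma> \<otimes>\<^sub>G \<tau> \<in> galois_automorphisms" by (rule galois_compose[OF \<sigma> \<tau>])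
  assume \<rho>: "\<rho> \<in> galois_automorphisms"
  show "\<sigma> \<otimes>\<^sub>G \<tau> \<otimes>\<^sub>G \<rho> = \<sigma> \<otimes>\<^sub>G (\<tau> \<otimes>\<^sub>G \<rho>)"
    by (rule galois_ext) (simp_all add: galois_compose galois_closed \<sigma> \<tau> \<rho>)
qed (rule galois_one)

interpretation galois: group absolute_galois_group
  by (rule group_absolute_galois_group)

lemma galois_inv_apply:
  assumes "\<sigma> \<in> galois_automorphisms" "x \<in> sep_closure"
  shows "\<sigma> ((inv\<^bsub>absolute_galois_group\<^esub> \<sigma>) x) = x" "(inv\<^bsub>absolute_galois_group\<^esub> \<sigma>) (\<sigma> x) = x"
  using assms galois.inv_closed[of \<sigma>] galois.r_inv[of \<sigma>] galois.l_inv[of \<sigma>]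
    galois_compose(1)[of \<sigma> "inv\<^bsub>absolute_galois_group\<^esub> \<sigma>" x]
    galois_compose(1)[of "inv\<^bsub>absolute_galois_group\<^esub> \<sigma>" \<sigma> x]
  by (simp_all add: galois_one)

lemma galois_PiE: "galois_automorphisms \<subseteq> sep_closure \<rightarrow>\<^sub>E sep_closure"
proof
  fix \<sigma> :: "'a alg_closure \<Rightarrow> 'a alg_closure"
  assume "\<sigma> \<in> galois_automorphisms"
  then show "\<sigma> \<in> sep_closure \<rightarrow>\<^sub>E sep_closure"
    using galois_closed[of \<sigma>] by (auto simp: galois_automorphisms_def Bij_def PiE_def)
qed

lemma topspace_krull_topology: "topspace krull_topology = galois_automorphisms"
  by (simp add: krull_topology_def inf.absorb2[OF galois_PiE])

lemma cochains1_cong: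
  assumes "f \<in> cochains1 absolute_galois_group"
    and "\<And>\<sigma>. \<sigma> \<in> galois_automorphisms \<Longrightarrow> f \<sigma> = g \<sigma>"
  shows "g \<in> cochains1 absolute_galois_group"
  using assms continuous_map_eq[of krull_topology "discrete_topology UNIV" f g]
  by (simp add: cochains1_def absolute_galois_group_def topspace_krull_topology)

lemma evaluation_continuous:
  assumes "x \<in> sep_closure"
  shows "continuous_map (group_topology absolute_galois_group) (discrete_topology UNIV) (\<lambda>\<sigma>. h (\<sigma> x))"
proof -
  have "continuous_map krull_topology (discrete_topology sep_closure) (\<lambda>\<sigma>. \<sigma> x)"
    unfolding krull_topology_def
    by (intro continuous_map_from_subtopology continuous_map_product_projection assms)
  moreover have "continuous_map (discrete_topology sep_closure) (discrete_topology UNIV) h"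
    by simp
  ultimately have "continuous_map krull_topology (discrete_topology UNIV) (h \<circ> (\<lambda>\<sigma>. \<sigma> x))"
    by (rule continuous_map_compose)
  then show ?thesis
    by (simp add: absolute_galois_group_def o_def)
qed

text \<open>
  The pointwise stabilisers of finite sets of separable elements form a basis of neighbourhoods of the
  identity in the Krull topology.
\<close>

lemma cochain_locally_constant:
  fixes f :: "('a::field alg_closure \<Rightarrow> 'a alg_closure) \<Rightarrow> 'p::prime_card mod_ring"
  assumes f: "f \<in> cochains1 absolute_galois_group"
  obtains T where "finite T" "T \<subseteq> sep_closure"
    "\<forall>\<sigma>\<in>galois_automorphisms. (\<forall>t\<in>T. \<sigma> t = t) \<longrightarrow> f \<sigma> = f \<one>\<^bsub>absolute_galois_group\<^esub>"
proof -
  let ?one = "\<one>\<^bsub>absolute_galois_group\<^esub>"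
  let ?P = "product_topology (\<lambda>_. discrete_topology sep_closure) sep_closure"
  have "openin krull_topology {\<sigma> \<in> topspace krull_topology. f \<sigma> = f ?one}"
    using f continuous_map_discrete_UNIV_iff[of krull_topology f]
    by (simp add: cochains1_def absolute_galois_group_def)
  then have "openin krull_topology {\<sigma> \<in> galois_automorphisms. f \<sigma> = f ?one}"
    by (simp add: topspace_krull_topology)
  then obtain V where V: "openin ?P V"
    "{\<sigma> \<in> galois_automorphisms. f \<sigma> = f ?one} = V \<inter> galois_automorphisms"
    unfolding krull_topology_def openin_subtopology by blast
  have "?one \<in> {\<sigma> \<in> galois_automorphisms. f \<sigma> = f ?one}" using galois_one(2) by simp
  then have "?one \<in> V" unfolding V(2) by simp
  then obtain W where W: "?one \<in> (\<Pi>\<^sub>E i\<in>sep_closure. W i)" "finite {i. W i \<noteq> sep_closure}"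
    "(\<Pi>\<^sub>E i\<in>sep_closure. W i) \<subseteq> V"
    using product_topology_open_contains_basis[OF V(1) \<open>?one \<in> V\<close>] by auto
  show thesis
  proof
    let ?T = "{i. W i \<noteq> sep_closure} \<inter> sep_closure"
    show "finite ?T" using W(2) by simp
    show "?T \<subseteq> sep_closure" by blast
    show "\<forall>\<sigma>\<in>galois_automorphisms. (\<forall>t\<in>?T. \<sigma> t = t) \<longrightarrow> f \<sigma> = f ?one"
    proof (intro ballI impI)
      fix \<sigma> assume \<sigma>: "\<sigma> \<in> galois_automorphisms" and fix_T: "\<forall>t\<in>?T. \<sigma> t = t"
      have "\<sigma> i \<in> W i" if "i \<in> sep_closure" for i
      proof (cases "W i = sep_closure")
        case False
        then show ?thesis using fix_T that PiE_mem[OF W(1) that] by (simp add: galois_one)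
      qed (use galois_closed[OF \<sigma> that] in simp)
      then have "\<sigma> \<in> (\<Pi>\<^sub>E i\<in>sep_closure. W i)" using galois_PiE \<sigma> by (auto simp: PiE_def)
      then have "\<sigma> \<in> V \<inter> galois_automorphisms" using W(3) \<sigma> by auto
      then show "f \<sigma> = f ?one" unfolding V(2)[symmetric] by simp
    qed
  qed
qed

section \<open>Independence of characters and Hilbert's Theorem 90\<close>

text \<open>
  Dedekind's argument: subtract from the relation at \<open>y * x\<close> the value \<open>q0 y\<close> times the relation at
  \<open>x\<close>. This eliminates \<open>q0\<close> and multiplies the coefficient of \<open>q\<close> by \<open>q y - q0 y\<close>.
\<close>

lemma dedekind_independence:
  fixes Q :: "('b::comm_monoid_mult \<Rightarrow> 'c::field) set"
  assumes "finite Q" and R: "1 \<in> R" "\<And>x y. x \<in> R \<Longrightarrow> y \<in> R \<Longrightarrow> x * y \<in> R"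
    and "\<And>q. q \<in> Q \<Longrightarrow> q 1 = 1"
    and "\<And>q x y. q \<in> Q \<Longrightarrow> x \<in> R \<Longrightarrow> y \<in> R \<Longrightarrow> q (x * y) = q x * q y"
    and "\<And>q q'. q \<in> Q \<Longrightarrow> q' \<in> Q \<Longrightarrow> q \<noteq> q' \<Longrightarrow> \<exists>x\<in>R. q x \<noteq> q' x"
    and "\<And>x. x \<in> R \<Longrightarrow> (\<Sum>q\<in>Q. c q * q x) = 0"
    and "q \<in> Q"
  shows "c q = 0"
  using assms(1,4-)
proof (induction Q arbitrary: c q rule: finite_induct)
  case (insert q0 Q)
  note one = insert.prems(1) and mult = insert.prems(2) and sep = insert.prems(3)
    and rel = insert.prems(4)
  have 0: "c q = 0" if q: "q \<in> Q" for q
  proof -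
    obtain y where y: "y \<in> R" "q y \<noteq> q0 y" using sep[of q q0] q insert.hyps by blast
    have "c q * (q y - q0 y) = 0"
    proof (rule insert.IH[of "\<lambda>q. c q * (q y - q0 y)"])
      fix x assume x: "x \<in> R"
      have "0 = (\<Sum>q\<in>insert q0 Q. c q * q (y * x)) - q0 y * (\<Sum>q\<in>insert q0 Q. c q * q x)"
        using rel[OF x] rel[OF R(2)[OF y(1) x]] by simp
      also have "\<dots> = (\<Sum>q\<in>insert q0 Q. c q * (q y - q0 y) * q x)"
        unfolding sum_distrib_left sum_subtractf[symmetric]
        using mult[OF _ y(1) x] by (intro sum.cong refl) (simp add: algebra_simps)
      also have "\<dots> = (\<Sum>q\<in>Q. c q * (q y - q0 y) * q x)"
        using insert.hyps by simp
      finally show "(\<Sum>q\<in>Q. c q * (q y - q0 y) * q x) = 0" by simp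
    qed (use one mult sep q in auto)
    then show ?thesis using y(2) by simp
  qed
  have "c q0 = (\<Sum>q\<in>insert q0 Q. c q * q 1)"
    using insert.hyps one 0 by simp
  also have "\<dots> = 0" by (rule rel[OF R(1)])
  finally show ?case using 0 insert.prems(5) by blast
qed simp

text \<open>
  For characters with values in the base field the cocycle is trivialised by a Lagrange resolvent
  \<open>\<Sum> inverse (\<psi> \<sigma>) * \<sigma> \<theta>\<close>, which is nonzero for some \<open>\<theta>\<close> by independence of characters. As
  \<open>H\<close> may be infinite, the sum ranges over the restrictions of its elements to the set \<open>R\<close> of elements
  fixed by the stabiliser of \<open>T\<close> in \<open>H\<close>.
\<close>

theorem hilbert_90:
  fixes \<psi> :: "('a::field alg_closure \<Rightarrow> 'a alg_closure) \<Rightarrow> 'a"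
  assumes H: "subgroup H absolute_galois_group"
    and \<psi>_mult: "\<And>\<sigma> \<tau>. \<sigma> \<in> H \<Longrightarrow> \<tau> \<in> H \<Longrightarrow> \<psi> (\<sigma> \<otimes>\<^sub>G \<tau>) = \<psi> \<sigma> * \<psi> \<tau>"
    and \<psi>_nz: "\<And>\<sigma>. \<sigma> \<in> H \<Longrightarrow> \<psi> \<sigma> \<noteq> 0"
    and T: "finite T" "T \<subseteq> sep_closure"
    and \<psi>_T: "\<And>\<sigma>. \<sigma> \<in> H \<Longrightarrow> (\<And>t. t \<in> T \<Longrightarrow> \<sigma> t = t) \<Longrightarrow> \<psi> \<sigma> = 1"
  obtains \<gamma> where "\<gamma> \<in> sep_closure" "\<gamma> \<noteq> 0" "\<forall>\<sigma>\<in>H. \<sigma> \<gamma> = to_ac (\<psi> \<sigma>) * \<gamma>"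
proof -
  let ?G = "absolute_galois_group :: ('a alg_closure \<Rightarrow> 'a alg_closure) topgroup"
  have HG: "\<sigma> \<in> galois_automorphisms" if "\<sigma> \<in> H" for \<sigma>
    using subgroup.mem_carrier[OF H that] by simp
  have H_one: "\<one>\<^bsub>?G\<^esub> \<in> H" and H_mult: "\<And>\<sigma> \<tau>. \<sigma> \<in> H \<Longrightarrow> \<tau> \<in> H \<Longrightarrow> \<sigma> \<otimes>\<^sub>G \<tau> \<in> H"
    and H_inv: "\<And>\<sigma>. \<sigma> \<in> H \<Longrightarrow> inv\<^bsub>?G\<^esub> \<sigma> \<in> H"
    using subgroup.one_closed[OF H] subgroup.m_closed[OF H] subgroup.m_inv_closed[OF H] by auto
  define R where "R = {x \<in> sep_closure. \<forall>\<sigma>\<in>H. (\<forall>t\<in>T. \<sigma> t = t) \<longrightarrow> \<sigma> x = x}"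
  have R_sep: "x \<in> sep_closure" if "x \<in> R" for x using that by (simp add: R_def)
  have T_R: "T \<subseteq> R" using T(2) by (auto simp: R_def)
  have one_R: "1 \<in> R" by (simp add: R_def galois_1 HG)
  have mult_R: "x * y \<in> R" if "x \<in> R" "y \<in> R" for x y
    using that by (auto simp: R_def sep_closure_mult galois_mult HG)
  \<comment> \<open>The next facts say that on \<open>R\<close>, and as far as \<open>\<psi>\<close> is concerned, an automorphism in \<open>H\<close> is
    determined by its values on the finite set \<open>T\<close>; hence only finitely many restrictions to \<open>R\<close> occur.\<close>
  have quotient: "inv\<^bsub>?G\<^esub> \<tau> \<otimes>\<^sub>G \<sigma> \<in> H" "\<forall>t\<in>T. (inv\<^bsub>?G\<^esub> \<tau> \<otimes>\<^sub>G \<sigma>) t = t"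
    if "\<sigma> \<in> H" "\<tau> \<in> H" "\<forall>t\<in>T. \<sigma> t = \<tau> t" for \<sigma> \<tau>
  proof -
    show "inv\<^bsub>?G\<^esub> \<tau> \<otimes>\<^sub>G \<sigma> \<in> H" using that H_mult H_inv by blast
    show "\<forall>t\<in>T. (inv\<^bsub>?G\<^esub> \<tau> \<otimes>\<^sub>G \<sigma>) t = t"
    proof
      fix t assume t: "t \<in> T"
      then have ts: "t \<in> sep_closure" using T(2) by blast
      have "(inv\<^bsub>?G\<^esub> \<tau> \<otimes>\<^sub>G \<sigma>) t = (inv\<^bsub>?G\<^esub> \<tau>) (\<tau> t)"
        using galois_compose(1)[OF HG[OF H_inv[OF that(2)]] HG[OF that(1)] ts] that(3) t by simp
      also have "\<dots> = t" by (rule galois_inv_apply(2)[OF HG[OF that(2)] ts])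
      finally show "(inv\<^bsub>?G\<^esub> \<tau> \<otimes>\<^sub>G \<sigma>) t = t" .
    qed
  qed
  have eq_quotient: "\<tau> \<otimes>\<^sub>G (inv\<^bsub>?G\<^esub> \<tau> \<otimes>\<^sub>G \<sigma>) = \<sigma>" if "\<sigma> \<in> H" "\<tau> \<in> H" for \<sigma> \<tau>
    using HG[OF that(1)] HG[OF that(2)] HG[OF H_inv[OF that(2)]]
    by (simp add: galois.m_assoc[symmetric])
  have \<psi>_cong: "\<psi> \<sigma> = \<psi> \<tau>" if "\<sigma> \<in> H" "\<tau> \<in> H" "\<forall>t\<in>T. \<sigma> t = \<tau> t" for \<sigma> \<tau>
  proof -
    have "\<psi> (inv\<^bsub>?G\<^esub> \<tau> \<otimes>\<^sub>G \<sigma>) = 1" using quotient[OF that] \<psi>_T by blast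
    then have "\<psi> (\<tau> \<otimes>\<^sub>G (inv\<^bsub>?G\<^esub> \<tau> \<otimes>\<^sub>G \<sigma>)) = \<psi> \<tau>"
      using \<psi>_mult[OF that(2) quotient(1)[OF that]] by simp
    then show ?thesis unfolding eq_quotient[OF that(1,2)] .
  qed
  have R_cong: "\<sigma> x = \<tau> x" if "\<sigma> \<in> H" "\<tau> \<in> H" "\<forall>t\<in>T. \<sigma> t = \<tau> t" "x \<in> R" for \<sigma> \<tau> x
  proof -
    have "(inv\<^bsub>?G\<^esub> \<tau> \<otimes>\<^sub>G \<sigma>) x = x" using quotient[OF that(1-3)] that(4) by (auto simp: R_def)
    then have "(\<tau> \<otimes>\<^sub>G (inv\<^bsub>?G\<^esub> \<tau> \<otimes>\<^sub>G \<sigma>)) x = \<tau> x"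
      using galois_compose(1)[OF HG[OF that(2)] HG[OF quotient(1)[OF that(1-3)]] R_sep[OF that(4)]] by simp
    then show ?thesis unfolding eq_quotient[OF that(1,2)] .
  qed
  define Q where "Q = (\<lambda>\<sigma>. restrict \<sigma> R) ` H"
  have "finite Q"
  proof (rule inj_on_finite[of "\<lambda>q. restrict q T"])
    show "inj_on (\<lambda>q. restrict q T) Q"
    proof (rule inj_onI)
      fix q q' assume "q \<in> Q" "q' \<in> Q" and eq: "restrict q T = restrict q' T"
      then obtain \<sigma> \<tau> where \<sigma>\<tau>: "\<sigma> \<in> H" "q = restrict \<sigma> R" "\<tau> \<in> H" "q' = restrict \<tau> R"
        by (auto simp: Q_def)
      have "\<forall>t\<in>T. \<sigma> t = \<tau> t"
      proof
        fix t assume "t \<in> T"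
        then show "\<sigma> t = \<tau> t"
          using fun_cong[OF eq, of t] T_R unfolding \<sigma>\<tau> by auto
      qed
      then show "q = q'" using R_cong[OF \<sigma>\<tau>(1,3)] unfolding \<sigma>\<tau> by (intro restrict_ext)
    qed
    show "(\<lambda>q. restrict q T) ` Q \<subseteq> (\<Pi>\<^sub>E t\<in>T. {\<sigma> t | \<sigma>. \<sigma> \<in> galois_automorphisms})"
    proof
      fix g assume "g \<in> (\<lambda>q. restrict q T) ` Q"
      then obtain \<sigma> where \<sigma>: "\<sigma> \<in> H" "g = restrict (restrict \<sigma> R) T" by (auto simp: Q_def)
      have "g t \<in> {\<sigma> t | \<sigma>. \<sigma> \<in> galois_automorphisms}" if "t \<in> T" for t
      proof -
        have "g t = \<sigma> t" using \<open>t \<in> T\<close> T_R by (auto simp: \<sigma>(2))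
        then show ?thesis using HG[OF \<sigma>(1)] by blast
      qed
      then show "g \<in> (\<Pi>\<^sub>E t\<in>T. {\<sigma> t | \<sigma>. \<sigma> \<in> galois_automorphisms})"
        by (intro PiE_I) (simp_all add: \<sigma>(2))
    qed
    show "finite (\<Pi>\<^sub>E t\<in>T. {\<sigma> t | \<sigma>. \<sigma> \<in> (galois_automorphisms :: ('a alg_closure \<Rightarrow> 'a alg_closure) set)})"
      using T by (intro finite_PiE galois_orbit_finite) auto
  qed
  define c where "c q = inverse (\<psi> (SOME \<sigma>. \<sigma> \<in> H \<and> q = restrict \<sigma> R))" for q
  have c: "c (restrict \<sigma> R) = inverse (\<psi> \<sigma>)" if \<sigma>: "\<sigma> \<in> H" for \<sigma>
  proof -
    define \<tau> where "\<tau> = (SOME \<tau>. \<tau> \<in> H \<and> restrict \<sigma> R = restrict \<tau> R)"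
    have \<tau>: "\<tau> \<in> H" "restrict \<sigma> R = restrict \<tau> R"
      using someI[of "\<lambda>\<tau>. \<tau> \<in> H \<and> restrict \<sigma> R = restrict \<tau> R" \<sigma>] \<sigma> by (simp_all add: \<tau>_def)
    have "\<forall>t\<in>T. \<sigma> t = \<tau> t"
    proof
      fix t assume "t \<in> T"
      then have "t \<in> R" using T_R by blast
      then show "\<sigma> t = \<tau> t" using fun_cong[OF \<tau>(2), of t] by simp
    qed
    then show ?thesis using \<psi>_cong[OF \<sigma> \<tau>(1)] by (simp add: c_def \<tau>_def)
  qed
  have "\<exists>\<theta>\<in>R. (\<Sum>q\<in>Q. to_ac (c q) * q \<theta>) \<noteq> 0"
  proof (rule ccontr)
    assume no: "\<not> (\<exists>\<theta>\<in>R. (\<Sum>q\<in>Q. to_ac (c q) * q \<theta>) \<noteq> 0)"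
    have "to_ac (c (restrict \<one>\<^bsub>?G\<^esub> R)) = 0"
    proof (rule dedekind_independence[OF \<open>finite Q\<close> one_R mult_R, where c = "\<lambda>q. to_ac (c q)"])
      show "q 1 = 1" if "q \<in> Q" for q
        using that one_R by (auto simp: Q_def galois_1 HG)
      show "q (x * y) = q x * q y" if "q \<in> Q" "x \<in> R" "y \<in> R" for q x y
        using that mult_R by (auto simp: Q_def galois_mult HG R_sep)
      show "\<exists>x\<in>R. q x \<noteq> q' x" if q: "q \<in> Q" "q' \<in> Q" "q \<noteq> q'" for q q'
      proof (rule ccontr)
        assume "\<not> (\<exists>x\<in>R. q x \<noteq> q' x)"
        moreover have "q \<in> extensional R" "q' \<in> extensional R" using q by (auto simp: Q_def)
        ultimately show False using q(3) extensionalityI[of q R q'] by blast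
      qed
      show "(\<Sum>q\<in>Q. to_ac (c q) * q x) = 0" if "x \<in> R" for x using no that by blast
      show "restrict \<one>\<^bsub>?G\<^esub> R \<in> Q" using H_one by (auto simp: Q_def)
    qed
    then show False using c[OF H_one] \<psi>_nz[OF H_one] by simp
  qed
  then obtain \<theta> where \<theta>: "\<theta> \<in> R" and nz: "(\<Sum>q\<in>Q. to_ac (c q) * q \<theta>) \<noteq> 0" ..
  define \<gamma> where "\<gamma> = (\<Sum>q\<in>Q. to_ac (c q) * q \<theta>)"
  have Q_sep: "q \<theta> \<in> sep_closure" if "q \<in> Q" for q
    using that \<theta> by (auto simp: Q_def galois_closed HG R_sep)
  have term_sep: "to_ac (c q) * q \<theta> \<in> sep_closure" if "q \<in> Q" for q
    using Q_sep[OF that] by (simp add: sep_closure_mult)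
  show thesis
  proof
    show "\<gamma> \<in> sep_closure" unfolding \<gamma>_def
      by (intro intermediate_ring_sum[OF sep_closure_intermediate_ring] term_sep)
    show "\<gamma> \<noteq> 0" using nz by (simp add: \<gamma>_def)
    show "\<forall>\<sigma>\<in>H. \<sigma> \<gamma> = to_ac (\<psi> \<sigma>) * \<gamma>"
    proof
      fix \<sigma> assume \<sigma>: "\<sigma> \<in> H"
      define m where "m q = restrict (\<lambda>x. \<sigma> (q x)) R" for q
      have m: "m (restrict \<tau> R) = restrict (\<sigma> \<otimes>\<^sub>G \<tau>) R" if "\<tau> \<in> H" for \<tau>
        unfolding m_def using galois_compose(1)[OF HG[OF \<sigma>] HG[OF that]] R_sep
        by (intro restrict_ext) simp
      have m_Q: "m q \<in> Q" if "q \<in> Q" for q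
        using that m H_mult[OF \<sigma>] by (auto simp: Q_def)
      have "inj_on m Q"
      proof (rule inj_onI)
        fix q q' assume q: "q \<in> Q" "q' \<in> Q" and eq: "m q = m q'"
        have "q x = q' x" if "x \<in> R" for x
        proof -
          have "\<sigma> (q x) = \<sigma> (q' x)" using fun_cong[OF eq, of x] that by (simp add: m_def)
          moreover have "q x \<in> sep_closure" "q' x \<in> sep_closure"
            using q that by (auto simp: Q_def galois_closed HG R_sep)
          ultimately show ?thesis using galois_inj[OF HG[OF \<sigma>]] by blast
        qed
        moreover have "q \<in> extensional R" "q' \<in> extensional R" using q by (auto simp: Q_def)
        ultimately show "q = q'" using extensionalityI[of q R q'] by blast
      qed
      moreover have "m ` Q = Q"
        using \<open>finite Q\<close> m_Q \<open>inj_on m Q\<close> by (intro endo_inj_surj) auto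
      ultimately have bij: "bij_betw m Q Q" by (simp add: bij_betw_def)
      have c_m: "c q = \<psi> \<sigma> * c (m q)" if "q \<in> Q" for q
      proof -
        obtain \<tau> where \<tau>: "\<tau> \<in> H" "q = restrict \<tau> R" using \<open>q \<in> Q\<close> by (auto simp: Q_def)
        show ?thesis
          using \<psi>_nz[OF \<sigma>] \<psi>_nz[OF \<tau>(1)]
          by (simp add: \<tau>(2) m[OF \<tau>(1)] c[OF \<tau>(1)] c[OF H_mult[OF \<sigma> \<tau>(1)]] \<psi>_mult[OF \<sigma> \<tau>(1)])
      qed
      have "\<sigma> \<gamma> = (\<Sum>q\<in>Q. \<sigma> (to_ac (c q) * q \<theta>))"
        unfolding \<gamma>_def by (rule galois_sum[OF HG[OF \<sigma>] term_sep])
      also have "\<dots> = (\<Sum>q\<in>Q. to_ac (\<psi> \<sigma>) * (to_ac (c (m q)) * m q \<theta>))"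
      proof (rule sum.cong[OF refl])
        fix q assume q: "q \<in> Q"
        have "\<sigma> (to_ac (c q) * q \<theta>) = to_ac (c q) * \<sigma> (q \<theta>)"
          using galois_mult[OF HG[OF \<sigma>] _ Q_sep[OF q]] by (simp add: galois_base[OF HG[OF \<sigma>]])
        then show "\<sigma> (to_ac (c q) * q \<theta>) = to_ac (\<psi> \<sigma>) * (to_ac (c (m q)) * m q \<theta>)"
          using c_m[OF q] \<theta> by (simp add: m_def)
      qed
      also have "\<dots> = to_ac (\<psi> \<sigma>) * \<gamma>"
        unfolding \<gamma>_def sum_distrib_left[symmetric]
        using sum.reindex_bij_betw[OF bij, of "\<lambda>q. to_ac (c q) * q \<theta>"] by simp
      finally show "\<sigma> \<gamma> = to_ac (\<psi> \<sigma>) * \<gamma>" .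
    qed
  qed
qed

section \<open>Kummer characters\<close>

text \<open>
  Exponents live in the prime field, which is where Kummer characters take their values.
\<close>

definition root_power :: "'a::field \<Rightarrow> 'p::prime_card mod_ring \<Rightarrow> 'a"
  where "root_power \<xi> c = \<xi> ^ nat (to_int_mod_ring c)"

lemma of_nat_nat_to_int_mod_ring [simp]:
  "(of_nat (nat (to_int_mod_ring c)) :: 'p::prime_card mod_ring) = c"
proof -
  have "0 \<le> to_int_mod_ring c" using range_to_int_mod_ring by (metis atLeastLessThan_iff rangeI)
  then show ?thesis by (simp add: of_nat_of_int_mod_ring)
qed

lemma root_nonzero: "x ^ CARD('p::finite) = to_ac c \<Longrightarrow> c \<noteq> 0 \<Longrightarrow> x \<noteq> 0"
  by (auto simp: power_0_left)

context
  fixes \<xi> :: "'a::field"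
  assumes prim: "primitive_root_of_unity CARD('p::prime_card) \<xi>"
begin

lemma primitive_root_power_card: "\<xi> ^ CARD('p) = 1"
  using prim by (simp add: primitive_root_of_unity_def)

lemma root_power_of_nat: "root_power \<xi> (of_nat n :: 'p mod_ring) = \<xi> ^ n"
proof -
  have "(of_nat n :: 'p mod_ring) = of_int_mod_ring (int n)" by (simp add: of_nat_of_int_mod_ring)
  then have "to_int_mod_ring (of_nat n :: 'p mod_ring) = int n mod int CARD('p)"
    by (metis of_int_mod_ring.rep_eq to_int_mod_ring.rep_eq)
  then have "nat (to_int_mod_ring (of_nat n :: 'p mod_ring)) = n mod CARD('p)"
    by (metis nat_int zmod_int)
  then have "root_power \<xi> (of_nat n :: 'p mod_ring) = \<xi> ^ (n mod CARD('p))"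
    by (simp add: root_power_def)
  also have "\<dots> = \<xi> ^ (n mod CARD('p)) * (\<xi> ^ CARD('p)) ^ (n div CARD('p))"
    by (simp add: primitive_root_power_card)
  also have "\<dots> = \<xi> ^ n"
    by (simp add: power_add[symmetric] power_mult[symmetric])
  finally show ?thesis .
qed

lemma root_power_0 [simp]: "root_power \<xi> (0 :: 'p mod_ring) = 1"
  using root_power_of_nat[of 0] by simp

lemma root_power_add:
  "root_power \<xi> (c + d :: 'p mod_ring) = root_power \<xi> c * root_power \<xi> d"
proof -
  obtain m n where "c = of_nat m" "d = of_nat n"
    using surj_of_nat_mod_ring by metis
  then show ?thesis
    by (simp add: root_power_of_nat power_add flip: of_nat_add)
qed

lemma root_power_sum:
  "root_power \<xi> (\<Sum>i\<in>A. f i :: 'p mod_ring) = (\<Prod>i\<in>A. root_power \<xi> (f i))"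
  by (induction A rule: infinite_finite_induct) (simp_all add: root_power_add)

lemma root_power_nonzero: "root_power \<xi> (c :: 'p mod_ring) \<noteq> 0"
  using root_power_add[of c "- c"] by auto

lemma root_power_power_card: "root_power \<xi> (c :: 'p mod_ring) ^ CARD('p) = 1"
proof -
  obtain m where "c = of_nat m" using surj_of_nat_mod_ring by metis
  then have "root_power \<xi> c ^ CARD('p) = (\<xi> ^ CARD('p)) ^ m"
    by (simp add: root_power_of_nat power_mult[symmetric] mult.commute)
  then show ?thesis by (simp add: primitive_root_power_card)
qed

lemma root_power_inject: "root_power \<xi> c = root_power \<xi> d \<longleftrightarrow> c = (d :: 'p mod_ring)"
proof
  assume eq: "root_power \<xi> c = root_power \<xi> d"
  have "root_power \<xi> (c - d) = 1"
    using root_power_add[of "c - d" d] eq root_power_nonzero[of d] by simp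
  moreover obtain n where n: "n < CARD('p)" "c - d = of_nat n"
    using surj_of_nat_mod_ring by metis
  ultimately have "\<xi> ^ n = 1" by (simp add: root_power_of_nat)
  then have "n = 0" using prim n(1) by (auto simp: primitive_root_of_unity_def)
  then show "c = d" using n(2) by simp
qed simp

text \<open>
  In characteristic \<open>p\<close> the equation \<open>\<xi> ^ p = 1\<close> says \<open>(\<xi> - 1) ^ p = 0\<close>, so 1 would be the only \<open>p\<close>-th
  root of unity.
\<close>

lemma card_nonzero_in_field: "(of_nat CARD('p) :: 'a) \<noteq> 0"
proof
  assume 0: "(of_nat CARD('p) :: 'a) = 0"
  have p: "prime CARD('p)" by (rule prime_card)
  from 0 have "CHAR('a) dvd CARD('p)" by (simp add: of_nat_eq_0_iff_char_dvd)
  then have char: "CHAR('a) = CARD('p)"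
    using p CHAR_not_1' by (auto simp: prime_nat_iff)
  have "\<xi> ^ CARD('p) = (\<xi> - 1 + 1) ^ CARD('p)" by simp
  also have "\<dots> = (\<xi> - 1) ^ CARD('p) + 1 ^ CARD('p)"
    by (rule freshmans_dream) (use p char in simp_all)
  finally have "(\<xi> - 1) ^ CARD('p) = 0" by (simp add: primitive_root_power_card)
  then have "\<xi> ^ 1 = 1" by simp
  then show False
    using prim prime_gt_1_nat[OF p] unfolding primitive_root_of_unity_def by blast
qed

text \<open>
  The powers of \<open>\<xi>\<close> already provide as many roots as the degree of \<open>t ^ p - 1\<close> permits.
\<close>

lemma root_of_unity_is_root_power:
  fixes x :: "'a alg_closure"
  assumes "x ^ CARD('p) = 1"
  obtains c :: "'p mod_ring" where "x = to_ac (root_power \<xi> c)"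
proof -
  let ?R = "{y :: 'a alg_closure. y ^ CARD('p) = 1}"
  let ?g = "monom 1 CARD('p) - 1 :: 'a alg_closure poly"
  have g: "poly ?g y = y ^ CARD('p) - 1" for y by (simp add: poly_monom)
  have "coeff ?g CARD('p) = 1" by simp
  then have g0: "?g \<noteq> 0" by (metis coeff_0 zero_neq_one)
  have R: "?R = {y. poly ?g y = 0}" unfolding g by simp
  have "degree ?g \<le> CARD('p)" by (intro degree_diff_le) (simp_all add: degree_monom_le)
  then have "card ?R \<le> CARD('p)" using card_poly_roots_bound[OF g0] unfolding R by linarith
  moreover have fin: "finite ?R" unfolding R by (rule poly_roots_finite[OF g0])
  let ?Z = "range (\<lambda>c :: 'p mod_ring. to_ac (root_power \<xi> c))"
  have "inj (\<lambda>c :: 'p mod_ring. to_ac (root_power \<xi> c))"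
    by (intro injI) (simp add: root_power_inject)
  then have "card ?Z = CARD('p)" by (simp add: card_image)
  moreover have "?Z \<subseteq> ?R" by (auto simp: root_power_power_card simp flip: to_ac_power)
  ultimately have "?Z = ?R" using card_seteq[OF fin, of ?Z] by simp
  then have "x \<in> ?Z" using assms by simp
  then show thesis using that by blast
qed

lemma equal_powers_root_power:
  fixes x y :: "'a alg_closure"
  assumes "x ^ CARD('p) = y ^ CARD('p)" and "y \<noteq> 0"
  obtains c :: "'p mod_ring" where "x = to_ac (root_power \<xi> c) * y"
proof -
  have "(x / y) ^ CARD('p) = 1" using assms by (simp add: power_divide)
  then obtain c :: "'p mod_ring" where "x / y = to_ac (root_power \<xi> c)"
    using root_of_unity_is_root_power by blast
  then show thesis using that assms(2) by (simp add: field_simps)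
qed

lemma ex_root_in_sep_closure:
  assumes "x \<in> sep_closure"
  obtains y :: "'a alg_closure" where "y \<in> sep_closure" "y ^ CARD('p) = x"
proof -
  obtain y where "y ^ CARD('p) = x"
    using nth_root_exists[of "CARD('p)" x] by auto
  then show thesis using that sep_closure_root[of y "CARD('p)"] card_nonzero_in_field assms by simp
qed

lemma kummer_char_apply:
  assumes \<sigma>: "\<sigma> \<in> galois_automorphisms" and "a \<noteq> 0"
    and \<alpha>: "\<alpha> \<in> sep_closure" "\<alpha> ^ CARD('p) = to_ac a"
  shows "\<sigma> \<alpha> = to_ac (root_power \<xi> (kummer_char \<xi> a \<sigma> :: 'p mod_ring)) * \<alpha>"
proof -
  have "\<alpha> \<noteq> 0" using \<alpha>(2) \<open>a \<noteq> 0\<close> by (auto simp: root_nonzero)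
  have "(\<sigma> \<alpha>) ^ CARD('p) = \<alpha> ^ CARD('p)"
    using galois_power[OF \<sigma> \<alpha>(1), of "CARD('p)"] by (simp add: \<alpha>(2) galois_base[OF \<sigma>])
  then obtain c :: "'p mod_ring" where c: "\<sigma> \<alpha> = to_ac (root_power \<xi> c) * \<alpha>"
    using equal_powers_root_power \<open>\<alpha> \<noteq> 0\<close> by blast
  have "kummer_char \<xi> a \<sigma> = c"
    unfolding kummer_char_def
  proof (rule the_equality, intro ballI impI)
    fix \<alpha>' :: "'a alg_closure" assume "\<alpha>' \<in> sep_closure" "\<alpha>' ^ CARD('p) = to_ac a"
    then obtain d :: "'p mod_ring" where d: "\<alpha>' = to_ac (root_power \<xi> d) * \<alpha>"
      using equal_powers_root_power[of \<alpha>' \<alpha>] \<alpha>(2) \<open>\<alpha> \<noteq> 0\<close> by auto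
    then have "\<sigma> \<alpha>' = to_ac (root_power \<xi> d) * \<sigma> \<alpha>"
      using galois_mult[OF \<sigma> to_ac_in_sep_closure \<alpha>(1)] by (simp add: galois_base[OF \<sigma>])
    then show "\<sigma> \<alpha>' = to_ac \<xi> ^ nat (to_int_mod_ring c) * \<alpha>'"
      by (simp add: c d root_power_def)
  next
    fix d :: "'p mod_ring"
    assume "\<forall>\<alpha>\<in>sep_closure. \<alpha> ^ CARD('p) = to_ac a \<longrightarrow>
      \<sigma> \<alpha> = to_ac \<xi> ^ nat (to_int_mod_ring d) * \<alpha>"
    then have "\<sigma> \<alpha> = to_ac (root_power \<xi> d) * \<alpha>" using \<alpha> by (simp add: root_power_def)
    then show "d = c" using c \<open>\<alpha> \<noteq> 0\<close> by (simp add: root_power_inject)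
  qed
  then show ?thesis using c by simp
qed

lemma kummer_char_eqI:
  assumes "\<sigma> \<in> galois_automorphisms" "a \<noteq> 0"
    and "\<alpha> \<in> sep_closure" "\<alpha> ^ CARD('p) = to_ac a"
    and "\<sigma> \<alpha> = to_ac (root_power \<xi> c) * \<alpha>"
  shows "kummer_char \<xi> a \<sigma> = (c :: 'p mod_ring)"
proof -
  have "\<alpha> \<noteq> 0" using assms by (auto simp: root_nonzero)
  then show ?thesis
    using kummer_char_apply[OF assms(1-4)] assms(5) by (simp add: root_power_inject)
qed

lemma kummer_char_mult:
  assumes "\<sigma> \<in> galois_automorphisms" "\<tau> \<in> galois_automorphisms" "a \<noteq> 0"
  shows "kummer_char \<xi> a (\<sigma> \<otimes>\<^sub>G \<tau>) = kummer_char \<xi> a \<sigma> + (kummer_char \<xi> a \<tau> :: 'p mod_ring)"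
proof -
  obtain \<alpha> where \<alpha>: "\<alpha> \<in> sep_closure" "\<alpha> ^ CARD('p) = to_ac a"
    by (rule ex_root_in_sep_closure[OF to_ac_in_sep_closure])
  show ?thesis
  proof (rule kummer_char_eqI[OF _ assms(3) \<alpha>])
    show "\<sigma> \<otimes>\<^sub>G \<tau> \<in> galois_automorphisms" using assms by (intro galois_compose)
    have "(\<sigma> \<otimes>\<^sub>G \<tau>) \<alpha> = \<sigma> (\<tau> \<alpha>)" by (rule galois_compose(1)[OF assms(1,2) \<alpha>(1)])
    also have "\<dots> = \<sigma> (to_ac (root_power \<xi> (kummer_char \<xi> a \<tau> :: 'p mod_ring)) * \<alpha>)"
      by (simp only: kummer_char_apply[OF assms(2,3) \<alpha>])
    also have "\<dots> = to_ac (root_power \<xi> (kummer_char \<xi> a \<tau> :: 'p mod_ring)) * \<sigma> \<alpha>"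
      using galois_mult[OF assms(1) to_ac_in_sep_closure \<alpha>(1)] by (simp add: galois_base[OF assms(1)])
    also have "\<dots> = to_ac (root_power \<xi> (kummer_char \<xi> a \<tau> :: 'p mod_ring)) *
        (to_ac (root_power \<xi> (kummer_char \<xi> a \<sigma> :: 'p mod_ring)) * \<alpha>)"
      by (simp only: kummer_char_apply[OF assms(1,3) \<alpha>])
    finally show "(\<sigma> \<otimes>\<^sub>G \<tau>) \<alpha> =
        to_ac (root_power \<xi> (kummer_char \<xi> a \<sigma> + (kummer_char \<xi> a \<tau> :: 'p mod_ring))) * \<alpha>"
      by (simp add: root_power_add)
  qed
qed

lemma kummer_char_one:
  assumes "a \<noteq> 0"
  shows "kummer_char \<xi> a \<one>\<^bsub>absolute_galois_group\<^esub> = (0 :: 'p mod_ring)"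
proof -
  let ?e = "\<one>\<^bsub>absolute_galois_group\<^esub> :: 'a alg_closure \<Rightarrow> 'a alg_closure"
  have e: "?e \<in> galois_automorphisms" by (rule galois_one(2))
  then have "?e \<otimes>\<^sub>G ?e = ?e" using galois.r_one[of ?e] by simp
  then have "kummer_char \<xi> a ?e = kummer_char \<xi> a ?e + (kummer_char \<xi> a ?e :: 'p mod_ring)"
    using kummer_char_mult[OF e e assms] by simp
  then show ?thesis by (metis add_cancel_right_left)
qed

lemma kummer_char_inv:
  assumes "\<sigma> \<in> galois_automorphisms" "a \<noteq> 0"
  shows "kummer_char \<xi> a (inv\<^bsub>absolute_galois_group\<^esub> \<sigma>) = - (kummer_char \<xi> a \<sigma> :: 'p mod_ring)"
proof -
  have inv: "inv\<^bsub>absolute_galois_group\<^esub> \<sigma> \<in> galois_automorphisms"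
    using galois.inv_closed[of \<sigma>] assms by simp
  have "kummer_char \<xi> a (inv\<^bsub>absolute_galois_group\<^esub> \<sigma>) + (kummer_char \<xi> a \<sigma> :: 'p mod_ring) = 0"
    using kummer_char_mult[OF inv assms] kummer_char_one[OF assms(2)] galois.l_inv[of \<sigma>] assms by simp
  then show ?thesis by (simp add: eq_neg_iff_add_eq_0)
qed

lemma kummer_char_pow:
  assumes "\<sigma> \<in> galois_automorphisms" "a \<noteq> 0"
  shows "kummer_char \<xi> a (\<sigma> [^]\<^bsub>absolute_galois_group\<^esub> n) = of_nat n * (kummer_char \<xi> a \<sigma> :: 'p mod_ring)"
proof (induction n)
  case 0
  show ?case using kummer_char_one[OF assms(2)] by simp
next
  case (Suc n)
  have "\<sigma> [^]\<^bsub>absolute_galois_group\<^esub> n \<in> galois_automorphisms"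
    using galois.nat_pow_closed[of \<sigma> n] assms(1) by simp
  then show ?case
    using kummer_char_mult[OF _ assms] Suc by (simp add: algebra_simps)
qed

lemma kummer_char_in_cochains1:
  assumes "a \<noteq> 0"
  shows "(kummer_char \<xi> a :: _ \<Rightarrow> 'p mod_ring) \<in> cochains1 absolute_galois_group"
proof -
  obtain \<alpha> where \<alpha>: "\<alpha> \<in> sep_closure" "\<alpha> ^ CARD('p) = to_ac a"
    by (rule ex_root_in_sep_closure[OF to_ac_in_sep_closure])
  have "\<alpha> \<noteq> 0" using \<alpha>(2) assms by (auto simp: root_nonzero)
  show ?thesis
  proof (rule cochains1_cong)
    let ?h = "\<lambda>x. THE c :: 'p mod_ring. x = to_ac (root_power \<xi> c) * \<alpha>"
    show "(\<lambda>\<sigma>. ?h (\<sigma> \<alpha>)) \<in> cochains1 absolute_galois_group"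
      unfolding cochains1_def by (intro CollectI evaluation_continuous \<alpha>)
    show "?h (\<sigma> \<alpha>) = kummer_char \<xi> a \<sigma>" if "\<sigma> \<in> galois_automorphisms" for \<sigma>
      using kummer_char_apply[OF that assms \<alpha>] \<open>\<alpha> \<noteq> 0\<close>
      by (intro the_equality) (simp_all add: root_power_inject)
  qed
qed

end

section \<open>The norm equation\<close>

context
  fixes \<xi> a b :: "'a::field"
  assumes prim: "primitive_root_of_unity CARD('p::prime_card) \<xi>"
    and a: "a \<noteq> 0" and b: "b \<noteq> 0"
begin

abbreviation (input) "\<chi>\<^sub>a \<equiv> kummer_char \<xi> a :: _ \<Rightarrow> 'p mod_ring"
abbreviation (input) "\<chi>\<^sub>b \<equiv> kummer_char \<xi> b :: _ \<Rightarrow> 'p mod_ring"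

text \<open>
  By \<open>galois_fixed_field\<close>, a relation \<open>m * \<chi>\<^sub>a + n * \<chi>\<^sub>b = 0\<close> on the whole group makes \<open>a ^ m * b ^ n\<close>
  a \<open>p\<close>-th power, so independence of \<open>a\<close> and \<open>b\<close> excludes nontrivial relations. If \<open>\<chi>\<^sub>a\<close> vanished on
  the kernel of \<open>\<chi>\<^sub>b\<close>, it would be a multiple of \<open>\<chi>\<^sub>b\<close>. Hence \<open>\<chi>\<^sub>a\<close> takes a nonzero value on the
  kernel of \<open>\<chi>\<^sub>b\<close>, and a suitable power of the automorphism brings this value to 1.
\<close>

lemma ex_automorphism_kummer_chars_1_0:
  assumes indep: "independent_mod_powers CARD('p) a b"
  obtains \<sigma> where "\<sigma> \<in> galois_automorphisms" "\<chi>\<^sub>a \<sigma> = 1" "\<chi>\<^sub>b \<sigma> = 0"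
proof -
  let ?G = "absolute_galois_group :: ('a alg_closure \<Rightarrow> 'a alg_closure) topgroup"
  note mult = kummer_char_mult[OF prim] and pow = kummer_char_pow[OF prim]
    and kinv = kummer_char_inv[OF prim]
  have pow_G: "\<sigma> [^]\<^bsub>?G\<^esub> n \<in> galois_automorphisms" if "\<sigma> \<in> galois_automorphisms" for \<sigma> and n :: nat
    using galois.nat_pow_closed[of \<sigma> n] that by simp
  have not_dvd: "\<not> int CARD('p) dvd 1"
    using prime_gt_1_nat[OF prime_card[where ?'a = 'p]] by simp
  obtain \<alpha> where \<alpha>: "\<alpha> \<in> sep_closure" "\<alpha> ^ CARD('p) = to_ac a"
    by (rule ex_root_in_sep_closure[OF prim to_ac_in_sep_closure])
  obtain \<beta> where \<beta>: "\<beta> \<in> sep_closure" "\<beta> ^ CARD('p) = to_ac b"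
    by (rule ex_root_in_sep_closure[OF prim to_ac_in_sep_closure])
  have nonzero: "\<exists>\<sigma>\<in>galois_automorphisms. of_nat m * \<chi>\<^sub>a \<sigma> + of_nat n * \<chi>\<^sub>b \<sigma> \<noteq> 0"
    if "m = 1 \<or> n = 1" for m n :: nat
  proof (rule ccontr)
    assume "\<not> ?thesis"
    then have zero: "of_nat m * \<chi>\<^sub>a \<sigma> + of_nat n * \<chi>\<^sub>b \<sigma> = 0" if "\<sigma> \<in> galois_automorphisms" for \<sigma>
      using that by blast
    have "\<alpha> ^ m * \<beta> ^ n \<in> range to_ac"
    proof (rule galois_fixed_field)
      show "\<alpha> ^ m * \<beta> ^ n \<in> sep_closure"
        by (intro sep_closure_mult sep_closure_power \<alpha> \<beta>)
      fix \<sigma> :: "'a alg_closure \<Rightarrow> 'a alg_closure" assume \<sigma>: "\<sigma> \<in> galois_automorphisms"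
      obtain i where i: "\<chi>\<^sub>a \<sigma> = of_nat i" using surj_of_nat_mod_ring by metis
      obtain j where j: "\<chi>\<^sub>b \<sigma> = of_nat j" using surj_of_nat_mod_ring by metis
      have "\<sigma> (\<alpha> ^ m * \<beta> ^ n) = \<sigma> \<alpha> ^ m * \<sigma> \<beta> ^ n"
        using \<alpha> \<beta> by (simp add: galois_mult[OF \<sigma>] galois_power[OF \<sigma>] sep_closure_power)
      also have "\<dots> = to_ac (\<xi> ^ (m * i + n * j)) * (\<alpha> ^ m * \<beta> ^ n)"
        using kummer_char_apply[OF prim \<sigma> a \<alpha>] kummer_char_apply[OF prim \<sigma> b \<beta>]
        by (simp add: i j root_power_of_nat[OF prim] power_mult_distrib power_add power_mult mult.commute
            flip: to_ac_power to_ac_mult)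
      also have "\<xi> ^ (m * i + n * j) = root_power \<xi> (of_nat (m * i + n * j) :: 'p mod_ring)"
        by (rule root_power_of_nat[OF prim, symmetric])
      also have "(of_nat (m * i + n * j) :: 'p mod_ring) = 0"
        using zero[OF \<sigma>] by (simp add: i j)
      finally show "\<sigma> (\<alpha> ^ m * \<beta> ^ n) = \<alpha> ^ m * \<beta> ^ n"
        by (simp add: root_power_0[OF prim])
    qed
    then obtain c where c: "\<alpha> ^ m * \<beta> ^ n = to_ac c" by blast
    have "to_ac (c ^ CARD('p)) = (\<alpha> ^ CARD('p)) ^ m * (\<beta> ^ CARD('p)) ^ n"
      by (simp flip: c add: power_mult_distrib power_mult[symmetric] mult.commute)
    then have "to_ac (c ^ CARD('p)) = to_ac (a ^ m * b ^ n)" by (simp add: \<alpha> \<beta>)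
    then have "a powi int m * b powi int n = c ^ CARD('p)" by (simp only: to_ac_eq_iff) simp
    moreover have "c \<noteq> 0"
    proof
      assume "c = 0"
      then have "a ^ m * b ^ n = 0" using calculation by (simp add: power_0_left)
      then show False using a b by simp
    qed
    ultimately have "int CARD('p) dvd int m \<and> int CARD('p) dvd int n"
      using indep unfolding independent_mod_powers_def by blast
    then show False using \<open>m = 1 \<or> n = 1\<close> not_dvd by auto
  qed
  have "\<exists>\<sigma>\<in>galois_automorphisms. \<chi>\<^sub>b \<sigma> = 0 \<and> \<chi>\<^sub>a \<sigma> \<noteq> 0"
  proof (rule ccontr)
    assume no: "\<not> ?thesis"
    obtain \<tau> where \<tau>: "\<tau> \<in> galois_automorphisms" "\<chi>\<^sub>b \<tau> \<noteq> 0" using nonzero[of 0 1] by auto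
    obtain n where n: "- (\<chi>\<^sub>a \<tau> / \<chi>\<^sub>b \<tau>) = of_nat n" using surj_of_nat_mod_ring by metis
    obtain \<sigma> where \<sigma>: "\<sigma> \<in> galois_automorphisms" "\<chi>\<^sub>a \<sigma> + of_nat n * \<chi>\<^sub>b \<sigma> \<noteq> 0"
      using nonzero[of 1 n] by auto
    obtain m where m: "- (\<chi>\<^sub>b \<sigma> / \<chi>\<^sub>b \<tau>) = of_nat m" using surj_of_nat_mod_ring by metis
    let ?\<rho> = "\<sigma> \<otimes>\<^sub>G \<tau> [^]\<^bsub>?G\<^esub> m"
    have \<rho>: "?\<rho> \<in> galois_automorphisms" by (intro galois_compose \<sigma> pow_G \<tau>)
    have "\<chi>\<^sub>b ?\<rho> = 0"
      using \<tau>(2) by (simp add: mult[OF \<sigma>(1) pow_G[OF \<tau>(1)] b] pow[OF \<tau>(1) b] flip: m)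
    then have "\<chi>\<^sub>a ?\<rho> = 0" using no \<rho> by blast
    then have "\<chi>\<^sub>a \<sigma> + of_nat m * \<chi>\<^sub>a \<tau> = 0"
      by (simp add: mult[OF \<sigma>(1) pow_G[OF \<tau>(1)] a] pow[OF \<tau>(1) a])
    then show False using \<sigma>(2) by (simp add: field_simps flip: m n)
  qed
  then obtain \<tau> where \<tau>: "\<tau> \<in> galois_automorphisms" "\<chi>\<^sub>b \<tau> = 0" "\<chi>\<^sub>a \<tau> \<noteq> 0" by blast
  obtain m where m: "inverse (\<chi>\<^sub>a \<tau>) = of_nat m" using surj_of_nat_mod_ring by metis
  show thesis
  proof
    show "\<tau> [^]\<^bsub>?G\<^esub> m \<in> galois_automorphisms" by (rule pow_G[OF \<tau>(1)])
    show "\<chi>\<^sub>a (\<tau> [^]\<^bsub>?G\<^esub> m) = 1" using \<tau>(3) by (simp add: pow[OF \<tau>(1) a] flip: m)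
    show "\<chi>\<^sub>b (\<tau> [^]\<^bsub>?G\<^esub> m) = 0" by (simp add: pow[OF \<tau>(1) b] \<tau>(2))
  qed
qed

text \<open>
  Both \<open>\<beta>\<close> and \<open>s \<gamma> / \<gamma>\<close> are multiplied by \<open>\<xi> ^ \<chi>\<^sub>b h\<close> under \<open>h\<close> in the kernel \<open>H\<close> of \<open>\<chi>\<^sub>a\<close>, the
  latter because conjugating \<open>h\<close> by \<open>s\<close> changes \<open>\<phi> h\<close> by \<open>\<chi>\<^sub>b h\<close>. So their quotient is invariant
  under \<open>H\<close>, and its translates depend on the value of \<open>\<chi>\<^sub>a\<close> only. The condition \<open>\<chi>\<^sub>b s = 0\<close> does two
  things: \<open>s\<close> fixes \<open>\<beta>\<close>, and \<open>\<phi>\<close> is additive on the powers of \<open>s\<close>, which makes the product of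
  the translates equal to \<open>b\<close> on the nose rather than up to a root of unity.
\<close>

lemma ex_norm_family:
  assumes indep: "independent_mod_powers CARD('p) a b"
    and \<phi>: "\<phi> \<in> cochains1 absolute_galois_group"
    and cob: "\<And>\<sigma> \<tau>. \<sigma> \<in> galois_automorphisms \<Longrightarrow> \<tau> \<in> galois_automorphisms \<Longrightarrow>
      \<chi>\<^sub>a \<sigma> * \<chi>\<^sub>b \<tau> = \<phi> \<sigma> + \<phi> \<tau> - \<phi> (\<sigma> \<otimes>\<^sub>G \<tau>)"
  obtains d :: "'p mod_ring \<Rightarrow> 'a alg_closure"
  where "\<forall>i. d i \<in> sep_closure"
    "\<forall>\<sigma>\<in>galois_automorphisms. \<forall>i. \<sigma> (d i) = d (i + \<chi>\<^sub>a \<sigma>)"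
    "(\<Prod>i\<in>UNIV. d i) = to_ac b"
proof -
  let ?G = "absolute_galois_group :: ('a alg_closure \<Rightarrow> 'a alg_closure) topgroup"
  note mult = kummer_char_mult[OF prim] and pow = kummer_char_pow[OF prim]
    and kinv = kummer_char_inv[OF prim]
  have one_G: "\<one>\<^bsub>?G\<^esub> \<in> galois_automorphisms" by (rule galois_one(2))
  have inv_G: "inv\<^bsub>?G\<^esub> \<sigma> \<in> galois_automorphisms" if "\<sigma> \<in> galois_automorphisms" for \<sigma>
    using galois.inv_closed[of \<sigma>] that by simp
  have cob': "\<phi> (\<sigma> \<otimes>\<^sub>G \<tau>) = \<phi> \<sigma> + \<phi> \<tau> - \<chi>\<^sub>a \<sigma> * \<chi>\<^sub>b \<tau>"
    if "\<sigma> \<in> galois_automorphisms" "\<tau> \<in> galois_automorphisms" for \<sigma> \<tau>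
    using cob[OF that] by simp
  obtain s where s: "s \<in> galois_automorphisms" "\<chi>\<^sub>a s = 1" "\<chi>\<^sub>b s = 0"
    by (rule ex_automorphism_kummer_chars_1_0[OF indep])
  have s_pow: "s [^]\<^bsub>?G\<^esub> n \<in> galois_automorphisms" for n :: nat
    using galois.nat_pow_closed[of s n] s(1) by simp
  obtain \<beta> where \<beta>: "\<beta> \<in> sep_closure" "\<beta> ^ CARD('p) = to_ac b"
    by (rule ex_root_in_sep_closure[OF prim to_ac_in_sep_closure])
  note \<beta>_apply = kummer_char_apply[OF prim _ b \<beta>]
  have \<beta>0: "\<beta> \<noteq> 0" using \<beta>(2) b by (auto simp: root_nonzero)
  define H where "H = {\<sigma> \<in> galois_automorphisms. \<chi>\<^sub>a \<sigma> = 0}"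
  have HG: "\<sigma> \<in> galois_automorphisms" if "\<sigma> \<in> H" for \<sigma> using that by (simp add: H_def)
  have H: "subgroup H ?G"
  proof (rule galois.subgroupI)
    show "H \<subseteq> carrier ?G" by (auto simp: H_def)
    show "H \<noteq> {}" using one_G kummer_char_one[OF prim a] by (auto simp: H_def)
    show "inv\<^bsub>?G\<^esub> \<sigma> \<in> H" if "\<sigma> \<in> H" for \<sigma>
      using that inv_G kinv[OF _ a] by (simp add: H_def)
    show "\<sigma> \<otimes>\<^sub>G \<tau> \<in> H" if "\<sigma> \<in> H" "\<tau> \<in> H" for \<sigma> \<tau>
      using that mult[OF _ _ a, of \<sigma> \<tau>] galois_compose(2)[of \<sigma> \<tau>] by (simp add: H_def)
  qed
  \<comment> \<open>This makes the translates of an \<open>H\<close>-invariant element depend on the value of \<open>\<chi>\<^sub>a\<close> only.\<close>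
  have coset: "inv\<^bsub>?G\<^esub> \<tau> \<otimes>\<^sub>G \<sigma> \<in> H" "\<tau> \<otimes>\<^sub>G (inv\<^bsub>?G\<^esub> \<tau> \<otimes>\<^sub>G \<sigma>) = \<sigma>"
    if "\<sigma> \<in> galois_automorphisms" "\<tau> \<in> galois_automorphisms" "\<chi>\<^sub>a \<sigma> = \<chi>\<^sub>a \<tau>" for \<sigma> \<tau>
  proof -
    show "inv\<^bsub>?G\<^esub> \<tau> \<otimes>\<^sub>G \<sigma> \<in> H"
      using that inv_G[OF that(2)] galois_compose(2)[OF inv_G[OF that(2)] that(1)]
      by (simp add: H_def mult[OF inv_G[OF that(2)] that(1) a] kinv[OF that(2) a])
    show "\<tau> \<otimes>\<^sub>G (inv\<^bsub>?G\<^esub> \<tau> \<otimes>\<^sub>G \<sigma>) = \<sigma>"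
      using that inv_G[OF that(2)] by (simp add: galois.m_assoc[symmetric])
  qed
  have \<phi>_one: "\<phi> \<one>\<^bsub>?G\<^esub> = 0"
  proof -
    have "\<one>\<^bsub>?G\<^esub> \<otimes>\<^sub>G \<one>\<^bsub>?G\<^esub> = \<one>\<^bsub>?G\<^esub>" using galois.r_one[of "\<one>\<^bsub>?G\<^esub>"] one_G by simp
    then have "\<phi> \<one>\<^bsub>?G\<^esub> = \<phi> \<one>\<^bsub>?G\<^esub> + \<phi> \<one>\<^bsub>?G\<^esub> - 0"
      using cob'[OF one_G one_G] unfolding kummer_char_one[OF prim a] by (simp only: mult_zero_left)
    then show ?thesis by (metis add_cancel_right_left diff_zero)
  qed
  obtain T where T: "finite T" "T \<subseteq> sep_closure"
    "\<forall>\<sigma>\<in>galois_automorphisms. (\<forall>t\<in>T. \<sigma> t = t) \<longrightarrow> \<phi> \<sigma> = \<phi> \<one>\<^bsub>?G\<^esub>"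
    by (rule cochain_locally_constant[OF \<phi>])
  obtain \<gamma> where \<gamma>: "\<gamma> \<in> sep_closure" "\<gamma> \<noteq> 0"
    and "\<forall>\<sigma>\<in>H. \<sigma> \<gamma> = to_ac (root_power \<xi> (\<phi> \<sigma>)) * \<gamma>"
  proof (rule hilbert_90[OF H, where \<psi> = "\<lambda>\<sigma>. root_power \<xi> (\<phi> \<sigma>)"])
    show "root_power \<xi> (\<phi> (\<sigma> \<otimes>\<^sub>G \<tau>)) = root_power \<xi> (\<phi> \<sigma>) * root_power \<xi> (\<phi> \<tau>)"
      if "\<sigma> \<in> H" "\<tau> \<in> H" for \<sigma> \<tau>
    proof -
      have "\<phi> (\<sigma> \<otimes>\<^sub>G \<tau>) = \<phi> \<sigma> + \<phi> \<tau>"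
        using cob'[OF HG[OF that(1)] HG[OF that(2)]] that(1) by (simp add: H_def)
      then show ?thesis by (simp add: root_power_add[OF prim])
    qed
    show "root_power \<xi> (\<phi> \<sigma>) = 1" if "\<sigma> \<in> H" "\<And>t. t \<in> T \<Longrightarrow> \<sigma> t = t" for \<sigma>
      using T(3) HG[OF that(1)] that(2) by (simp add: \<phi>_one root_power_0[OF prim])
  qed (use T root_power_nonzero[OF prim] in auto)
  then have \<gamma>_apply: "\<sigma> \<gamma> = to_ac (root_power \<xi> (\<phi> \<sigma>)) * \<gamma>" if "\<sigma> \<in> H" for \<sigma>
    using that by blast
  define \<delta> where "\<delta> = \<gamma> * \<beta> * inverse (s \<gamma>)"
  have s\<gamma>: "s \<gamma> \<in> sep_closure" "s \<gamma> \<noteq> 0"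
    using galois_closed[OF s(1) \<gamma>(1)] galois_eq_0[OF s(1) \<gamma>(1)] \<gamma>(2) by auto
  have \<delta>_sep: "\<delta> \<in> sep_closure"
    unfolding \<delta>_def by (intro sep_closure_mult sep_closure_inverse \<gamma> \<beta> s\<gamma>)
  have \<delta>_fixed: "h \<delta> = \<delta>" if h: "h \<in> H" for h
  proof -
    let ?h' = "inv\<^bsub>?G\<^esub> s \<otimes>\<^sub>G (h \<otimes>\<^sub>G s)"
    have hG: "h \<in> galois_automorphisms" "\<chi>\<^sub>a h = 0" using h by (simp_all add: H_def)
    have hs: "h \<otimes>\<^sub>G s \<in> galois_automorphisms" "\<chi>\<^sub>a (h \<otimes>\<^sub>G s) = \<chi>\<^sub>a s"
      using galois_compose(2)[OF hG(1) s(1)] by (simp_all add: mult[OF hG(1) s(1) a] hG(2))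
    note h' = coset[OF hs(1) s(1) hs(2)]
    have \<chi>h': "\<chi>\<^sub>b ?h' = \<chi>\<^sub>b h"
      by (simp add: mult[OF inv_G[OF s(1)] hs(1) b] kinv[OF s(1) b] mult[OF hG(1) s(1) b])
    have "\<phi> (h \<otimes>\<^sub>G s) = \<phi> h + \<phi> s"
      using cob'[OF hG(1) s(1)] by (simp add: hG(2))
    moreover have "\<phi> (s \<otimes>\<^sub>G ?h') = \<phi> s + \<phi> ?h' - \<chi>\<^sub>b h"
      using cob'[OF s(1) HG[OF h'(1)]] by (simp add: s(2) \<chi>h')
    ultimately have \<phi>h': "\<phi> ?h' = \<phi> h + \<chi>\<^sub>b h" unfolding h'(2) by (simp add: algebra_simps)
    have "h (s \<gamma>) = (h \<otimes>\<^sub>G s) \<gamma>" by (rule galois_compose(1)[OF hG(1) s(1) \<gamma>(1), symmetric])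
    also have "\<dots> = (s \<otimes>\<^sub>G ?h') \<gamma>" by (simp only: h'(2))
    also have "\<dots> = s (?h' \<gamma>)" by (rule galois_compose(1)[OF s(1) HG[OF h'(1)] \<gamma>(1)])
    also have "\<dots> = s (to_ac (root_power \<xi> (\<phi> h + \<chi>\<^sub>b h)) * \<gamma>)"
      by (simp only: \<gamma>_apply[OF h'(1)] \<phi>h')
    also have "\<dots> = to_ac (root_power \<xi> (\<phi> h + \<chi>\<^sub>b h)) * s \<gamma>"
      by (simp add: galois_mult[OF s(1) to_ac_in_sep_closure \<gamma>(1)] galois_base[OF s(1)])
    finally have hs\<gamma>: "h (s \<gamma>) = to_ac (root_power \<xi> (\<phi> h + \<chi>\<^sub>b h)) * s \<gamma>" .
    define u v where "u = to_ac (root_power \<xi> (\<phi> h))" and "v = to_ac (root_power \<xi> (\<chi>\<^sub>b h))"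
    have uv: "u \<noteq> 0" "v \<noteq> 0" using root_power_nonzero[OF prim] by (simp_all add: u_def v_def)
    have "h \<delta> = h \<gamma> * h \<beta> * inverse (h (s \<gamma>))"
      unfolding \<delta>_def using \<gamma>(1) \<beta>(1) s\<gamma>(1)
      by (simp add: galois_mult[OF hG(1)] galois_inverse[OF hG(1)] sep_closure_mult sep_closure_inverse)
    also have "\<dots> = u * \<gamma> * (v * \<beta>) * inverse (u * v * s \<gamma>)"
      unfolding hs\<gamma> \<gamma>_apply[OF h] \<beta>_apply[OF hG(1)]
      by (simp add: u_def v_def root_power_add[OF prim])
    \<comment> \<open>The root of unity \<open>u\<close> from \<open>\<gamma>\<close> and the root of unity \<open>v\<close> from \<open>\<beta>\<close> both cancel against
      those from \<open>s \<gamma>\<close>.\<close>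
    also have "\<dots> = \<delta>"
      using uv by (simp add: \<delta>_def field_simps)
    finally show ?thesis .
  qed
  have same: "\<sigma> \<delta> = \<tau> \<delta>"
    if "\<sigma> \<in> galois_automorphisms" "\<tau> \<in> galois_automorphisms" "\<chi>\<^sub>a \<sigma> = \<chi>\<^sub>a \<tau>" for \<sigma> \<tau>
    using galois_compose(1)[OF that(2) HG[OF coset(1)[OF that]] \<delta>_sep]
    unfolding coset(2)[OF that] \<delta>_fixed[OF coset(1)[OF that]] .
  define d where "d i = (s [^]\<^bsub>?G\<^esub> nat (to_int_mod_ring i)) \<delta>" for i :: "'p mod_ring"
  have \<chi>_s: "\<chi>\<^sub>a (s [^]\<^bsub>?G\<^esub> n) = of_nat n" "\<chi>\<^sub>b (s [^]\<^bsub>?G\<^esub> n) = 0" for n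
    using pow[OF s(1) a, of n] pow[OF s(1) b, of n] by (simp_all add: s(2,3))
  have d_eq: "\<sigma> \<delta> = d (\<chi>\<^sub>a \<sigma>)" if "\<sigma> \<in> galois_automorphisms" for \<sigma>
    unfolding d_def by (rule same[OF that s_pow]) (simp add: \<chi>_s)
  show thesis
  proof
    show "\<forall>i. d i \<in> sep_closure"
      unfolding d_def using galois_closed[OF s_pow \<delta>_sep] by blast
    show "\<forall>\<sigma>\<in>galois_automorphisms. \<forall>i. \<sigma> (d i) = d (i + \<chi>\<^sub>a \<sigma>)"
    proof (intro ballI allI)
      fix \<sigma> :: "'a alg_closure \<Rightarrow> 'a alg_closure" and i :: "'p mod_ring"
      assume \<sigma>: "\<sigma> \<in> galois_automorphisms"
      let ?t = "s [^]\<^bsub>?G\<^esub> nat (to_int_mod_ring i)"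
      have "\<sigma> (d i) = (\<sigma> \<otimes>\<^sub>G ?t) \<delta>"
        unfolding d_def by (rule galois_compose(1)[OF \<sigma> s_pow \<delta>_sep, symmetric])
      also have "\<dots> = d (\<chi>\<^sub>a (\<sigma> \<otimes>\<^sub>G ?t))"
        by (rule d_eq[OF galois_compose(2)[OF \<sigma> s_pow]])
      also have "\<chi>\<^sub>a (\<sigma> \<otimes>\<^sub>G ?t) = i + \<chi>\<^sub>a \<sigma>"
        by (simp add: mult[OF \<sigma> s_pow a] \<chi>_s add.commute)
      finally show "\<sigma> (d i) = d (i + \<chi>\<^sub>a \<sigma>)" .
    qed
    \<comment> \<open>The definition of \<open>\<delta>\<close> says \<open>s \<gamma> * \<delta> = \<gamma> * \<beta>\<close>; apply the powers of \<open>s\<close>, which fix \<open>\<beta>\<close>.\<close>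
    have telescope: "(s [^]\<^bsub>?G\<^esub> n) \<gamma> * (\<Prod>j<n. (s [^]\<^bsub>?G\<^esub> j) \<delta>) = \<gamma> * \<beta> ^ n" for n
    proof (induction n)
      case 0
      show ?case using galois_one(1)[OF \<gamma>(1)] by simp
    next
      case (Suc n)
      let ?t = "s [^]\<^bsub>?G\<^esub> n"
      note t = s_pow[of n]
      have "s \<gamma> * \<delta> = \<gamma> * \<beta>" using s\<gamma>(2) by (simp add: \<delta>_def field_simps)
      then have "?t (s \<gamma>) * ?t \<delta> = ?t \<gamma> * ?t \<beta>"
        using galois_mult[OF t s\<gamma>(1) \<delta>_sep] galois_mult[OF t \<gamma>(1) \<beta>(1)] by simp
      also have "?t \<beta> = \<beta>" by (simp add: \<beta>_apply[OF t] \<chi>_s root_power_0[OF prim])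
      finally have step: "?t (s \<gamma>) * ?t \<delta> = ?t \<gamma> * \<beta>" .
      have "(s [^]\<^bsub>?G\<^esub> Suc n) \<gamma> = ?t (s \<gamma>)"
        using galois_compose(1)[OF t s(1) \<gamma>(1)] by simp
      then have "(s [^]\<^bsub>?G\<^esub> Suc n) \<gamma> * (\<Prod>j<Suc n. (s [^]\<^bsub>?G\<^esub> j) \<delta>) =
          (?t (s \<gamma>) * ?t \<delta>) * (\<Prod>j<n. (s [^]\<^bsub>?G\<^esub> j) \<delta>)"
        by (simp add: mult_ac)
      also have "\<dots> = \<gamma> * \<beta> ^ Suc n"
        unfolding step using Suc.IH by (simp add: mult_ac)
      finally show ?case .
    qed
    have "\<phi> (s [^]\<^bsub>?G\<^esub> n) = of_nat n * \<phi> s" for n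
    proof (induction n)
      case (Suc n)
      then show ?case using cob'[OF s_pow s(1), of n] by (simp add: s(3) algebra_simps)
    qed (simp add: \<phi>_one)
    then have "\<phi> (s [^]\<^bsub>?G\<^esub> CARD('p)) = 0" by simp
    moreover have "s [^]\<^bsub>?G\<^esub> CARD('p) \<in> H" using s_pow by (simp add: H_def \<chi>_s)
    ultimately have "(s [^]\<^bsub>?G\<^esub> CARD('p)) \<gamma> = \<gamma>"
      using \<gamma>_apply[of "s [^]\<^bsub>?G\<^esub> CARD('p)"] by (simp add: root_power_0[OF prim])
    then have "(\<Prod>j<CARD('p). (s [^]\<^bsub>?G\<^esub> j) \<delta>) = to_ac b"
      using telescope[of "CARD('p)"] \<gamma>(2) by (simp add: \<beta>(2))
    moreover have "(\<Prod>i\<in>UNIV. d i) = (\<Prod>j<CARD('p). (s [^]\<^bsub>?G\<^esub> j) \<delta>)"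
    proof (rule prod.reindex_bij_witness[of _ "\<lambda>j. of_nat j" "\<lambda>i. nat (to_int_mod_ring i)"])
      fix j assume "j \<in> {..<CARD('p)}"
      then show "nat (to_int_mod_ring (of_nat j :: 'p mod_ring)) = j"
        by (simp add: of_nat_of_int_mod_ring)
    next
      fix i :: "'p mod_ring"
      have "to_int_mod_ring i \<in> {0..<int CARD('p)}" using range_to_int_mod_ring by blast
      then show "nat (to_int_mod_ring i) \<in> {..<CARD('p)}" by auto
    qed (simp_all add: d_def)
    ultimately show "(\<Prod>i\<in>UNIV. d i) = to_ac b" by simp
  qed
qed

text \<open>
  Choose a \<open>p\<close>-th root \<open>\<epsilon> i\<close> of each \<open>d i\<close>. Then \<open>\<sigma> (\<epsilon> i)\<close> and \<open>\<epsilon> (i + \<chi>\<^sub>a \<sigma>)\<close> have the same \<open>p\<close>-th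
  power, and \<open>f i \<sigma>\<close> is the exponent of the root of unity between them. The product of the \<open>\<epsilon> i\<close> is a
  \<open>p\<close>-th root of \<open>b\<close>, which identifies the sum of the \<open>f i\<close> with \<open>\<chi>\<^sub>b\<close>.
\<close>

lemma ex_twisted_family:
  assumes d: "\<forall>i. d i \<in> sep_closure"
    "\<forall>\<sigma>\<in>galois_automorphisms. \<forall>i. \<sigma> (d i) = d (i + \<chi>\<^sub>a \<sigma>)" "(\<Prod>i\<in>UNIV. d i) = to_ac b"
  obtains f :: "'p mod_ring \<Rightarrow> ('a alg_closure \<Rightarrow> 'a alg_closure) \<Rightarrow> 'p mod_ring"
  where "\<forall>i. f i \<in> cochains1 absolute_galois_group"
    "\<forall>i. \<forall>\<sigma>\<in>galois_automorphisms. \<forall>\<tau>\<in>galois_automorphisms.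
      f i (\<sigma> \<otimes>\<^sub>G \<tau>) = f i \<tau> + f (i + \<chi>\<^sub>a \<tau>) \<sigma>"
    "\<forall>\<sigma>\<in>galois_automorphisms. \<chi>\<^sub>b \<sigma> = (\<Sum>i\<in>UNIV. f i \<sigma>)"
proof -
  have "\<forall>i. \<exists>e. e \<in> sep_closure \<and> e ^ CARD('p) = d i"
    using ex_root_in_sep_closure[OF prim] d(1) by metis
  then obtain \<epsilon> where \<epsilon>: "\<And>i. \<epsilon> i \<in> sep_closure" "\<And>i. \<epsilon> i ^ CARD('p) = d i" by metis
  have prod_\<epsilon>: "(\<Prod>i\<in>UNIV. \<epsilon> i) ^ CARD('p) = to_ac b"
    by (simp add: prod_power_distrib \<epsilon>(2) d(3))
  then have "(\<Prod>i\<in>UNIV. \<epsilon> i) \<noteq> 0" using b by (auto simp: root_nonzero)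
  then have \<epsilon>0: "\<epsilon> i \<noteq> 0" for i by simp
  define f where "f i \<sigma> = (THE c :: 'p mod_ring. \<sigma> (\<epsilon> i) = to_ac (root_power \<xi> c) * \<epsilon> (i + \<chi>\<^sub>a \<sigma>))" for i \<sigma>
  have unique: "c = c'"
    if "x = to_ac (root_power \<xi> c) * \<epsilon> i" "x = to_ac (root_power \<xi> c') * \<epsilon> i" for x i and c c' :: "'p mod_ring"
    using that \<epsilon>0[of i] by (simp add: root_power_inject[OF prim])
  have f: "\<sigma> (\<epsilon> i) = to_ac (root_power \<xi> (f i \<sigma>)) * \<epsilon> (i + \<chi>\<^sub>a \<sigma>)"
    if \<sigma>: "\<sigma> \<in> galois_automorphisms" for i \<sigma>
  proof -
    have "\<sigma> (\<epsilon> i) ^ CARD('p) = \<epsilon> (i + \<chi>\<^sub>a \<sigma>) ^ CARD('p)"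
      using galois_power[OF \<sigma> \<epsilon>(1), of i "CARD('p)"] d(2) \<sigma> by (simp add: \<epsilon>(2))
    then obtain c :: "'p mod_ring" where c: "\<sigma> (\<epsilon> i) = to_ac (root_power \<xi> c) * \<epsilon> (i + \<chi>\<^sub>a \<sigma>)"
      by (rule equal_powers_root_power[OF prim _ \<epsilon>0])
    then have "f i \<sigma> = c" unfolding f_def by (rule the_equality) (rule unique[OF _ c])
    then show ?thesis using c by simp
  qed
  show thesis
  proof
    show "\<forall>i. f i \<in> cochains1 absolute_galois_group"
    proof
      fix i
      show "f i \<in> cochains1 absolute_galois_group"
        using continuous_map_discrete_combine[OF evaluation_continuous[OF \<epsilon>(1)[of i], of "\<lambda>x. x"]
            kummer_char_in_cochains1[OF prim a, unfolded cochains1_def mem_Collect_eq],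
            of "\<lambda>x t. THE c :: 'p mod_ring. x = to_ac (root_power \<xi> c) * \<epsilon> (i + t)"]
        by (simp add: f_def[abs_def] cochains1_def)
    qed
    show "\<forall>i. \<forall>\<sigma>\<in>galois_automorphisms. \<forall>\<tau>\<in>galois_automorphisms.
      f i (\<sigma> \<otimes>\<^sub>G \<tau>) = f i \<tau> + f (i + \<chi>\<^sub>a \<tau>) \<sigma>"
    proof (intro allI ballI)
      fix i :: "'p mod_ring" and \<sigma> \<tau> :: "'a alg_closure \<Rightarrow> 'a alg_closure"
      assume \<sigma>: "\<sigma> \<in> galois_automorphisms" and \<tau>: "\<tau> \<in> galois_automorphisms"
      have \<chi>: "i + \<chi>\<^sub>a (\<sigma> \<otimes>\<^sub>G \<tau>) = i + \<chi>\<^sub>a \<tau> + \<chi>\<^sub>a \<sigma>"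
        by (simp add: kummer_char_mult[OF prim \<sigma> \<tau> a] algebra_simps)
      have "(\<sigma> \<otimes>\<^sub>G \<tau>) (\<epsilon> i) = \<sigma> (\<tau> (\<epsilon> i))" by (rule galois_compose(1)[OF \<sigma> \<tau> \<epsilon>(1)])
      also have "\<dots> = \<sigma> (to_ac (root_power \<xi> (f i \<tau>)) * \<epsilon> (i + \<chi>\<^sub>a \<tau>))" by (simp only: f[OF \<tau>])
      also have "\<dots> = to_ac (root_power \<xi> (f i \<tau>)) * \<sigma> (\<epsilon> (i + \<chi>\<^sub>a \<tau>))"
        by (simp add: galois_mult[OF \<sigma> to_ac_in_sep_closure \<epsilon>(1)] galois_base[OF \<sigma>])
      also have "\<dots> = to_ac (root_power \<xi> (f i \<tau>)) *
          (to_ac (root_power \<xi> (f (i + \<chi>\<^sub>a \<tau>) \<sigma>)) * \<epsilon> (i + \<chi>\<^sub>a \<tau> + \<chi>\<^sub>a \<sigma>))"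
        by (simp only: f[OF \<sigma>])
      also have "\<dots> = to_ac (root_power \<xi> (f i \<tau> + f (i + \<chi>\<^sub>a \<tau>) \<sigma>)) * \<epsilon> (i + \<chi>\<^sub>a (\<sigma> \<otimes>\<^sub>G \<tau>))"
        unfolding \<chi> by (simp add: root_power_add[OF prim])
      finally show "f i (\<sigma> \<otimes>\<^sub>G \<tau>) = f i \<tau> + f (i + \<chi>\<^sub>a \<tau>) \<sigma>"
        by (intro unique[OF f[OF galois_compose(2)[OF \<sigma> \<tau>]]])
    qed
    show "\<forall>\<sigma>\<in>galois_automorphisms. \<chi>\<^sub>b \<sigma> = (\<Sum>i\<in>UNIV. f i \<sigma>)"
    proof
      fix \<sigma> :: "'a alg_closure \<Rightarrow> 'a alg_closure" assume \<sigma>: "\<sigma> \<in> galois_automorphisms"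
      have "\<sigma> (\<Prod>i\<in>UNIV. \<epsilon> i) = (\<Prod>i\<in>UNIV. \<sigma> (\<epsilon> i))" by (rule galois_prod[OF \<sigma> \<epsilon>(1)])
      also have "\<dots> = to_ac (\<Prod>i\<in>UNIV. root_power \<xi> (f i \<sigma>)) * (\<Prod>i\<in>UNIV. \<epsilon> (i + \<chi>\<^sub>a \<sigma>))"
        by (simp add: f[OF \<sigma>] prod.distrib to_ac_prod)
      also have "(\<Prod>i\<in>UNIV. \<epsilon> (i + \<chi>\<^sub>a \<sigma>)) = (\<Prod>i\<in>UNIV. \<epsilon> i)"
        by (rule prod.reindex_bij_witness[of _ "\<lambda>i. i - \<chi>\<^sub>a \<sigma>" "\<lambda>i. i + \<chi>\<^sub>a \<sigma>"]) auto
      also have "(\<Prod>i\<in>UNIV. root_power \<xi> (f i \<sigma>)) = root_power \<xi> (\<Sum>i\<in>UNIV. f i \<sigma>)"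
        by (rule root_power_sum[OF prim, symmetric])
      finally show "\<chi>\<^sub>b \<sigma> = (\<Sum>i\<in>UNIV. f i \<sigma>)"
        by (rule kummer_char_eqI[OF prim \<sigma> b sep_closure_prod[OF \<epsilon>(1)] prod_\<epsilon>])
    qed
  qed
qed

end

section \<open>Vanishing of the Massey products\<close>

theorem theorem5p9:
  fixes \<xi> a b :: "'a::field"
    and p k :: nat
    and \<chi>a \<chi>b :: "('a alg_closure \<Rightarrow> 'a alg_closure) \<Rightarrow> 'p::prime_card mod_ring"
    and G :: "('a alg_closure \<Rightarrow> 'a alg_closure) topgroup"
  assumes "p = CARD('p)"
    and "primitive_root_of_unity p \<xi>"
    and "a \<noteq> 0" and "b \<noteq> 0"
    and "independent_mod_powers p a b"
    and "0 < k" and "k < p"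
    and "G = absolute_galois_group"
    and "\<chi>a = kummer_char \<xi> a" and "\<chi>b = kummer_char \<xi> b"
    and "H2_class G (cup \<chi>a \<chi>b) = H2_zero G"
  shows "(massey_defined G (\<chi>b # replicate k \<chi>a) \<and>
          H2_zero G \<in> massey_product G (\<chi>b # replicate k \<chi>a)) \<and>
         (massey_defined G (replicate k \<chi>a @ [\<chi>b]) \<and>
          H2_zero G \<in> massey_product G (replicate k \<chi>a @ [\<chi>b])) \<and>
         (massey_defined G (\<chi>a # \<chi>b # replicate k \<chi>a) \<and>
          H2_zero G \<in> massey_product G (\<chi>a # \<chi>b # replicate k \<chi>a)) \<and>
         (massey_defined G (replicate k \<chi>a @ [\<chi>b, \<chi>a]) \<and>
          H2_zero G \<in> massey_product G (replicate k \<chi>a @ [\<chi>b, \<chi>a]))"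
proof -
  have prim: "primitive_root_of_unity CARD('p) \<xi>" and indep: "independent_mod_powers CARD('p) a b"
    using assms by simp_all
  have G: "carrier G = galois_automorphisms" "group G"
    using assms(8) group_absolute_galois_group by simp_all
  obtain \<phi> where \<phi>: "\<phi> \<in> cochains1 G"
    "\<forall>\<sigma>\<in>carrier G. \<forall>\<tau>\<in>carrier G. cup \<chi>a \<chi>b \<sigma> \<tau> = coboundary1 G \<phi> \<sigma> \<tau>"
    by (rule H2_zero_imp_coboundary[OF assms(11)])
  obtain d where d: "\<forall>i. d i \<in> sep_closure"
    "\<forall>\<sigma>\<in>galois_automorphisms. \<forall>i. \<sigma> (d i) = d (i + \<chi>a \<sigma>)" "(\<Prod>i\<in>UNIV. d i) = to_ac b"
    using ex_norm_family[OF prim assms(3,4) indep, of \<phi>] \<phi> G(1)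
    by (auto simp: assms(8-10) cup_def coboundary1_def)
  obtain f where f: "\<forall>i. f i \<in> cochains1 G"
    "\<forall>i. \<forall>\<sigma>\<in>galois_automorphisms. \<forall>\<tau>\<in>galois_automorphisms.
      f i (\<sigma> \<otimes>\<^bsub>G\<^esub> \<tau>) = f i \<tau> + f (i + \<chi>a \<tau>) \<sigma>"
    "\<forall>\<sigma>\<in>galois_automorphisms. \<chi>b \<sigma> = (\<Sum>i\<in>UNIV. f i \<sigma>)"
    using ex_twisted_family[OF prim assms(3,4), of d] d unfolding assms(8-10) by blast
  have "massey_defined G as \<and> H2_zero G \<in> massey_product G as"
    if "as \<in> {\<chi>b # replicate k \<chi>a, replicate k \<chi>a @ [\<chi>b],
      \<chi>a # \<chi>b # replicate k \<chi>a, replicate k \<chi>a @ [\<chi>b, \<chi>a]}" for as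
  proof (rule massey_of_twisted_family[OF G(2) assms(6) _ _ _ _ _ _ that])
    show "k < CARD('p)" using assms(1,7) by simp
    show "\<chi>a \<in> cochains1 G"
      unfolding assms(8,9) by (rule kummer_char_in_cochains1[OF prim assms(3)])
    show "\<chi>a (\<sigma> \<otimes>\<^bsub>G\<^esub> \<tau>) = \<chi>a \<sigma> + \<chi>a \<tau>" if "\<sigma> \<in> carrier G" "\<tau> \<in> carrier G" for \<sigma> \<tau>
      using that unfolding assms(8,9) by (simp add: kummer_char_mult[OF prim _ _ assms(3)])
  qed (use f G(1) in auto)
  then show ?thesis by simp
qed

end
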